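(* Let $n\in\mathbb{N}$, let $\phi=(\phi_1,\dots,\phi_n):U^n\to U^n$ be holomorphic, and let $p\ge 1$ and $q>0$. Then $C_\phi$ is a compact operator from $\mathcal{B}^p_0(U^n)$ to $\mathcal{B}^q_0(U^n)$ if and only if $\phi^\gamma\in\mathcal{B}^q_0(U^n)$ for every $n$-multi-index $\gamma$ and $$\lim_{\phi(z)\to\partial U^n}\ \sum_{k,l=1}^n\left|\frac{\partial \phi_l}{\partial z_k}(z)\right|\frac{(1-|z_k|^2)^q}{(1-|\phi_l(z)|^2)^p}=0 .$$
   Context: $U$ is the open unit disk in $\mathbb{C}$, $U^n\subset\mathbb{C}^n$ is the open unit polydisk, and $\partial U^n$ is its topological boundary. For a holomorphic self-map $\phi$ of $U^n$, the composition operator is $C_\phi f=f\circ\phi$ for $f$ holomorphic on $U^n$. An $n$-multi-index is an $n$-tuple $\gamma=(\gamma_1,\dots,\gamma_n)$ of nonnegative integers, and $\phi^\gamma=\phi_1^{\gamma_1}\cdots\phi_n^{\gamma_n}$. For $p>0$, the $p$-Bloch space $\mathcal{B}^p(U^n)$ is the Banach space of holomorphic $f:U^n\to\mathbb{C}$ with finite norm $$\|f\|_{\mathcal{B}^p}=|f(0)|+\sup_{z\in U^n}\sum_{k=1}^n\left|\frac{\partial f}{\partial z_k}(z)\right|(1-|z_k|^2)^p .$$ The little $p$-Bloch space $\mathcal{B}^p_0(U^n)$ is the closure of the polynomials in $\mathcal{B}^p(U^n)$, with the same norm. The limit condition $\lim_{\phi(z)\to\partial U^n}S(z)=0$ means: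 for every $\varepsilon>0$ there is $\delta>0$ such that $|S(z)|<\varepsilon$ for all $z\in U^n$ whose image $\phi(z)$ has Euclidean distance less than $\delta$ to $\partial U^n$ (vacuously true if $\phi(U^n)$ stays away from $\partial U^n$). A compact operator from $X$ to $Y$ is in particular required to map $X$ into $Y$. *)

theory Defs
  imports "HOL-Analysis.Analysis"
begin

definition polydisk :: "(complex ^ 'n) set" where
  "polydisk = {z. \<forall>k. cmod (z $ k) < 1}"

text \<open>Holomorphy in several variables: Frechet differentiable with complex-linear derivative.\<close>

definition holomorphic_several :: "(complex ^ 'n \<Rightarrow> complex) \<Rightarrow> (complex ^ 'n) set \<Rightarrow> bool" where
  "holomorphic_several f S \<longleftrightarrow>
     (\<forall>z\<in>S. \<exists>D. (f has_derivative D) (at z) \<and> (\<forall>c v. D (c *s v) = c * D v))"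

definition holomorphic_self_map :: "(complex ^ 'n \<Rightarrow> complex ^ 'n) \<Rightarrow> bool" where
  "holomorphic_self_map \<phi> \<longleftrightarrow>
     \<phi> \<in> polydisk \<rightarrow> polydisk \<and> (\<forall>l. holomorphic_several (\<lambda>z. \<phi> z $ l) polydisk)"

definition partial_deriv :: "'n \<Rightarrow> (complex ^ 'n \<Rightarrow> complex) \<Rightarrow> complex ^ 'n \<Rightarrow> complex" where
  "partial_deriv k f z = deriv (\<lambda>w. f (\<chi> j. if j = k then w else z $ j)) (z $ k)"

text \<open>A function on the polydisk is represented by its extension by zero to the whole type, so
  that equality of functions on the polydisk is equality in HOL.\<close>

definition zero_ext :: "(complex ^ 'n \<Rightarrow> complex) \<Rightarrow> complex ^ 'n \<Rightarrow> complex" where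
  "zero_ext f = (\<lambda>z. if z \<in> polydisk then f z else 0)"

definition bloch_weight :: "real \<Rightarrow> (complex ^ 'n \<Rightarrow> complex) \<Rightarrow> complex ^ 'n \<Rightarrow> real" where
  "bloch_weight p f z = (\<Sum>k\<in>UNIV. cmod (partial_deriv k f z) * (1 - (cmod (z $ k))\<^sup>2) powr p)"

definition bloch :: "real \<Rightarrow> (complex ^ 'n \<Rightarrow> complex) set" where
  "bloch p = {f. holomorphic_several f polydisk \<and> (\<forall>z. z \<notin> polydisk \<longrightarrow> f z = 0) \<and>
                 bdd_above (bloch_weight p f ` polydisk)}"

definition bloch_norm :: "real \<Rightarrow> (complex ^ 'n \<Rightarrow> complex) \<Rightarrow> real" where
  "bloch_norm p f = cmod (f 0) + (SUP z\<in>polydisk. bloch_weight p f z)"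

text \<open>The value 0 off the space is immaterial; it is there because the locale
  \<^locale>\<open>Metric_space\<close> asks for nonnegativity and symmetry on the whole type.\<close>

definition bloch_dist ::
  "real \<Rightarrow> (complex ^ 'n \<Rightarrow> complex) \<Rightarrow> (complex ^ 'n \<Rightarrow> complex) \<Rightarrow> real" where
  "bloch_dist p f g =
     (if f \<in> bloch p \<and> g \<in> bloch p then bloch_norm p (\<lambda>z. f z - g z) else 0)"

lemma convex_polydisk: "convex (polydisk :: (complex ^ 'n) set)"
proof -
  have *: "polydisk = (\<Inter>k. (\<lambda>z. z $ k) -` ball 0 1 :: (complex ^ 'n) set)"
    by (auto simp: polydisk_def)
  have "convex ((\<lambda>z. z $ k) -` ball 0 1 :: (complex ^ 'n) set)" for k
    by (intro convex_linear_vimage bounded_linear.linear bounded_linear_vec_nth convex_ball)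
  then show ?thesis unfolding * by (intro convex_INT)
qed

lemma zero_in_polydisk: "0 \<in> polydisk"
  by (simp add: polydisk_def)

lemma partial_deriv_eq:
  fixes f :: "complex ^ 'n \<Rightarrow> complex"
  assumes D: "(f has_derivative D) (at z)" and lin: "\<And>c v. D (c *s v) = c * D v"
  shows "partial_deriv k f z = D (axis k 1)"
proof -
  let ?s = "\<lambda>w. (\<chi> j. if j = k then w else z $ j) :: complex ^ 'n"
  have s: "?s = (\<lambda>w. z + (w - z $ k) *s axis k 1)"
    by (auto simp: fun_eq_iff vec_eq_iff axis_def)
  have "((\<lambda>w. ?s w) has_derivative (\<lambda>h. h *s axis k 1)) (at (z $ k))"
  proof -
    have bl: "bounded_linear (\<lambda>h. h *s (axis k 1 :: complex ^ 'n))"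
      by (intro linear_conv_bounded_linear [THEN iffD1] linearI)
        (auto simp: vec_eq_iff algebra_simps)
    have "((\<lambda>w. (w - z $ k) *s axis k 1) has_derivative (\<lambda>h. h *s (axis k 1 :: complex ^ 'n)))
            (at (z $ k))"
      by (rule bounded_linear.has_derivative [OF bl]) (auto intro!: derivative_eq_intros)
    from has_derivative_add [OF has_derivative_const this] show ?thesis
      unfolding s by (simp only: add_0)
  qed
  moreover have "?s (z $ k) = z" by (auto simp: vec_eq_iff)
  ultimately have "((\<lambda>w. f (?s w)) has_derivative (\<lambda>h. D (h *s axis k 1))) (at (z $ k))"
    using D has_derivative_compose [of ?s "\<lambda>h. h *s axis k 1" "z $ k" UNIV f D] by simp
  then have *: "((\<lambda>w. f (?s w)) has_field_derivative D (axis k 1)) (at (z $ k))"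
    unfolding has_field_derivative_def lin by (simp only: mult_commute_abs)
  show "partial_deriv k f z = D (axis k 1)"
    unfolding partial_deriv_def by (rule DERIV_imp_deriv [OF *])
qed

lemma holomorphic_severalE:
  assumes "holomorphic_several f S" "z \<in> S"
  obtains D where "(f has_derivative D) (at z)" "\<forall>c v. D (c *s v) = c * D v"
proof -
  from bspec [OF assms(1) [unfolded holomorphic_several_def] assms(2)]
  obtain D where D: "(f has_derivative D) (at z) \<and> (\<forall>c v. D (c *s v) = c * D v)" by (elim exE)
  show thesis by (rule that [OF conjunct1 [OF D] conjunct2 [OF D]])
qed

lemma holomorphic_several_linear:
  assumes f: "holomorphic_several f S" and g: "holomorphic_several g S"
  shows "holomorphic_several (\<lambda>z. a * f z + b * g z) S"
    and "z \<in> S \<Longrightarrow> partial_deriv k (\<lambda>z. a * f z + b * g z) z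
                     = a * partial_deriv k f z + b * partial_deriv k g z"
proof -
  have F: "((\<lambda>z. a * f z + b * g z) has_derivative (\<lambda>v. a * D v + b * E v)) (at z)"
    "a * D (c *s v) + b * E (c *s v) = c * (a * D v + b * E v)"
    if "(f has_derivative D) (at z)" "\<And>c v. D (c *s v) = c * D v"
      "(g has_derivative E) (at z)" "\<And>c v. E (c *s v) = c * E v" for z D E c v
  proof -
    show "((\<lambda>z. a * f z + b * g z) has_derivative (\<lambda>v. a * D v + b * E v)) (at z)"
      by (intro has_derivative_add has_derivative_mult_right that)
    show "a * D (c *s v) + b * E (c *s v) = c * (a * D v + b * E v)"
      by (simp only: that(2,4) distrib_left mult.left_commute)
  qed
  show "holomorphic_several (\<lambda>z. a * f z + b * g z) S"
    unfolding holomorphic_several_def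
  proof
    fix z assume "z \<in> S"
    obtain D where D: "(f has_derivative D) (at z)" "\<forall>c v. D (c *s v) = c * D v"
      by (rule holomorphic_severalE [OF f \<open>z \<in> S\<close>])
    obtain E where E: "(g has_derivative E) (at z)" "\<forall>c v. E (c *s v) = c * E v"
      by (rule holomorphic_severalE [OF g \<open>z \<in> S\<close>])
    show "\<exists>D. ((\<lambda>z. a * f z + b * g z) has_derivative D) (at z) \<and> (\<forall>c v. D (c *s v) = c * D v)"
    proof (intro exI conjI allI)
      show "((\<lambda>z. a * f z + b * g z) has_derivative (\<lambda>v. a * D v + b * E v)) (at z)"
        by (rule F(1) [OF D(1) D(2) [rule_format] E(1) E(2) [rule_format]])
      show "a * D (c *s v) + b * E (c *s v) = c * (a * D v + b * E v)" for c v
        by (rule F(2) [OF D(1) D(2) [rule_format] E(1) E(2) [rule_format]])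
    qed
  qed
  show "partial_deriv k (\<lambda>z. a * f z + b * g z) z
                     = a * partial_deriv k f z + b * partial_deriv k g z" if zS: "z \<in> S"
  proof -
    obtain D where D: "(f has_derivative D) (at z)" "\<forall>c v. D (c *s v) = c * D v"
      by (rule holomorphic_severalE [OF f zS])
    obtain E where E: "(g has_derivative E) (at z)" "\<forall>c v. E (c *s v) = c * E v"
      by (rule holomorphic_severalE [OF g zS])
    have "partial_deriv k f z = D (axis k 1)" "partial_deriv k g z = E (axis k 1)"
      by (rule partial_deriv_eq [OF D(1) D(2) [rule_format]], rule partial_deriv_eq [OF E(1) E(2) [rule_format]])
    moreover have "partial_deriv k (\<lambda>z. a * f z + b * g z) z
                     = a * D (axis k 1) + b * E (axis k 1)"
      by (rule partial_deriv_eq [OF F(1) [OF D(1) D(2) [rule_format] E(1) E(2) [rule_format]] F(2) [OF D(1) D(2) [rule_format] E(1) E(2) [rule_format]]])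
    ultimately show ?thesis by (simp only:)
  qed
qed

lemma bloch_weight_nonneg: "0 \<le> bloch_weight p f z"
  by (simp add: bloch_weight_def sum_nonneg)

lemma bloch_weight_linear:
  assumes "holomorphic_several f polydisk" "holomorphic_several g polydisk" "z \<in> polydisk"
  shows "bloch_weight p (\<lambda>z. a * f z + b * g z) z
           \<le> cmod a * bloch_weight p f z + cmod b * bloch_weight p g z"
  unfolding bloch_weight_def sum_distrib_left sum.distrib [symmetric]
proof (rule sum_mono)
  fix k
  have "cmod (partial_deriv k (\<lambda>z. a * f z + b * g z) z)
      \<le> cmod a * cmod (partial_deriv k f z) + cmod b * cmod (partial_deriv k g z)"
    unfolding holomorphic_several_linear(2) [OF assms] norm_mult [symmetric]
    by (rule norm_triangle_ineq)
  from mult_right_mono [OF this, of "(1 - (cmod (z $ k))\<^sup>2) powr p"]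
  show "cmod (partial_deriv k (\<lambda>z. a * f z + b * g z) z) * (1 - (cmod (z $ k))\<^sup>2) powr p
    \<le> cmod a * (cmod (partial_deriv k f z) * (1 - (cmod (z $ k))\<^sup>2) powr p) +
       cmod b * (cmod (partial_deriv k g z) * (1 - (cmod (z $ k))\<^sup>2) powr p)"
    by (simp add: algebra_simps)
qed

lemma bloch_weight_le:
  assumes "f \<in> bloch p" "z \<in> polydisk"
  shows "bloch_weight p f z \<le> (SUP z\<in>polydisk. bloch_weight p f z)"
  using assms by (intro cSUP_upper) (auto simp: bloch_def)

lemma bloch_linear:
  assumes f: "f \<in> bloch p" and g: "g \<in> bloch p"
  shows "(\<lambda>z. a * f z + b * g z) \<in> bloch p"
    and "bloch_norm p (\<lambda>z. a * f z + b * g z) \<le> cmod a * bloch_norm p f + cmod b * bloch_norm p g"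
proof -
  let ?F = "SUP z\<in>polydisk. bloch_weight p f z" and ?G = "SUP z\<in>polydisk. bloch_weight p g z"
  have fh: "holomorphic_several f polydisk" and gh: "holomorphic_several g polydisk"
    using f g by (auto simp: bloch_def)
  have le: "bloch_weight p (\<lambda>z. a * f z + b * g z) z \<le> cmod a * ?F + cmod b * ?G"
    if "z \<in> polydisk" for z
    using bloch_weight_linear [OF fh gh that, of p a b]
      mult_left_mono [OF bloch_weight_le [OF f that] norm_ge_zero [of a]]
      mult_left_mono [OF bloch_weight_le [OF g that] norm_ge_zero [of b]] by linarith
  then have "bdd_above (bloch_weight p (\<lambda>z. a * f z + b * g z) ` polydisk)"
    by (auto intro!: bdd_aboveI)
  with f g holomorphic_several_linear(1) [OF fh gh]
  show "(\<lambda>z. a * f z + b * g z) \<in> bloch p" by (auto simp: bloch_def)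
  have "(SUP z\<in>polydisk. bloch_weight p (\<lambda>z. a * f z + b * g z) z) \<le> cmod a * ?F + cmod b * ?G"
    using zero_in_polydisk by (intro cSUP_least le) auto
  moreover have "cmod (a * f 0 + b * g 0) \<le> cmod a * cmod (f 0) + cmod b * cmod (g 0)"
    unfolding norm_mult [symmetric] by (rule norm_triangle_ineq)
  ultimately
  show "bloch_norm p (\<lambda>z. a * f z + b * g z) \<le> cmod a * bloch_norm p f + cmod b * bloch_norm p g"
    unfolding bloch_norm_def by (simp add: algebra_simps)
qed

lemma bloch_norm_nonneg:
  assumes "f \<in> bloch p" shows "0 \<le> bloch_norm p f"
proof -
  have "0 \<le> bloch_weight p f 0" by (rule bloch_weight_nonneg)
  also have "\<dots> \<le> (SUP z\<in>polydisk. bloch_weight p f z)"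
    by (rule bloch_weight_le [OF assms zero_in_polydisk])
  finally show ?thesis by (simp add: bloch_norm_def)
qed

lemma bloch_norm_eq_0:
  fixes f :: "complex ^ 'n \<Rightarrow> complex"
  assumes f: "f \<in> bloch p" and 0: "bloch_norm p f = 0"
  shows "f = (\<lambda>z. 0)"
proof -
  have "0 \<le> (SUP z\<in>polydisk. bloch_weight p f z)"
    using bloch_weight_le [OF f zero_in_polydisk] bloch_weight_nonneg [of p f 0] by linarith
  with 0 have f0: "f 0 = 0" and S: "(SUP z\<in>polydisk. bloch_weight p f z) = 0"
    unfolding bloch_norm_def by (smt (verit) norm_ge_zero norm_eq_zero)+
  have der: "(f has_derivative (\<lambda>v. 0)) (at z within polydisk)" if z: "z \<in> polydisk" for z
  proof -
    obtain D where D: "(f has_derivative D) (at z)" "\<And>c v. D (c *s v) = c * D v"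
      using f z by (auto simp: bloch_def holomorphic_several_def)
    have "bloch_weight p f z = 0"
      using bloch_weight_le [OF f z] bloch_weight_nonneg [of p f z] S by linarith
    then have "cmod (partial_deriv k f z) * (1 - (cmod (z $ k))\<^sup>2) powr p = 0" for k
      unfolding bloch_weight_def by (subst (asm) sum_nonneg_eq_0_iff) auto
    moreover have "(cmod (z $ k))\<^sup>2 \<noteq> 1" for k
      using z power_less_one_iff [of "cmod (z $ k)" 2] by (fastforce simp: polydisk_def)
    ultimately have ax: "D (axis k 1) = 0" for k
      using partial_deriv_eq [OF D] by fastforce
    have "D v = 0" for v
    proof -
      have "D v = D (\<Sum>k\<in>UNIV. v $ k *s axis k 1)" by (simp add: basis_expansion)
      also have "\<dots> = (\<Sum>k\<in>UNIV. D (v $ k *s axis k 1))"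
        by (rule linear_sum [OF has_derivative_linear [OF D(1)]])
      also have "\<dots> = 0" by (simp add: D(2) ax)
      finally show ?thesis .
    qed
    then have "D = (\<lambda>v. 0)" by auto
    with D show ?thesis using has_derivative_at_withinI by blast
  qed
  obtain c where "\<forall>z\<in>polydisk. f z = c"
    using has_derivative_zero_constant [OF convex_polydisk der] by blast
  with f0 zero_in_polydisk have "\<forall>z\<in>polydisk. f z = 0" by metis
  with f show ?thesis by (auto simp: bloch_def fun_eq_iff)
qed

lemma bloch_diff: "f \<in> bloch p \<Longrightarrow> g \<in> bloch p \<Longrightarrow> (\<lambda>z. f z - g z) \<in> bloch p"
  using bloch_linear(1) [of f p g 1 "-1"] by simp

lemma Metric_space_bloch: "Metric_space (bloch p :: (complex ^ 'n \<Rightarrow> complex) set) (bloch_dist p)"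
proof
  fix f g h :: "complex ^ 'n \<Rightarrow> complex"
  show "0 \<le> bloch_dist p f g"
    by (simp add: bloch_dist_def bloch_diff bloch_norm_nonneg)
  have "bloch_norm p (\<lambda>z. f z - g z) \<le> bloch_norm p (\<lambda>z. g z - f z)"
    if "f \<in> bloch p" "g \<in> bloch p" for f g :: "complex ^ 'n \<Rightarrow> complex"
    using bloch_linear(2) [OF bloch_diff [OF that(2,1)] bloch_diff [OF that(2,1)], of "-1" 0] by simp
  then show "bloch_dist p f g = bloch_dist p g f"
    by (auto simp: bloch_dist_def intro: antisym)
  show "bloch_dist p f g = 0 \<longleftrightarrow> f = g" if fg: "f \<in> bloch p" "g \<in> bloch p"
  proof
    assume "bloch_dist p f g = 0"
    with fg bloch_norm_eq_0 [OF bloch_diff [OF fg]] show "f = g"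
      by (auto simp: bloch_dist_def fun_eq_iff)
  next
    assume "f = g"
    then show "bloch_dist p f g = 0"
      using fg bloch_linear(2) [OF fg, of 0 0] bloch_norm_nonneg [OF bloch_diff [OF fg]]
      by (simp add: bloch_dist_def)
  qed
  show "bloch_dist p f h \<le> bloch_dist p f g + bloch_dist p g h"
    if "f \<in> bloch p" "g \<in> bloch p" "h \<in> bloch p"
    using bloch_linear(2) [OF bloch_diff [OF that(1,2)] bloch_diff [OF that(2,3)], of 1 1] that
    by (simp add: bloch_dist_def)
qed

definition bloch_topology :: "real \<Rightarrow> (complex ^ 'n \<Rightarrow> complex) topology" where
  "bloch_topology p = Metric_space.mtopology (bloch p) (bloch_dist p)"

definition monomial :: "('n \<Rightarrow> nat) \<Rightarrow> complex ^ 'n \<Rightarrow> complex" where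
  "monomial \<gamma> z = (\<Prod>i\<in>UNIV. (z $ i) ^ \<gamma> i)"

definition polynomial_functions :: "(complex ^ 'n \<Rightarrow> complex) set" where
  "polynomial_functions =
     {zero_ext (\<lambda>z. \<Sum>\<gamma>\<in>A. c \<gamma> * monomial \<gamma> z) | A c. finite A}"

definition little_bloch :: "real \<Rightarrow> (complex ^ 'n \<Rightarrow> complex) set" where
  "little_bloch p = bloch_topology p closure_of polynomial_functions"

definition little_bloch_topology :: "real \<Rightarrow> (complex ^ 'n \<Rightarrow> complex) topology" where
  "little_bloch_topology p = Metric_space.mtopology (little_bloch p) (bloch_dist p)"

definition linear_between ::
  "('a \<Rightarrow> complex) set \<Rightarrow> ('b \<Rightarrow> complex) set \<Rightarrow> (('a \<Rightarrow> complex) \<Rightarrow> 'b \<Rightarrow> complex) \<Rightarrow> bool" where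
  "linear_between X Y T \<longleftrightarrow> T \<in> X \<rightarrow> Y \<and>
     (\<forall>f\<in>X. \<forall>g\<in>X. T (\<lambda>z. f z + g z) = (\<lambda>w. T f w + T g w)) \<and>
     (\<forall>f\<in>X. \<forall>c. T (\<lambda>z. c * f z) = (\<lambda>w. c * T f w))"

text \<open>\<^term>\<open>X\<close> is a space of functions with norm \<^term>\<open>N\<close>; the target is the
  carrier of the topology \<^term>\<open>\<tau>\<close>. The closure of the image of the closed unit ball is
  required to be compact.\<close>

definition compact_operator ::
  "('a \<Rightarrow> complex) set \<Rightarrow> (('a \<Rightarrow> complex) \<Rightarrow> real) \<Rightarrow> ('b \<Rightarrow> complex) topology \<Rightarrow>
   (('a \<Rightarrow> complex) \<Rightarrow> 'b \<Rightarrow> complex) \<Rightarrow> bool" where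
  "compact_operator X N \<tau> T \<longleftrightarrow> linear_between X (topspace \<tau>) T \<and>
     compactin \<tau> (\<tau> closure_of (T ` {f \<in> X. N f \<le> 1}))"

definition composition_operator ::
  "(complex ^ 'n \<Rightarrow> complex ^ 'n) \<Rightarrow> (complex ^ 'n \<Rightarrow> complex) \<Rightarrow> complex ^ 'n \<Rightarrow> complex" where
  "composition_operator \<phi> f = zero_ext (f \<circ> \<phi>)"

definition vanishes_as_image_to_boundary ::
  "(complex ^ 'n \<Rightarrow> complex ^ 'n) \<Rightarrow> (complex ^ 'n \<Rightarrow> real) \<Rightarrow> bool" where
  "vanishes_as_image_to_boundary \<phi> S \<longleftrightarrow>
     (\<forall>\<epsilon>>0. \<exists>\<delta>>0. \<forall>z\<in>polydisk. infdist (\<phi> z) (frontier polydisk) < \<delta> \<longrightarrow> \<bar>S z\<bar> < \<epsilon>)"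

end

theory Submission
  imports Defs "HOL-Complex_Analysis.Great_Picard"
begin

text \<open>
  Sufficiency: writing $T_{kl}(z) = |\partial_k \phi_l(z)| (1 - |z_k|^2)^q / (1 - |\phi_l(z)|^2)^p$,
  the chain rule bounds the Bloch weight of $f \circ \phi$ at $z$ by the weight of $f$ at $\phi(z)$
  times $\sum T_{kl}(z)$. That sum is bounded, so $C_\phi$ is bounded, and since it
  sends monomials into the closure of the polynomials it maps the little Bloch spaces into each
  other. A bounded sequence has a subsequence converging locally
  uniformly with its derivatives; where $\phi(z)$ is near the boundary the sum of the $T_{kl}$ is
  small, elsewhere the derivatives are already close, so the images converge in norm.

  Necessity: a bounded sequence tending to 0 pointwise is mapped to a null sequence in norm.
  For $a_j$ with $|\phi_l(a_j)| \to 1$ this is applied with $w = \phi_l(a_j)$ to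
  $(1 - |w|^2)^{m+1-p} (1 - \bar w z_l)^{-m}$, $m = \lceil p \rceil$, whose derivative at $w$ is
  comparable to $(1 - |w|^2)^{-p}$. These say nothing about the terms $T_{kl}$ for which
  $|\phi_l(a_j)|$ stays away from 1 while another coordinate satisfies $|\phi_m(a_j)| \to 1$;
  those are reached by $(z_l - b)(1 - |w|^2)/(1 - \bar w z_m)$ with $b = \phi_l(a_j)$ and
  $w = \phi_m(a_j)$, which is bounded in the Bloch norm because $p \ge 1$.
\<close>

subsection \<open>Calculus of partial derivatives on the polydisk\<close>

text \<open>Two closure gaps shape the argument. The unit ball of the little Bloch space is not
  closed under locally uniform convergence, so a normal-family limit \<open>g\<close> is known only
  to lie in \<open>bloch p\<close>; its image still lands in \<open>little_bloch q\<close>, as a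
  norm limit of images of little Bloch functions. Conversely, compactness is given on
  \<open>little_bloch p\<close> only, so every test function must be a norm limit of polynomials.
  This is why the test functions are products of polynomials and integer powers of
  \<open>1 / (1 - cnj w * z $ l)\<close> with |w| < 1: the geometric series converges uniformly
  together with its derivative.

  Evaluating a composed test function at one point yields a chain rule sum over all coordinates of
  \<phi>. A function of one variable leaves a single term. The mixed function has two variables, and
  its factor \<open>z $ l - b\<close> removes the second term at that point. What remains bounds the
  numerator of T_{kl} only, which suffices because |\<phi>_l| stays away from 1 in the case
  concerned.\<close>

lemma open_polydisk: "open (polydisk :: (complex ^ 'n) set)"
proof -
  have "polydisk = (\<Inter>k. (\<lambda>z. z $ k) -` ball 0 1 :: (complex ^ 'n) set)"
    by (auto simp: polydisk_def)
  moreover have "open ((\<lambda>z. z $ k) -` ball 0 1 :: (complex ^ 'n) set)" for k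
    by (intro open_vimage open_ball continuous_intros)
  ultimately show ?thesis by (metis finite open_INT)
qed

text \<open>Complex linearity determines a derivative by its values on the axes. This normal form is
  the interface of the whole calculus: each rule below proves one \<open>has_derivative\<close> fact
  of this shape, then reads off holomorphy and the partial derivatives with
  \<open>holomorphic_severalI\<close> and \<open>partial_deriv_eqI\<close>.\<close>

lemma has_derivative_partial_deriv:
  fixes f :: "complex ^ 'n \<Rightarrow> complex"
  assumes f: "holomorphic_several f S" and z: "z \<in> S"
  shows "(f has_derivative (\<lambda>v. \<Sum>k\<in>UNIV. v $ k * partial_deriv k f z)) (at z)"
proof -
  obtain D where D: "(f has_derivative D) (at z)" "\<forall>c v. D (c *s v) = c * D v"
    by (rule holomorphic_severalE [OF f z])
  have "D v = (\<Sum>k\<in>UNIV. v $ k * partial_deriv k f z)" for v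
  proof -
    have "D v = D (\<Sum>k\<in>UNIV. v $ k *s axis k 1)" by (simp add: basis_expansion)
    also have "\<dots> = (\<Sum>k\<in>UNIV. D (v $ k *s axis k 1))"
      by (rule linear_sum [OF has_derivative_linear [OF D(1)]])
    also have "\<dots> = (\<Sum>k\<in>UNIV. v $ k * partial_deriv k f z)"
      using D by (simp add: partial_deriv_eq)
    finally show ?thesis .
  qed
  then have "D = (\<lambda>v. \<Sum>k\<in>UNIV. v $ k * partial_deriv k f z)" by auto
  with D show ?thesis by simp
qed

lemma partial_deriv_eqI:
  fixes f :: "complex ^ 'n \<Rightarrow> complex"
  assumes "(f has_derivative (\<lambda>v. \<Sum>k\<in>UNIV. v $ k * d k)) (at z)"
  shows "partial_deriv k f z = d k"
proof -
  have "partial_deriv k f z = (\<Sum>j\<in>UNIV. (axis k 1 :: complex ^ 'n) $ j * d j)"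
    by (rule partial_deriv_eq [OF assms]) (simp add: sum_distrib_left mult.assoc)
  also have "\<dots> = (\<Sum>j\<in>UNIV. if j = k then d j else 0)"
    by (intro sum.cong) (auto simp: axis_def)
  finally show ?thesis by simp
qed

lemma holomorphic_severalI:
  fixes f :: "complex ^ 'n \<Rightarrow> complex"
  assumes "\<And>z. z \<in> S \<Longrightarrow> (f has_derivative (\<lambda>v. \<Sum>k\<in>UNIV. v $ k * d z k)) (at z)"
  shows "holomorphic_several f S"
  unfolding holomorphic_several_def
  using assms by (fastforce simp: sum_distrib_left mult.assoc)

lemma zero_ext_has_derivative_iff:
  assumes z: "z \<in> polydisk"
  shows "(zero_ext f has_derivative D) (at z) \<longleftrightarrow> (f has_derivative D) (at z)"
  using has_derivative_transform_within_open [OF _ open_polydisk z, of f D UNIV "zero_ext f"]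
    has_derivative_transform_within_open [OF _ open_polydisk z, of "zero_ext f" D UNIV f]
  by (auto simp: zero_ext_def)

lemma holomorphic_several_zero_ext [simp]:
  "holomorphic_several (zero_ext f) polydisk \<longleftrightarrow> holomorphic_several f polydisk"
  by (simp add: holomorphic_several_def zero_ext_has_derivative_iff)

lemma partial_deriv_zero_ext:
  assumes "holomorphic_several f polydisk" "z \<in> polydisk"
  shows "partial_deriv k (zero_ext f) z = partial_deriv k f z"
  by (rule partial_deriv_eqI)
    (use assms has_derivative_partial_deriv zero_ext_has_derivative_iff in blast)

lemma holomorphic_several_mult:
  assumes f: "holomorphic_several f S" and g: "holomorphic_several g S"
  shows "holomorphic_several (\<lambda>z. f z * g z) S"
    and "z \<in> S \<Longrightarrow> partial_deriv k (\<lambda>z. f z * g z) z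
                     = f z * partial_deriv k g z + partial_deriv k f z * g z"
proof -
  have *: "((\<lambda>z. f z * g z) has_derivative
      (\<lambda>v. \<Sum>k\<in>UNIV. v $ k * (f z * partial_deriv k g z + partial_deriv k f z * g z))) (at z)"
    if "z \<in> S" for z
    using has_derivative_mult [OF has_derivative_partial_deriv [OF f that]
        has_derivative_partial_deriv [OF g that]]
    by (simp add: sum_distrib_left sum_distrib_right algebra_simps flip: sum.distrib)
  show "holomorphic_several (\<lambda>z. f z * g z) S"
    by (rule holomorphic_severalI [OF *])
  show "z \<in> S \<Longrightarrow> partial_deriv k (\<lambda>z. f z * g z) z
      = f z * partial_deriv k g z + partial_deriv k f z * g z"
    by (rule partial_deriv_eqI [OF *])
qed

lemma holomorphic_several_coordinate:
  fixes l :: "'n :: finite"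
  assumes F: "\<And>z. z \<in> S \<Longrightarrow> (F has_field_derivative F' (z $ l)) (at (z $ l))"
  shows "holomorphic_several (\<lambda>z :: complex ^ 'n. F (z $ l)) S"
    and "z \<in> S \<Longrightarrow> partial_deriv k (\<lambda>z :: complex ^ 'n. F (z $ l)) z = (if k = l then F' (z $ l) else 0)"
proof -
  have *: "((\<lambda>z :: complex ^ 'n. F (z $ l)) has_derivative
      (\<lambda>v. \<Sum>k\<in>UNIV. v $ k * (if k = l then F' (z $ l) else 0))) (at z)"
    if "z \<in> S" for z
  proof -
    have "((\<lambda>z :: complex ^ 'n. z $ l) has_derivative (\<lambda>v. v $ l)) (at z)"
      by (rule bounded_linear_imp_has_derivative [OF bounded_linear_vec_nth])
    from has_derivative_compose [OF this F [OF that, unfolded has_field_derivative_def]]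
    show ?thesis by (simp add: if_distrib [of "\<lambda>x. _ * x"] mult.commute cong: if_cong)
  qed
  show "holomorphic_several (\<lambda>z :: complex ^ 'n. F (z $ l)) S"
    by (rule holomorphic_severalI [OF *])
  show "z \<in> S \<Longrightarrow> partial_deriv k (\<lambda>z :: complex ^ 'n. F (z $ l)) z
      = (if k = l then F' (z $ l) else 0)"
    by (rule partial_deriv_eqI [OF *])
qed

lemma self_map_in_polydisk: "holomorphic_self_map \<phi> \<Longrightarrow> z \<in> polydisk \<Longrightarrow> \<phi> z \<in> polydisk"
  by (auto simp: holomorphic_self_map_def)

lemma holomorphic_several_compose:
  fixes \<phi> :: "complex ^ 'n \<Rightarrow> complex ^ 'n"
  assumes \<phi>: "holomorphic_self_map \<phi>" and f: "holomorphic_several f polydisk"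
  shows "holomorphic_several (f \<circ> \<phi>) polydisk"
    and "z \<in> polydisk \<Longrightarrow> partial_deriv k (f \<circ> \<phi>) z
           = (\<Sum>l\<in>UNIV. partial_deriv k (\<lambda>w. \<phi> w $ l) z * partial_deriv l f (\<phi> z))"
proof -
  have *: "(f \<circ> \<phi> has_derivative (\<lambda>v. \<Sum>k\<in>UNIV. v $ k *
      (\<Sum>l\<in>UNIV. partial_deriv k (\<lambda>w. \<phi> w $ l) z * partial_deriv l f (\<phi> z)))) (at z)"
    if z: "z \<in> polydisk" for z
  proof -
    let ?D = "\<lambda>v. \<chi> l. \<Sum>k\<in>UNIV. v $ k * partial_deriv k (\<lambda>w. \<phi> w $ l) z"
    have "((\<lambda>w. \<phi> w $ l) has_derivative (\<lambda>v. ?D v $ l)) (at z)" for l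
      using has_derivative_partial_deriv [of "\<lambda>w. \<phi> w $ l", OF _ z] \<phi>
      by (simp add: holomorphic_self_map_def)
    \<comment> \<open>The componentwise criterion runs over the real basis, whose vectors are
      \<open>axis m b\<close> with b in the basis of the complex numbers; the inner product with
      such a vector sees only the m-th complex coordinate.\<close>
    then have "((\<lambda>w. \<phi> w \<bullet> i) has_derivative (\<lambda>v. ?D v \<bullet> i)) (at z)" if "i \<in> Basis" for i
    proof -
      obtain m b where "i = axis m b" using \<open>i \<in> Basis\<close> by (auto simp: Basis_vec_def)
      then show ?thesis
        using has_derivative_inner_left [OF \<open>((\<lambda>w. \<phi> w $ m) has_derivative (\<lambda>v. ?D v $ m)) (at z)\<close>, of b]
        by (simp add: inner_axis)
    qed
    then have "(\<phi> has_derivative ?D) (at z)"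
      by (subst has_derivative_componentwise_within) blast
    from has_derivative_compose [OF this has_derivative_partial_deriv
        [OF f self_map_in_polydisk [OF \<phi> z]]]
    have "((\<lambda>x. f (\<phi> x)) has_derivative
       (\<lambda>v. \<Sum>l\<in>UNIV. (\<Sum>k\<in>UNIV. v $ k * partial_deriv k (\<lambda>w. \<phi> w $ l) z) *
          partial_deriv l f (\<phi> z))) (at z)" by simp
    also have "(\<lambda>v :: complex ^ 'n. \<Sum>l\<in>UNIV. (\<Sum>k\<in>UNIV. v $ k * partial_deriv k (\<lambda>w. \<phi> w $ l) z) *
          partial_deriv l f (\<phi> z)) = (\<lambda>v. \<Sum>k\<in>UNIV. v $ k *
      (\<Sum>l\<in>UNIV. partial_deriv k (\<lambda>w. \<phi> w $ l) z * partial_deriv l f (\<phi> z)))"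
      unfolding sum_distrib_left sum_distrib_right mult.assoc by (intro ext sum.swap)
    finally show ?thesis by (simp add: o_def)
  qed
  show "holomorphic_several (f \<circ> \<phi>) polydisk"
    by (rule holomorphic_severalI [OF *])
  show "z \<in> polydisk \<Longrightarrow> partial_deriv k (f \<circ> \<phi>) z
           = (\<Sum>l\<in>UNIV. partial_deriv k (\<lambda>w. \<phi> w $ l) z * partial_deriv l f (\<phi> z))"
    by (rule partial_deriv_eqI [OF *])
qed

section \<open>Exhaustion by compact convex polydisks and the mean value inequality\<close>

definition closed_polydisk :: "real \<Rightarrow> (complex ^ 'n) set" where
  "closed_polydisk R = {z. \<forall>k. cmod (z $ k) \<le> R}"

lemma closed_polydisk_subset: "R < 1 \<Longrightarrow> closed_polydisk R \<subseteq> polydisk"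
  by (auto simp: closed_polydisk_def polydisk_def intro: le_less_trans)

lemma closed_polydisk_mono: "R \<le> R' \<Longrightarrow> closed_polydisk R \<subseteq> closed_polydisk R'"
  by (auto simp: closed_polydisk_def intro: order_trans)

lemma polydisk_exhaustion:
  assumes "z \<in> polydisk"
  obtains R where "0 \<le> R" "R < 1" "z \<in> closed_polydisk R"
proof -
  have "finite (range (\<lambda>k. cmod (z $ k)))" by simp
  then have "0 \<le> Max (range (\<lambda>k. cmod (z $ k)))" "Max (range (\<lambda>k. cmod (z $ k))) < 1"
    "z \<in> closed_polydisk (Max (range (\<lambda>k. cmod (z $ k))))"
    using assms by (auto simp: polydisk_def closed_polydisk_def Max_ge_iff)
  with that show thesis by blast
qed

lemma convex_closed_polydisk: "convex (closed_polydisk R :: (complex ^ 'n) set)"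
proof -
  have *: "closed_polydisk R = (\<Inter>k. (\<lambda>z. z $ k) -` cball 0 R :: (complex ^ 'n) set)"
    by (auto simp: closed_polydisk_def)
  have "convex ((\<lambda>z. z $ k) -` cball 0 R :: (complex ^ 'n) set)" for k
    by (intro convex_linear_vimage bounded_linear.linear bounded_linear_vec_nth convex_cball)
  then show ?thesis unfolding * by (intro convex_INT)
qed

lemma compact_closed_polydisk: "compact (closed_polydisk R :: (complex ^ 'n) set)"
proof -
  have *: "closed_polydisk R = (\<Inter>k. (\<lambda>z. z $ k) -` cball 0 R :: (complex ^ 'n) set)"
    by (auto simp: closed_polydisk_def)
  have "closed (closed_polydisk R :: (complex ^ 'n) set)"
    unfolding * by (intro closed_INT ballI closed_vimage closed_cball continuous_intros)
  moreover have "norm z \<le> (\<Sum>k\<in>(UNIV :: 'n set). R)" if "z \<in> closed_polydisk R" for z :: "complex ^ 'n"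
    unfolding norm_vec_def using that
    by (intro order_trans [OF L2_set_le_sum] sum_mono) (auto simp: closed_polydisk_def)
  ultimately show ?thesis
    using compact_eq_bounded_closed bounded_iff by blast
qed

lemma zero_in_closed_polydisk: "0 \<le> R \<Longrightarrow> 0 \<in> closed_polydisk R"
  by (simp add: closed_polydisk_def)

lemma cmod_linear_form_le:
  fixes v :: "complex ^ 'n"
  assumes "\<And>k. cmod (d k) \<le> B"
  shows "cmod (\<Sum>k\<in>UNIV. v $ k * d k) \<le> real CARD('n) * B * norm v"
proof -
  have "cmod (\<Sum>k\<in>UNIV. v $ k * d k) \<le> (\<Sum>k\<in>(UNIV :: 'n set). norm v * B)"
    by (intro sum_norm_le) (auto simp: norm_mult assms intro!: mult_mono Finite_Cartesian_Product.norm_nth_le)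
  then show ?thesis by (simp add: algebra_simps)
qed

text \<open>Mean value inequality on a convex set; the factor \<open>CARD('n)\<close> is the crude
  operator norm estimate of \<open>cmod_linear_form_le\<close>.\<close>

lemma lipschitz_partial_deriv_bound:
  fixes f :: "complex ^ 'n \<Rightarrow> complex"
  assumes f: "holomorphic_several f polydisk" and R: "R < 1"
    and B: "\<And>k z. z \<in> closed_polydisk R \<Longrightarrow> cmod (partial_deriv k f z) \<le> B"
    and xy: "x \<in> closed_polydisk R" "y \<in> closed_polydisk R"
  shows "cmod (f x - f y) \<le> real CARD('n) * B * norm (x - y)"
proof (rule differentiable_bound [OF convex_closed_polydisk _ _ xy])
  fix z :: "complex ^ 'n" assume z: "z \<in> closed_polydisk R"
  then have "z \<in> polydisk" using closed_polydisk_subset [OF R] by blast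
  then show "(f has_derivative (\<lambda>v. \<Sum>k\<in>UNIV. v $ k * partial_deriv k f z)) (at z within closed_polydisk R)"
    using has_derivative_partial_deriv [OF f] has_derivative_at_withinI by blast
  show "onorm (\<lambda>v. \<Sum>k\<in>UNIV. v $ k * partial_deriv k f z) \<le> real CARD('n) * B"
    by (rule onorm_le) (rule cmod_linear_form_le [OF B [OF z]])
qed

subsection \<open>Elementary estimates in the Bloch space\<close>

lemma one_minus_square_pos: "z \<in> polydisk \<Longrightarrow> 0 < 1 - (cmod (z $ k))\<^sup>2"
  by (simp add: polydisk_def abs_square_less_1)

lemma bloch_weight_zero_ext:
  assumes "holomorphic_several f polydisk" "z \<in> polydisk"
  shows "bloch_weight p (zero_ext f) z = bloch_weight p f z"
  by (simp add: bloch_weight_def partial_deriv_zero_ext assms)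

text \<open>The entry point for concrete functions: \<open>f\<close> may be any formula, whatever it
  gives outside the polydisk, and a pointwise bound of its weight suffices.\<close>

lemma bloch_zero_extI:
  assumes f: "holomorphic_several f polydisk"
    and b: "\<And>z. z \<in> polydisk \<Longrightarrow> bloch_weight p f z \<le> b"
  shows "zero_ext f \<in> bloch p" and "bloch_norm p (zero_ext f) \<le> cmod (f 0) + b"
proof -
  have le: "bloch_weight p (zero_ext f) z \<le> b" if "z \<in> polydisk" for z
    using b that by (simp add: bloch_weight_zero_ext f)
  then have "bdd_above (bloch_weight p (zero_ext f) ` polydisk)" by (intro bdd_aboveI2)
  moreover have "zero_ext f z = 0" if "z \<notin> polydisk" for z
    using that by (simp add: zero_ext_def)
  ultimately show "zero_ext f \<in> bloch p"
    using f by (simp add: bloch_def)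
  have "(SUP z\<in>polydisk. bloch_weight p (zero_ext f) z) \<le> b"
    using zero_in_polydisk by (intro cSUP_least le) auto
  then show "bloch_norm p (zero_ext f) \<le> cmod (f 0) + b"
    by (simp add: bloch_norm_def zero_ext_def zero_in_polydisk)
qed

lemma bloch_weight_le_norm:
  assumes "f \<in> bloch p" "z \<in> polydisk"
  shows "bloch_weight p f z \<le> bloch_norm p f"
  using bloch_weight_le [OF assms] by (simp add: bloch_norm_def add_increasing)

lemma cmod_at_0_le_bloch_norm:
  assumes "f \<in> bloch p"
  shows "cmod (f 0) \<le> bloch_norm p f"
proof -
  have "0 \<le> (SUP z\<in>polydisk. bloch_weight p f z)"
    using bloch_weight_le [OF assms zero_in_polydisk] bloch_weight_nonneg [of p f 0] by linarith
  then show ?thesis by (simp add: bloch_norm_def)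
qed

lemma weighted_partial_deriv_le:
  "cmod (partial_deriv k f z) * (1 - (cmod (z $ k))\<^sup>2) powr p \<le> bloch_weight p f z"
  unfolding bloch_weight_def by (rule member_le_sum) auto

text \<open>On a smaller closed polydisk the factors (1 - |z_k|^2)^p are bounded below, so there the
  weight controls the plain derivatives.\<close>

lemma partial_deriv_le_bloch_weight:
  assumes R: "0 \<le> R" "R < 1" and z: "z \<in> closed_polydisk R" and p: "0 \<le> p"
  shows "cmod (partial_deriv k f z) \<le> bloch_weight p f z / (1 - R\<^sup>2) powr p"
proof -
  have R2: "0 < 1 - R\<^sup>2" using R by (simp add: abs_square_less_1)
  have "(cmod (z $ k))\<^sup>2 \<le> R\<^sup>2"
    using z by (intro power_mono) (auto simp: closed_polydisk_def)
  then have "(1 - R\<^sup>2) powr p \<le> (1 - (cmod (z $ k))\<^sup>2) powr p"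
    using R2 p by (intro powr_mono2) auto
  then have "cmod (partial_deriv k f z) * (1 - R\<^sup>2) powr p \<le> bloch_weight p f z"
    by (rule order_trans [OF mult_left_mono weighted_partial_deriv_le]) simp
  then show ?thesis using R2 by (simp add: pos_le_divide_eq)
qed

lemma bloch_lipschitz:
  fixes f :: "complex ^ 'n \<Rightarrow> complex"
  assumes f: "f \<in> bloch p" and R: "0 \<le> R" "R < 1" and p: "0 \<le> p"
    and xy: "x \<in> closed_polydisk R" "y \<in> closed_polydisk R"
  shows "cmod (f x - f y) \<le> real CARD('n) * (bloch_norm p f / (1 - R\<^sup>2) powr p) * norm (x - y)"
proof (rule lipschitz_partial_deriv_bound [OF _ R(2) _ xy])
  show "holomorphic_several f polydisk" using f by (simp add: bloch_def)
  fix k :: 'n and z :: "complex ^ 'n" assume z: "z \<in> closed_polydisk R"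
  then have "z \<in> polydisk" using closed_polydisk_subset [OF R(2)] by blast
  then have "bloch_weight p f z / (1 - R\<^sup>2) powr p \<le> bloch_norm p f / (1 - R\<^sup>2) powr p"
    by (intro divide_right_mono bloch_weight_le_norm [OF f]) auto
  with partial_deriv_le_bloch_weight [OF R z p, of k f]
  show "cmod (partial_deriv k f z) \<le> bloch_norm p f / (1 - R\<^sup>2) powr p" by linarith
qed

text \<open>\<open>C\<close> does not depend on \<open>f\<close>, so convergence in the Bloch norm
  implies locally uniform, hence pointwise, convergence. The estimate runs from the origin, where
  the norm contains |f(0)|; this is the summand 1 in the constant \<open>1 + ?C\<close>.\<close>

lemma bloch_growth:
  assumes R: "0 \<le> R" "R < 1" and p: "0 \<le> p"
  obtains C where "0 < C" "\<And>(f :: complex ^ 'n::finite \<Rightarrow> complex) z. f \<in> bloch p \<Longrightarrow> z \<in> closed_polydisk R \<Longrightarrow> cmod (f z) \<le> C * bloch_norm p f"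
proof -
  obtain B where B: "0 < B" "\<And>z :: complex ^ 'n. z \<in> closed_polydisk R \<Longrightarrow> norm z \<le> B"
    using compact_imp_bounded [OF compact_closed_polydisk [of R, where 'n = 'n]]
    by (auto simp: bounded_pos)
  let ?C = "real CARD('n) / (1 - R\<^sup>2) powr p * B"
  have "cmod (f z) \<le> (1 + ?C) * bloch_norm p f"
    if f: "f \<in> bloch p" and z: "z \<in> closed_polydisk R" for f and z :: "complex ^ 'n"
  proof -
  have "cmod (f z - f 0) \<le> real CARD('n) * (bloch_norm p f / (1 - R\<^sup>2) powr p) * norm (z - 0)"
    by (rule bloch_lipschitz [OF f R p z zero_in_closed_polydisk [OF R(1)]])
  also have "\<dots> \<le> real CARD('n) * (bloch_norm p f / (1 - R\<^sup>2) powr p) * B"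
    using B(2) [OF z] bloch_norm_nonneg [OF f] by (intro mult_left_mono) auto
  finally have "cmod (f z - f 0) \<le> ?C * bloch_norm p f" by (simp add: field_simps)
  moreover have "cmod (f z) \<le> cmod (f 0) + cmod (f z - f 0)"
    using norm_triangle_ineq [of "f 0" "f z - f 0"] by simp
  ultimately show ?thesis
    using cmod_at_0_le_bloch_norm [OF f] by (simp add: algebra_simps)
  qed
  moreover have "0 < 1 + ?C" using B by (simp add: add_pos_nonneg)
  ultimately show thesis using that by blast
qed

subsection \<open>Polynomials and the little Bloch space\<close>

text \<open>Polynomials on the whole type, before extension by zero, so that algebra and
  differentiation apply to them directly.\<close>

definition multipolynomials :: "(complex ^ 'n \<Rightarrow> complex) set" where
  "multipolynomials = {\<lambda>z. \<Sum>\<gamma>\<in>A. c \<gamma> * monomial \<gamma> z | A c. finite A}"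

lemma polynomial_functions_eq: "polynomial_functions = zero_ext ` multipolynomials"
  by (auto simp: polynomial_functions_def multipolynomials_def)

text \<open>Terms with equal exponents are collected. Sums and products of polynomials can thus be
  indexed by \<open>A <+> B\<close> and \<open>A \<times> B\<close> although different indices may
  yield the same exponent.\<close>

lemma multipolynomials_indexed_sum:
  fixes g :: "'i \<Rightarrow> 'n::finite \<Rightarrow> nat"
  assumes "finite I"
  shows "(\<lambda>z :: complex ^ 'n. \<Sum>i\<in>I. c i * monomial (g i) z) \<in> multipolynomials"
proof -
  have "(\<lambda>z :: complex ^ 'n. \<Sum>i\<in>I. c i * monomial (g i) z)
      = (\<lambda>z. \<Sum>\<gamma>\<in>g ` I. (\<Sum>i\<in>{i\<in>I. g i = \<gamma>}. c i) * monomial \<gamma> z)"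
    by (rule ext, subst sum.image_gen [OF assms, of _ g])
      (auto simp: sum_distrib_right intro!: sum.cong)
  then show ?thesis using assms by (auto simp: multipolynomials_def)
qed

lemma multipolynomials_linear:
  assumes "P \<in> multipolynomials" "Q \<in> multipolynomials"
  shows "(\<lambda>z. a * P z + b * Q z) \<in> multipolynomials"
proof -
  obtain A c B d where P: "P = (\<lambda>z. \<Sum>\<gamma>\<in>A. c \<gamma> * monomial \<gamma> z)" "finite A"
    and Q: "Q = (\<lambda>z. \<Sum>\<gamma>\<in>B. d \<gamma> * monomial \<gamma> z)" "finite B"
    using assms unfolding multipolynomials_def by blast
  have "(\<lambda>z. \<Sum>i\<in>A <+> B. case_sum (\<lambda>\<gamma>. a * c \<gamma>) (\<lambda>\<gamma>. b * d \<gamma>) i * monomial (case_sum id id i) z)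
      \<in> multipolynomials"
    using P Q by (intro multipolynomials_indexed_sum) simp
  also have "(\<lambda>z. \<Sum>i\<in>A <+> B. case_sum (\<lambda>\<gamma>. a * c \<gamma>) (\<lambda>\<gamma>. b * d \<gamma>) i * monomial (case_sum id id i) z)
      = (\<lambda>z. a * P z + b * Q z)"
    using P Q by (simp add: sum.Plus sum_distrib_left mult.assoc)
  finally show ?thesis .
qed

lemma monomial_add: "monomial (\<lambda>i. \<gamma> i + \<delta> i) z = monomial \<gamma> z * monomial \<delta> z"
  by (simp add: monomial_def power_add prod.distrib)

lemma multipolynomials_mult:
  assumes "P \<in> multipolynomials" "Q \<in> multipolynomials"
  shows "(\<lambda>z. P z * Q z) \<in> multipolynomials"
proof -
  obtain A c B d where P: "P = (\<lambda>z. \<Sum>\<gamma>\<in>A. c \<gamma> * monomial \<gamma> z)" "finite A"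
    and Q: "Q = (\<lambda>z. \<Sum>\<gamma>\<in>B. d \<gamma> * monomial \<gamma> z)" "finite B"
    using assms unfolding multipolynomials_def by blast
  have "(\<lambda>z. \<Sum>i\<in>A \<times> B. (c (fst i) * d (snd i)) * monomial (\<lambda>j. fst i j + snd i j) z)
      \<in> multipolynomials"
    using P Q by (intro multipolynomials_indexed_sum) simp
  also have "(\<lambda>z. \<Sum>i\<in>A \<times> B. (c (fst i) * d (snd i)) * monomial (\<lambda>j. fst i j + snd i j) z)
      = (\<lambda>z. P z * Q z)"
    unfolding P Q sum_product sum.cartesian_product
    by (simp add: monomial_add case_prod_unfold mult_ac)
  finally show ?thesis .
qed

lemma multipolynomials_const: "(\<lambda>z. a) \<in> multipolynomials"
  using multipolynomials_indexed_sum [of "{()}" "\<lambda>_. a" "\<lambda>_ _. 0"] by (simp add: monomial_def)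

lemma multipolynomials_coordinate: "(\<lambda>z :: complex ^ 'n. z $ l) \<in> multipolynomials"
proof -
  have "(z $ i) ^ (if i = l then 1 else 0) = (if i = l then z $ l else 1)" for z :: "complex ^ 'n" and i l
    by simp
  then have "monomial (\<lambda>i. if i = l then 1 else 0) z = z $ l" for z :: "complex ^ 'n"
    unfolding monomial_def by (simp only: prod.delta finite UNIV_I if_True)
  then show ?thesis
    using multipolynomials_indexed_sum [of "{()}" "\<lambda>_. 1" "\<lambda>_ i. if i = l then 1 else 0"] by simp
qed

lemma multipolynomials_power:
  assumes "P \<in> multipolynomials"
  shows "(\<lambda>z. P z ^ m) \<in> multipolynomials"
  by (induction m) (simp_all add: multipolynomials_const multipolynomials_mult assms)

lemma multipolynomials_sum:
  assumes "\<And>i. i \<in> I \<Longrightarrow> P i \<in> multipolynomials"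
  shows "(\<lambda>z. \<Sum>i\<in>I. P i z) \<in> multipolynomials"
  using assms
proof (induction I rule: infinite_finite_induct)
  case (insert x F)
  then show ?case using multipolynomials_linear [of "P x" "\<lambda>z. \<Sum>i\<in>F. P i z" 1 1] by simp
qed (simp_all add: multipolynomials_const)

section \<open>Functions that are bounded together with their first derivatives\<close>

definition bounded_C1 :: "(complex ^ 'n \<Rightarrow> complex) \<Rightarrow> bool" where
  "bounded_C1 f \<longleftrightarrow> holomorphic_several f polydisk \<and> bounded (f ` polydisk) \<and>
     (\<forall>k. bounded (partial_deriv k f ` polydisk))"

text \<open>The definition speaks of \<open>bounded\<close> images because products of uniform
  limits ask for that form; estimates are easier with one constant for the function and all its
  partial derivatives, obtained here by adding the finitely many bounds.\<close>

lemma bounded_C1_iff: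
  fixes f :: "complex ^ 'n \<Rightarrow> complex"
  shows "bounded_C1 f \<longleftrightarrow> holomorphic_several f polydisk \<and>
     (\<exists>B\<ge>0. \<forall>z\<in>polydisk. cmod (f z) \<le> B \<and> (\<forall>k. cmod (partial_deriv k f z) \<le> B))"
proof safe
  assume f: "bounded_C1 f"
  then show "holomorphic_several f polydisk" by (simp add: bounded_C1_def)
  obtain A where A: "\<And>z. z \<in> polydisk \<Longrightarrow> cmod (f z) \<le> A"
    using f by (auto simp: bounded_C1_def bounded_iff)
  have "\<forall>k. \<exists>B. \<forall>z\<in>polydisk. cmod (partial_deriv k f z) \<le> B"
    using f by (auto simp: bounded_C1_def bounded_iff)
  then obtain B where B: "\<And>k z. z \<in> polydisk \<Longrightarrow> cmod (partial_deriv k f z) \<le> B k"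
    by metis
  have B0: "0 \<le> B k" for k
    using order_trans [OF norm_ge_zero B [OF zero_in_polydisk]] .
  have A0: "0 \<le> A"
    using order_trans [OF norm_ge_zero A [OF zero_in_polydisk]] .
  have "cmod (partial_deriv k f z) \<le> A + sum B UNIV" if "z \<in> polydisk" for k z
    using B [OF that, of k] member_le_sum [of k UNIV B] B0 A0 by (simp add: add_increasing)
  moreover have "cmod (f z) \<le> A + sum B UNIV" if "z \<in> polydisk" for z
    using A [OF that] B0 by (simp add: add_increasing2 sum_nonneg)
  ultimately show "\<exists>B\<ge>0. \<forall>z\<in>polydisk. cmod (f z) \<le> B \<and> (\<forall>k. cmod (partial_deriv k f z) \<le> B)"
    using A0 B0 by (intro exI [of _ "A + sum B UNIV"]) (auto intro!: add_nonneg_nonneg sum_nonneg)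
qed (auto simp: bounded_C1_def bounded_iff)

lemma bounded_C1_linear:
  assumes f: "bounded_C1 f" and g: "bounded_C1 g"
  shows "bounded_C1 (\<lambda>z. a * f z + b * g z)"
proof -
  obtain A where A: "A \<ge> 0" "\<And>z. z \<in> polydisk \<Longrightarrow> cmod (f z) \<le> A" 
      "\<And>k z. z \<in> polydisk \<Longrightarrow> cmod (partial_deriv k f z) \<le> A"
    using f unfolding bounded_C1_iff by blast
  obtain B where B: "B \<ge> 0" "\<And>z. z \<in> polydisk \<Longrightarrow> cmod (g z) \<le> B" 
      "\<And>k z. z \<in> polydisk \<Longrightarrow> cmod (partial_deriv k g z) \<le> B"
    using g unfolding bounded_C1_iff by blast
  have fg: "holomorphic_several f polydisk" "holomorphic_several g polydisk"
    using f g by (simp_all add: bounded_C1_def)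
  have le: "cmod (a * u + b * v) \<le> cmod a * A + cmod b * B" if "cmod u \<le> A" "cmod v \<le> B" for u v
    using that by (intro norm_triangle_le add_mono) (auto simp: norm_mult intro!: mult_left_mono)
  show ?thesis
    unfolding bounded_C1_iff using A B fg
    by (intro conjI exI [of _ "cmod a * A + cmod b * B"])
      (auto simp: holomorphic_several_linear intro!: le)
qed

lemma bounded_C1_mult:
  assumes f: "bounded_C1 f" and g: "bounded_C1 g"
  shows "bounded_C1 (\<lambda>z. f z * g z)"
proof -
  obtain A where A: "A \<ge> 0" "\<And>z. z \<in> polydisk \<Longrightarrow> cmod (f z) \<le> A" 
      "\<And>k z. z \<in> polydisk \<Longrightarrow> cmod (partial_deriv k f z) \<le> A"
    using f unfolding bounded_C1_iff by blast
  obtain B where B: "B \<ge> 0" "\<And>z. z \<in> polydisk \<Longrightarrow> cmod (g z) \<le> B" 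
      "\<And>k z. z \<in> polydisk \<Longrightarrow> cmod (partial_deriv k g z) \<le> B"
    using g unfolding bounded_C1_iff by blast
  have fg: "holomorphic_several f polydisk" "holomorphic_several g polydisk"
    using f g by (simp_all add: bounded_C1_def)
  have le: "cmod (u * v) \<le> A * B" if "cmod u \<le> A" "cmod v \<le> B" for u v
    using that A(1) by (auto simp: norm_mult intro!: mult_mono)
  have "cmod (f z * g z) \<le> A * B + A * B" if "z \<in> polydisk" for z
    using le [OF A(2) B(2), OF that that] mult_nonneg_nonneg [OF A(1) B(1)] by linarith
  moreover have "cmod (partial_deriv k (\<lambda>z. f z * g z) z) \<le> A * B + A * B" if "z \<in> polydisk" for z k
    unfolding holomorphic_several_mult(2) [OF fg that]
    by (intro norm_triangle_le add_mono le A B that)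
  ultimately show ?thesis
    unfolding bounded_C1_iff using A(1) B(1) fg
    by (intro conjI exI [of _ "A * B + A * B"]) (auto simp: holomorphic_several_mult)
qed

lemma bounded_C1_const: "bounded_C1 (\<lambda>z :: complex ^ 'n. a)"
proof -
  have "((\<lambda>z. a) has_derivative (\<lambda>v. \<Sum>k\<in>UNIV. v $ k * (\<lambda>_ _. 0) z k)) (at z)" for z :: "complex ^ 'n"
    by simp
  from holomorphic_severalI [OF this] partial_deriv_eqI [OF this] show ?thesis
    unfolding bounded_C1_iff by (intro conjI exI [of _ "cmod a"]) auto
qed

lemma bounded_C1_coordinate: "bounded_C1 (\<lambda>z :: complex ^ 'n. z $ l)"
proof -
  have *: "((\<lambda>w. w) has_field_derivative (\<lambda>_. 1) (z $ l)) (at (z $ l))" for z :: "complex ^ 'n"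
    by simp
  from holomorphic_several_coordinate [where S = polydisk, OF this]
  show ?thesis
    unfolding bounded_C1_iff by (intro conjI exI [of _ 1]) (auto simp: polydisk_def less_imp_le [of "cmod _"])
qed

lemma bounded_C1_prod:
  assumes "\<And>i. i \<in> I \<Longrightarrow> bounded_C1 (f i)"
  shows "bounded_C1 (\<lambda>z. \<Prod>i\<in>I. f i z)"
  using assms
  by (induction I rule: infinite_finite_induct) (auto simp: bounded_C1_const bounded_C1_mult)

lemma bounded_C1_monomial: "bounded_C1 (monomial \<gamma> :: complex ^ 'n \<Rightarrow> complex)"
proof -
  have "bounded_C1 (\<lambda>z :: complex ^ 'n. (z $ i) ^ m)" for i m
    using bounded_C1_prod [of "{..<m}" "\<lambda>_ z. z $ i"] by (simp add: bounded_C1_coordinate)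
  from bounded_C1_prod [of UNIV, OF this] show ?thesis
    by (simp add: monomial_def [abs_def])
qed

lemma bounded_C1_multipolynomial:
  assumes "P \<in> multipolynomials"
  shows "bounded_C1 P"
proof -
  obtain A c where P: "P = (\<lambda>z. \<Sum>\<gamma>\<in>A. c \<gamma> * monomial \<gamma> z)" and "finite A"
    using assms unfolding multipolynomials_def by blast
  from this(2) show ?thesis unfolding P
  proof induction
    case (insert \<gamma> F)
    then show ?case using bounded_C1_linear [OF bounded_C1_monomial [of \<gamma>] insert.IH, of "c \<gamma>" 1] by simp
  qed (simp add: bounded_C1_const)
qed

text \<open>For p \<ge> 0 every factor (1 - |z_k|^2)^p is at most 1, so uniform control of the
  derivatives is stronger than control in the Bloch norm.\<close>

lemma bloch_weight_le_C1_bound: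
  fixes f :: "complex ^ 'n \<Rightarrow> complex"
  assumes "\<And>k. cmod (partial_deriv k f z) \<le> B" and p: "0 \<le> p" and z: "z \<in> polydisk"
  shows "bloch_weight p f z \<le> real CARD('n) * B"
proof -
  have "0 \<le> B" using order_trans [OF norm_ge_zero assms(1)] .
  moreover have "(1 - (cmod (z $ k))\<^sup>2) powr p \<le> 1" for k
    using powr_mono2 [OF p _, of "1 - (cmod (z $ k))\<^sup>2" 1] one_minus_square_pos [OF z, of k] by simp
  ultimately have "bloch_weight p f z \<le> (\<Sum>k\<in>(UNIV :: 'n set). B * 1)"
    unfolding bloch_weight_def using assms(1) by (intro sum_mono mult_mono) auto
  then show ?thesis by simp
qed

lemma bounded_C1_in_bloch:
  assumes f: "bounded_C1 f" and p: "0 \<le> p"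
  shows "zero_ext f \<in> bloch p"
proof -
  obtain B where "\<And>k z. z \<in> polydisk \<Longrightarrow> cmod (partial_deriv k f z) \<le> B"
    and "holomorphic_several f polydisk"
    using f unfolding bounded_C1_iff by blast
  then show ?thesis using bloch_zero_extI(1) bloch_weight_le_C1_bound [OF _ p] by metis
qed

lemma polynomial_functions_in_bloch: "0 \<le> p \<Longrightarrow> polynomial_functions \<subseteq> bloch p"
  by (auto simp: polynomial_functions_eq bounded_C1_in_bloch bounded_C1_multipolynomial)

lemma zero_ext_linear: "zero_ext (\<lambda>z. a * f z + b * g z) = (\<lambda>z. a * zero_ext f z + b * zero_ext g z)"
  by (auto simp: zero_ext_def)

lemma zero_ext_diff: "zero_ext (\<lambda>z. f z - g z) = (\<lambda>z. zero_ext f z - zero_ext g z)"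
  by (auto simp: zero_ext_def)

section \<open>Approximation in the Bloch norm\<close>

lemma little_bloch_iff:
  assumes "0 \<le> p"
  shows "f \<in> little_bloch p \<longleftrightarrow>
    f \<in> bloch p \<and> (\<forall>e>0. \<exists>P\<in>polynomial_functions. bloch_norm p (\<lambda>z. f z - P z) < e)"
proof -
  interpret Metric_space "bloch p" "bloch_dist p" by (rule Metric_space_bloch)
  show ?thesis
    using polynomial_functions_in_bloch [OF assms]
    unfolding little_bloch_def bloch_topology_def metric_closure_of
    by (fastforce simp: in_mball bloch_dist_def)
qed

lemma little_bloch_subset: "little_bloch p \<subseteq> bloch p"
proof -
  interpret Metric_space "bloch p" "bloch_dist p" by (rule Metric_space_bloch)
  show ?thesis by (simp add: little_bloch_def bloch_topology_def metric_closure_of)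
qed

lemma little_bloch_linear:
  assumes p: "0 \<le> p" and f: "f \<in> little_bloch p" and g: "g \<in> little_bloch p"
  shows "(\<lambda>z. a * f z + b * g z) \<in> little_bloch p"
  unfolding little_bloch_iff [OF p]
proof (intro conjI allI impI)
  have fb: "f \<in> bloch p" and gb: "g \<in> bloch p" using f g little_bloch_subset by auto
  then show "(\<lambda>z. a * f z + b * g z) \<in> bloch p" by (rule bloch_linear)
  fix e :: real assume e: "0 < e"
  \<comment> \<open>The summand 1 keeps the denominator positive when a = b = 0 and makes the final
    estimate strict.\<close>
  define d where "d = e / (cmod a + cmod b + 1)"
  have pos: "0 < cmod a + cmod b + 1" by (simp add: add_nonneg_pos)
  then have d: "0 < d" using e by (simp add: d_def)
  obtain P where P: "P \<in> polynomial_functions" "bloch_norm p (\<lambda>z. f z - P z) < d"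
    using f d unfolding little_bloch_iff [OF p] by blast
  obtain Q where Q: "Q \<in> polynomial_functions" "bloch_norm p (\<lambda>z. g z - Q z) < d"
    using g d unfolding little_bloch_iff [OF p] by blast
  have "P \<in> bloch p" "Q \<in> bloch p" using P Q polynomial_functions_in_bloch [OF p] by auto
  then have "bloch_norm p (\<lambda>z. a * (f z - P z) + b * (g z - Q z))
      \<le> cmod a * bloch_norm p (\<lambda>z. f z - P z) + cmod b * bloch_norm p (\<lambda>z. g z - Q z)"
    by (intro bloch_linear bloch_diff fb gb)
  also have "\<dots> \<le> cmod a * d + cmod b * d"
    using P Q by (intro add_mono mult_left_mono) auto
  also have "\<dots> < (cmod a + cmod b + 1) * d" using d by (simp add: algebra_simps)
  also have "\<dots> = e" using pos by (simp add: d_def)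
  finally have "bloch_norm p (\<lambda>z. (a * f z + b * g z) - (a * P z + b * Q z)) < e"
    by (simp add: algebra_simps)
  moreover have "(\<lambda>z. a * P z + b * Q z) \<in> polynomial_functions"
    using P(1) Q(1) by (auto simp: polynomial_functions_eq image_iff multipolynomials_linear zero_ext_linear [symmetric])
  ultimately show "\<exists>P\<in>polynomial_functions. bloch_norm p (\<lambda>z. (a * f z + b * g z) - P z) < e"
    by (rule bexI)
qed

lemma polynomial_functions_in_little_bloch:
  assumes "0 \<le> p" shows "polynomial_functions \<subseteq> little_bloch p"
  unfolding little_bloch_def bloch_topology_def
  using polynomial_functions_in_bloch [OF assms] Metric_space.topspace_mtopology [OF Metric_space_bloch]
  by (intro closure_of_subset) auto

lemma little_bloch_zero: "0 \<le> p \<Longrightarrow> (\<lambda>z. 0) \<in> little_bloch p"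
  using little_bloch_linear [of p] polynomial_functions_in_little_bloch [of p]
    multipolynomials_const [of 0] by (force simp: polynomial_functions_eq zero_ext_def)

lemma little_bloch_sum:
  assumes p: "0 \<le> p" and "\<And>i. i \<in> I \<Longrightarrow> f i \<in> little_bloch p"
  shows "(\<lambda>z. \<Sum>i\<in>I. c i * f i z) \<in> little_bloch p"
  using assms(2)
proof (induction I rule: infinite_finite_induct)
  case (insert x F)
  then show ?case
    using little_bloch_linear [OF p, of "f x" "\<lambda>z. \<Sum>i\<in>F. c i * f i z" "c x" 1] by simp
qed (simp_all add: little_bloch_zero p)

lemma bloch_norm_triangle:
  assumes "f \<in> bloch p" "g \<in> bloch p" "h \<in> bloch p"
  shows "bloch_norm p (\<lambda>z. f z - h z) \<le> bloch_norm p (\<lambda>z. f z - g z) + bloch_norm p (\<lambda>z. g z - h z)"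
  using bloch_linear(2) [OF bloch_diff [OF assms(1,2)] bloch_diff [OF assms(2,3)], of 1 1] by simp

lemma little_bloch_closed:
  assumes p: "0 \<le> p" and f: "f \<in> bloch p"
    and "\<And>e. 0 < e \<Longrightarrow> \<exists>g\<in>little_bloch p. bloch_norm p (\<lambda>z. f z - g z) < e"
  shows "f \<in> little_bloch p"
  unfolding little_bloch_iff [OF p]
proof (intro conjI allI impI f)
  fix e :: real assume "0 < e"
  then obtain g where g: "g \<in> little_bloch p" "bloch_norm p (\<lambda>z. f z - g z) < e / 2"
    using assms(3) [of "e / 2"] by auto
  moreover obtain P where "P \<in> polynomial_functions" "bloch_norm p (\<lambda>z. g z - P z) < e / 2"
    using g \<open>0 < e\<close> unfolding little_bloch_iff [OF p] by (meson half_gt_zero)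
  moreover have "g \<in> bloch p" "P \<in> bloch p"
    using calculation little_bloch_subset polynomial_functions_in_bloch [OF p] by auto
  ultimately show "\<exists>P\<in>polynomial_functions. bloch_norm p (\<lambda>z. f z - P z) < e"
    using bloch_norm_triangle [OF f, of g P] by (intro bexI [of _ P]) auto
qed

subsection \<open>Uniform limits of polynomials together with their first derivatives\<close>

text \<open>A condition stronger than lying in the little Bloch space, chosen because it passes to
  products: the product rule needs uniform convergence and boundedness of both factors and their
  derivatives, which a bound in the Bloch norm does not supply for general p.\<close>

definition C1_polynomial_limit :: "(complex ^ 'n \<Rightarrow> complex) \<Rightarrow> bool" where
  "C1_polynomial_limit f \<longleftrightarrow> bounded_C1 f \<and>
     (\<exists>P. (\<forall>n. P n \<in> multipolynomials) \<and> uniform_limit polydisk P f sequentially \<and>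
       (\<forall>k. uniform_limit polydisk (\<lambda>n. partial_deriv k (P n)) (partial_deriv k f) sequentially))"

lemma C1_polynomial_limit_multipolynomial:
  "P \<in> multipolynomials \<Longrightarrow> C1_polynomial_limit P"
  unfolding C1_polynomial_limit_def
  by (intro conjI exI [of _ "\<lambda>_. P"]) (auto simp: bounded_C1_multipolynomial intro: uniform_limit_const)

lemma C1_polynomial_limit_mult:
  assumes f: "C1_polynomial_limit f" and g: "C1_polynomial_limit g"
  shows "C1_polynomial_limit (\<lambda>z. f z * g z)"
proof -
  obtain P where P: "\<And>n. P n \<in> multipolynomials" "uniform_limit polydisk P f sequentially"
      "\<And>k. uniform_limit polydisk (\<lambda>n. partial_deriv k (P n)) (partial_deriv k f) sequentially"
    using f unfolding C1_polynomial_limit_def by blast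
  obtain Q where Q: "\<And>n. Q n \<in> multipolynomials" "uniform_limit polydisk Q g sequentially"
      "\<And>k. uniform_limit polydisk (\<lambda>n. partial_deriv k (Q n)) (partial_deriv k g) sequentially"
    using g unfolding C1_polynomial_limit_def by blast
  have fb: "bounded_C1 f" and gb: "bounded_C1 g" using f g by (simp_all add: C1_polynomial_limit_def)
  have hol: "holomorphic_several f polydisk" "holomorphic_several g polydisk"
    using fb gb by (simp_all add: bounded_C1_def)
  have PQ: "holomorphic_several (P n) polydisk" "holomorphic_several (Q n) polydisk" for n
    using bounded_C1_multipolynomial [OF P(1)] bounded_C1_multipolynomial [OF Q(1)]
    by (simp_all add: bounded_C1_def)
  have "uniform_limit polydisk (\<lambda>n. partial_deriv k (\<lambda>z. P n z * Q n z)) (partial_deriv k (\<lambda>z. f z * g z)) sequentially" for k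
  proof -
    have "uniform_limit polydisk (\<lambda>n z. P n z * partial_deriv k (Q n) z + partial_deriv k (P n) z * Q n z)
        (\<lambda>z. f z * partial_deriv k g z + partial_deriv k f z * g z) sequentially"
      using fb gb P(2,3) Q(2,3)
      by (intro uniform_limit_add uniform_lim_mult) (auto simp: bounded_C1_def)
    then show ?thesis
      by (rule uniform_limit_cong' [THEN iffD1, rotated -1])
        (auto simp: holomorphic_several_mult(2) [OF hol] holomorphic_several_mult(2) [OF PQ])
  qed
  moreover have "uniform_limit polydisk (\<lambda>n z. P n z * Q n z) (\<lambda>z. f z * g z) sequentially"
    using fb gb P(2) Q(2) by (intro uniform_lim_mult) (auto simp: bounded_C1_def)
  ultimately show ?thesis
    unfolding C1_polynomial_limit_def using P(1) Q(1) fb gb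
    by (intro conjI exI [of _ "\<lambda>n z. P n z * Q n z"]) (auto simp: bounded_C1_mult multipolynomials_mult)
qed

lemma C1_polynomial_limit_power:
  "C1_polynomial_limit f \<Longrightarrow> C1_polynomial_limit (\<lambda>z. f z ^ m)"
  by (induction m)
    (simp_all add: C1_polynomial_limit_mult C1_polynomial_limit_multipolynomial multipolynomials_const)

lemma C1_polynomial_limit_in_little_bloch:
  fixes f :: "complex ^ 'n \<Rightarrow> complex"
  assumes f: "C1_polynomial_limit f" and p: "0 \<le> p"
  shows "zero_ext f \<in> little_bloch p"
  unfolding little_bloch_iff [OF p]
proof (intro conjI allI impI)
  have fb: "bounded_C1 f" using f by (simp add: C1_polynomial_limit_def)
  then show "zero_ext f \<in> bloch p" by (rule bounded_C1_in_bloch [OF _ p])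
  fix e :: real assume "0 < e"
  define d where "d = e / (real CARD('n) + 2)"
  \<comment> \<open>Of the \<open>CARD('n) + 2\<close> shares of \<open>e\<close>,
    \<open>CARD('n)\<close> pay for the weight and one for the value at 0; the last one is
    slack.\<close>
  have d: "0 < d" using \<open>0 < e\<close> by (simp add: d_def)
  obtain P where P: "\<And>n. P n \<in> multipolynomials" "uniform_limit polydisk P f sequentially"
      "\<And>k. uniform_limit polydisk (\<lambda>n. partial_deriv k (P n)) (partial_deriv k f) sequentially"
    using f unfolding C1_polynomial_limit_def by blast
  have "\<forall>\<^sub>F n in sequentially. \<forall>z\<in>polydisk. cmod (P n z - f z) < d"
    using P(2) d by (simp add: uniform_limit_iff dist_norm)
  moreover have "\<forall>\<^sub>F n in sequentially. \<forall>k. \<forall>z\<in>polydisk. cmod (partial_deriv k (P n) z - partial_deriv k f z) < d"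
    using P(3) d by (intro eventually_all_finite) (simp add: uniform_limit_iff dist_norm)
  ultimately obtain n where n: "\<And>z. z \<in> polydisk \<Longrightarrow> cmod (P n z - f z) < d"
      "\<And>k z. z \<in> polydisk \<Longrightarrow> cmod (partial_deriv k (P n) z - partial_deriv k f z) < d"
    using eventually_happens [OF eventually_conj] by fastforce
  have hol: "holomorphic_several f polydisk" "holomorphic_several (P n) polydisk"
    using fb bounded_C1_multipolynomial [OF P(1)] by (simp_all add: bounded_C1_def)
  note lin = holomorphic_several_linear [OF hol, where a = 1 and b = "-1", simplified]
  have "bloch_weight p (\<lambda>z. f z - P n z) z \<le> real CARD('n) * d" if "z \<in> polydisk" for z
    by (rule bloch_weight_le_C1_bound [OF _ p that])
      (use that n(2) [OF that] in \<open>auto simp: lin norm_minus_commute less_imp_le\<close>)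
  from bloch_zero_extI(2) [OF lin(1) this]
  have "bloch_norm p (\<lambda>z. zero_ext f z - zero_ext (P n) z) \<le> cmod (f 0 - P n 0) + real CARD('n) * d"
    by (simp add: zero_ext_diff)
  also have "\<dots> < (real CARD('n) + 2) * d"
    using n(1) [OF zero_in_polydisk] d by (simp add: norm_minus_commute algebra_simps)
  also have "\<dots> = e" by (simp add: d_def)
  finally show "\<exists>P\<in>polynomial_functions. bloch_norm p (\<lambda>z. zero_ext f z - P z) < e"
    using P(1) by (auto simp: polynomial_functions_eq)
qed

text \<open>The pole 1/c lies outside the closed unit disk, so the geometric series and its derived
  series have the summable majorants |c|^j and j |c|^(j-1) |c| on the whole polydisk. All test
  functions are assembled from this kernel.\<close>

lemma C1_polynomial_limit_geometric:
  fixes l :: "'n::finite"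
  assumes c: "cmod c < 1"
  shows "C1_polynomial_limit (\<lambda>z. 1 / (1 - c * z $ l))"
proof -
  let ?f = "\<lambda>w. 1 / (1 - c * w)" and ?f' = "\<lambda>w. c / (1 - c * w)\<^sup>2"
  have small: "cmod (c * z $ l) \<le> cmod c" if "z \<in> polydisk" for z :: "complex ^ 'n"
    using that by (simp add: polydisk_def norm_mult mult_left_le less_imp_le)
  then have lt1: "cmod (c * z $ l) < 1" if "z \<in> polydisk" for z :: "complex ^ 'n"
    using c that le_less_trans by blast
  then have ne: "c * z $ l \<noteq> 1" if "z \<in> polydisk" for z :: "complex ^ 'n"
    using that by force
  have "(?f has_field_derivative ?f' (z $ l)) (at (z $ l))" if "z \<in> polydisk" for z :: "complex ^ 'n"
    using ne [OF that] by (auto intro!: derivative_eq_intros simp: power2_eq_square)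
  note f = holomorphic_several_coordinate [where F = ?f and F' = ?f' and l = l, OF this]
  let ?P = "\<lambda>n w. \<Sum>j<n. (c * w) ^ j" and ?P' = "\<lambda>n w. \<Sum>j<n. of_nat j * (c * w) ^ (j - 1) * c"
  have "(?P n has_field_derivative ?P' n w) (at w)" for n w
    by (auto intro!: derivative_eq_intros sum.cong)
  note P = holomorphic_several_coordinate [where F = "?P n" and F' = "?P' n" and l = l and S = polydisk for n, OF this]
  have lim: "uniform_limit polydisk (\<lambda>n z. ?P n (z $ l)) (\<lambda>z. ?f (z $ l)) sequentially"
  proof -
    have "uniform_limit polydisk (\<lambda>n z. ?P n (z $ l)) (\<lambda>z. suminf (\<lambda>j. (c * z $ l) ^ j)) sequentially"
      by (rule Weierstrass_m_test [of _ _ "\<lambda>j. cmod c ^ j"])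
        (use c small in \<open>auto simp: norm_power summable_geometric intro!: power_mono\<close>)
    then show ?thesis
      by (rule uniform_limit_cong' [THEN iffD1, rotated -1]) (simp_all add: suminf_geometric lt1)
  qed
  \<comment> \<open>The term j = 0 has the truncated exponent \<open>0 - 1 = 0\<close>, but its
    factor j makes it vanish, so shifting the index by one does not change the sum.\<close>
  have series: "(\<lambda>j. of_nat j * u ^ (j - 1) * a) sums (a / (1 - u)\<^sup>2)" if "cmod u < 1" for u a :: complex
  proof -
    have "(\<lambda>j. of_nat (Suc j) * u ^ j * a) sums (1 / (1 - u)\<^sup>2 * a)"
      by (intro sums_mult2 geometric_deriv_sums that)
    then show ?thesis
      using sums_Suc_iff [of "\<lambda>j. of_nat j * u ^ (j - 1) * a"] by simp
  qed
  have summ: "summable (\<lambda>j. real j * cmod c ^ (j - 1) * cmod c)"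
  proof -
    have "summable (\<lambda>j. real (Suc j) * cmod c ^ j * cmod c)"
      using geometric_deriv_sums [of "cmod c"] c by (intro summable_mult2) (auto simp: sums_iff)
    then show ?thesis
      using summable_Suc_iff [of "\<lambda>j. real j * cmod c ^ (j - 1) * cmod c"] by simp
  qed
  have "uniform_limit polydisk (\<lambda>n z. ?P' n (z $ l)) (\<lambda>z. suminf (\<lambda>j. of_nat j * (c * z $ l) ^ (j - 1) * c)) sequentially"
    by (rule Weierstrass_m_test [OF _ summ])
      (use small in \<open>auto simp: norm_mult norm_power intro!: mult_right_mono mult_left_mono power_mono\<close>)
  then have lim': "uniform_limit polydisk (\<lambda>n z. ?P' n (z $ l)) (\<lambda>z. ?f' (z $ l)) sequentially"
    by (rule uniform_limit_cong' [THEN iffD1, rotated -1])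
      (use sums_unique [OF series [OF lt1], symmetric] in simp_all)
  have limk: "uniform_limit polydisk (\<lambda>n. partial_deriv k (\<lambda>z. ?P n (z $ l))) (partial_deriv k (\<lambda>z. ?f (z $ l))) sequentially" for k
  proof (cases "k = l")
    case True
    show ?thesis
      by (rule uniform_limit_cong' [THEN iffD1, OF _ _ lim']) (simp_all add: P f True)
  next
    case False
    have "uniform_limit (polydisk :: (complex ^ 'n) set) (\<lambda>_ _. 0) (\<lambda>_. 0 :: complex) sequentially"
      by (rule uniform_limit_const)
    then show ?thesis
      by (rule uniform_limit_cong' [THEN iffD1, rotated -1]) (simp_all add: P f False)
  qed
  have dist: "1 - cmod c \<le> cmod (1 - c * z $ l)" if "z \<in> polydisk" for z :: "complex ^ 'n"
    using small [OF that] norm_triangle_ineq2 [of 1 "c * z $ l"] by simp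
  \<comment> \<open>The bound natural for the derivative serves the function as well, because 1 -
    |c| \<le> 1.\<close>
  have "cmod (?f (z $ l)) \<le> 1 / (1 - cmod c)\<^sup>2" if "z \<in> polydisk" for z :: "complex ^ 'n"
  proof -
    have "cmod (?f (z $ l)) \<le> 1 / (1 - cmod c)"
      using c dist [OF that] by (simp add: norm_divide frac_le)
    also have "\<dots> \<le> 1 / (1 - cmod c)\<^sup>2"
      using c by (intro frac_le) (auto simp: power2_eq_square mult_left_le_one_le)
    finally show ?thesis .
  qed
  moreover have "cmod (?f' (z $ l)) \<le> 1 / (1 - cmod c)\<^sup>2" if "z \<in> polydisk" for z :: "complex ^ 'n"
    using c dist [OF that] by (auto simp: norm_divide norm_power intro!: frac_le power_mono)
  ultimately have "bounded_C1 (\<lambda>z. ?f (z $ l))"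
    unfolding bounded_C1_iff using f by (intro conjI exI [of _ "1 / (1 - cmod c)\<^sup>2"]) auto
  moreover have "(\<lambda>z. ?P n (z $ l)) \<in> multipolynomials" for n
    using multipolynomials_linear [OF multipolynomials_coordinate multipolynomials_const, of c l 0 0]
    by (intro multipolynomials_sum multipolynomials_power) simp
  ultimately show ?thesis
    unfolding C1_polynomial_limit_def using lim limk by (intro conjI exI [of _ "\<lambda>n z. ?P n (z $ l)"]) auto
qed

subsection \<open>Normal families\<close>

text \<open>\<open>partial_deriv\<close> is defined through the slice at the base point only. The
  Cauchy estimate needs the slice to be holomorphic on a whole disk, hence its derivative at every
  \<open>w\<close>.\<close>

lemma slice_has_field_derivative:
  fixes f :: "complex ^ 'n::finite \<Rightarrow> complex" and z :: "complex ^ 'n" and k :: 'n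
  defines "s \<equiv> \<lambda>w. \<chi> j. if j = k then w else z $ j"
  assumes f: "holomorphic_several f polydisk" and w: "s w \<in> polydisk"
  shows "((\<lambda>w. f (s w)) has_field_derivative partial_deriv k f (s w)) (at w)"
proof -
  have bl: "bounded_linear (\<lambda>h. h *s (axis k 1 :: complex ^ 'n))"
    by (intro linear_conv_bounded_linear [THEN iffD1] linearI) (auto simp: vec_eq_iff algebra_simps)
  have "((\<lambda>v. s w + (v - w) *s axis k 1) has_derivative (\<lambda>h. 0 + h *s (axis k 1 :: complex ^ 'n))) (at w)"
    by (intro has_derivative_add has_derivative_const bounded_linear.has_derivative [OF bl])
      (auto intro!: derivative_eq_intros)
  moreover have "(\<lambda>v. s w + (v - w) *s axis k 1) = s"
    by (auto simp: s_def fun_eq_iff vec_eq_iff axis_def)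
  ultimately have "(s has_derivative (\<lambda>h. h *s axis k 1)) (at w)" by simp
  from has_derivative_compose [OF this has_derivative_partial_deriv [OF f w]]
  have "((\<lambda>w. f (s w)) has_derivative
      (\<lambda>h. \<Sum>j\<in>UNIV. (h *s axis k 1) $ j * partial_deriv j f (s w))) (at w)" .
  also have "(\<lambda>h. \<Sum>j\<in>UNIV. (h *s axis k 1) $ j * partial_deriv j f (s w))
      = (\<lambda>h. \<Sum>j\<in>UNIV. if j = k then h * partial_deriv j f (s w) else 0)"
    by (intro ext sum.cong) (auto simp: axis_def)
  also have "\<dots> = (*) (partial_deriv k f (s w))" by (simp add: fun_eq_iff mult.commute)
  finally show ?thesis by (simp add: has_field_derivative_def)
qed

text \<open>One-variable Cauchy inequality on the circle of radius R' - R about z_k: moving this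
  single coordinate stays within \<open>closed_polydisk R'\<close>.\<close>

lemma partial_deriv_Cauchy_estimate:
  fixes f :: "complex ^ 'n \<Rightarrow> complex"
  assumes f: "holomorphic_several f polydisk" and R: "R < R'" "R' < 1"
    and B: "\<And>z. z \<in> closed_polydisk R' \<Longrightarrow> cmod (f z) \<le> B"
    and z: "z \<in> closed_polydisk R"
  shows "cmod (partial_deriv k f z) \<le> B / (R' - R)"
proof -
  let ?s = "\<lambda>w. (\<chi> j. if j = k then w else z $ j) :: complex ^ 'n"
  have s: "?s w \<in> closed_polydisk R'" if "w \<in> cball (z $ k) (R' - R)" for w
  proof -
    have "cmod w \<le> cmod (z $ k) + cmod (w - z $ k)"
      using norm_triangle_ineq [of "z $ k" "w - z $ k"] by simp
    moreover have "cmod (z $ k) \<le> R" "cmod (z $ j) \<le> R'" for j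
      using z R by (auto simp: closed_polydisk_def intro: order_trans less_imp_le)
    ultimately show ?thesis
      using that by (auto simp: closed_polydisk_def dist_norm norm_minus_commute)
  qed
  then have der: "((\<lambda>w. f (?s w)) has_field_derivative partial_deriv k f (?s w)) (at w)"
    if "w \<in> cball (z $ k) (R' - R)" for w
    using slice_has_field_derivative [OF f] closed_polydisk_subset [OF R(2)] that by blast
  have "norm ((deriv ^^ 1) (\<lambda>w. f (?s w)) (z $ k)) \<le> fact 1 * B / (R' - R) ^ 1"
  proof (rule Cauchy_inequality)
    show "(\<lambda>w. f (?s w)) holomorphic_on ball (z $ k) (R' - R)"
      unfolding holomorphic_on_def field_differentiable_def
      using has_field_derivative_at_within [OF der [OF subsetD [OF ball_subset_cball]]] by blast
    show "continuous_on (cball (z $ k) (R' - R)) (\<lambda>w. f (?s w))"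
      by (intro continuous_at_imp_continuous_on ballI DERIV_isCont [OF der])
    show "cmod (f (?s w)) \<le> B" if "norm (z $ k - w) = R' - R" for w
      using that by (intro B s) (simp add: dist_norm)
  qed (use R in simp)
  then show ?thesis by (simp add: partial_deriv_def)
qed

text \<open>Arzela-Ascoli on each member of a compact exhaustion, then a diagonal subsequence. A
  common Bloch bound yields both the uniform bound and a common Lipschitz constant on each compact
  polydisk.\<close>

lemma locally_uniform_subsequence:
  fixes f :: "nat \<Rightarrow> complex ^ 'n \<Rightarrow> complex"
  assumes p: "0 \<le> p" and f: "\<And>n. f n \<in> bloch p" "\<And>n. bloch_norm p (f n) \<le> N"
  obtains k :: "nat \<Rightarrow> nat" where "strict_mono k"
    "\<And>R. 0 \<le> R \<Longrightarrow> R < 1 \<Longrightarrow> uniformly_convergent_on (closed_polydisk R) (\<lambda>n. f (k n))"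
proof -
  \<comment> \<open>Radii in [0, 1) increasing to 1, so that every \<open>closed_polydisk R\<close>
    with R < 1 lies in some \<open>K i\<close>.\<close>
  define \<rho> :: "nat \<Rightarrow> real" where "\<rho> i = 1 - 1 / (real i + 1)" for i
  have \<rho>: "0 \<le> \<rho> i" "\<rho> i < 1" for i by (simp_all add: \<rho>_def divide_simps)
  define K :: "nat \<Rightarrow> (complex ^ 'n) set" where "K i = closed_polydisk (\<rho> i)" for i
  define \<Phi> where "\<Phi> i r \<longleftrightarrow> (\<exists>g. uniform_limit (K i) (\<lambda>n. f (r n)) g sequentially)" for i and r :: "nat \<Rightarrow> nat"
  have sub: "\<exists>k. strict_mono (k :: nat \<Rightarrow> nat) \<and> \<Phi> i (r \<circ> k)" for i r
  proof -
    obtain C where C: "0 < C" "\<And>(h :: complex ^ 'n \<Rightarrow> complex) z. h \<in> bloch p \<Longrightarrow>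
        z \<in> K i \<Longrightarrow> cmod (h z) \<le> C * bloch_norm p h"
      using bloch_growth [OF \<rho> p] unfolding K_def by blast
    define L where "L = real CARD('n) * (N / (1 - (\<rho> i)\<^sup>2) powr p)"
    have "0 \<le> N" using order_trans [OF bloch_norm_nonneg [OF f(1)] f(2)] .
    then have L: "0 \<le> L" by (simp add: L_def)
    have lip: "cmod (f (r n) x - f (r n) y) \<le> L * norm (x - y)" if "x \<in> K i" "y \<in> K i" for n x y
    proof -
      have "cmod (f (r n) x - f (r n) y)
          \<le> real CARD('n) * (bloch_norm p (f (r n)) / (1 - (\<rho> i)\<^sup>2) powr p) * norm (x - y)"
        using that unfolding K_def by (rule bloch_lipschitz [OF f(1) \<rho> p])
      also have "\<dots> \<le> L * norm (x - y)"
        unfolding L_def using f(2) by (intro mult_right_mono mult_left_mono divide_right_mono) auto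
      finally show ?thesis .
    qed
    obtain g k where "strict_mono (k :: nat \<Rightarrow> nat)"
      "\<And>e. 0 < e \<Longrightarrow> \<exists>M. \<forall>n x. n \<ge> M \<and> x \<in> K i \<longrightarrow> norm (f (r (k n)) x - g x) < e"
    proof (rule Arzela_Ascoli [of "K i" "\<lambda>n. f (r n)" "C * N"])
      show "compact (K i)" by (simp add: K_def compact_closed_polydisk)
      show "cmod (f (r n) x) \<le> C * N" if "x \<in> K i" for n x
        by (rule order_trans [OF C(2) [OF f(1) that] mult_left_mono [OF f(2) less_imp_le [OF C(1)]]])
      show "\<exists>d>0. \<forall>n y. y \<in> K i \<and> norm (x - y) < d \<longrightarrow> cmod (f (r n) x - f (r n) y) < e"
        if "x \<in> K i" "0 < e" for x e
      \<comment> \<open>\<open>L\<close> may be 0, whence the division by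
        \<open>L + 1\<close>.\<close>
      proof (intro exI [of _ "e / (L + 1)"] conjI allI impI)
        show "0 < e / (L + 1)" using L that by simp
        fix n y assume y: "y \<in> K i \<and> norm (x - y) < e / (L + 1)"
        have "cmod (f (r n) x - f (r n) y) \<le> L * norm (x - y)" using lip that y by blast
        also have "\<dots> \<le> (L + 1) * norm (x - y)" by (simp add: mult_right_mono)
        also have "\<dots> < e" using y L by (simp add: pos_less_divide_eq mult.commute)
        finally show "cmod (f (r n) x - f (r n) y) < e" .
      qed
    next
      fix g k assume "strict_mono (k :: nat \<Rightarrow> nat)"
        "\<And>e. 0 < e \<Longrightarrow> \<exists>M. \<forall>n x. n \<ge> M \<and> x \<in> K i \<longrightarrow> norm (f (r (k n)) x - g x) < e"
      then show thesis by (rule that)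
    qed
    then have "strict_mono k \<and> \<Phi> i (r \<circ> k)"
      unfolding \<Phi>_def uniform_limit_iff eventually_sequentially
      unfolding dist_norm o_def by (intro conjI exI [of _ g]) blast+
    then show ?thesis by blast
  qed
  obtain k where k: "strict_mono (k :: nat \<Rightarrow> nat)" "\<And>i. \<Phi> i (id \<circ> k)"
  proof (rule subsequence_diagonalization_lemma [of \<Phi> id, OF sub])
    \<comment> \<open>The diagonal sequence follows the i-th subsequence only from some index on.
      Convergence survives this, since each late index of \<open>k2\<close> matches an index of
      \<open>k1\<close> at least as large.\<close>
    show "\<Phi> i (r \<circ> k2)"
      if k1: "\<Phi> i (r \<circ> k1)" and k2: "\<And>j. M \<le> j \<Longrightarrow> \<exists>j'\<ge>j. k2 j = k1 j'" for i r k1 k2 M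
    proof -
      obtain g where g: "uniform_limit (K i) (\<lambda>n. f (r (k1 n))) g sequentially"
        using k1 by (auto simp: \<Phi>_def)
      have "uniform_limit (K i) (\<lambda>n. f (r (k2 n))) g sequentially"
        unfolding uniform_limit_iff eventually_sequentially
      proof (intro allI impI)
        fix e :: real assume "0 < e"
        then obtain M' where M': "\<And>n x. n \<ge> M' \<Longrightarrow> x \<in> K i \<Longrightarrow> dist (f (r (k1 n)) x) (g x) < e"
          using g unfolding uniform_limit_iff eventually_sequentially by blast
        have "\<forall>x\<in>K i. dist (f (r (k2 n)) x) (g x) < e" if n: "n \<ge> max M M'" for n
        proof -
          obtain j' where "n \<le> j'" "k2 n = k1 j'" using k2 [of n] n by auto
          with M' [of j'] n show ?thesis by auto
        qed
        then show "\<exists>M. \<forall>n\<ge>M. \<forall>x\<in>K i. dist (f (r (k2 n)) x) (g x) < e" by blast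
      qed
      then show ?thesis by (auto simp: \<Phi>_def)
    qed
  next
    fix k assume "strict_mono (k :: nat \<Rightarrow> nat)" "\<And>i. \<Phi> i (id \<circ> k)"
    then show thesis by (rule that)
  qed
  have "uniformly_convergent_on (closed_polydisk R) (\<lambda>n. f (k n))" if R: "0 \<le> R" "R < 1" for R
  proof -
    obtain i :: nat where i: "1 / (1 - R) < real i" using reals_Archimedean2 by blast
    then have "1 < real i * (1 - R)" using R by (simp add: pos_divide_less_eq)
    then have "R \<le> \<rho> i"
      using R by (simp add: \<rho>_def field_simps)
    then have "closed_polydisk R \<subseteq> K i" unfolding K_def by (rule closed_polydisk_mono)
    with k(2) [of i] show ?thesis
      unfolding \<Phi>_def uniformly_convergent_on_def by (auto intro: uniform_limit_on_subset)
  qed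
  with k(1) that show thesis by blast
qed

text \<open>Via the Cauchy criterion: the Cauchy estimate applies to the differences
  \<open>h m - h n\<close>, which are holomorphic, so nothing has to be known about a limit function
  yet. The loss 1/(R' - R) is prepaid in the tolerance for the functions.\<close>

lemma uniformly_convergent_partial_deriv:
  fixes h :: "nat \<Rightarrow> complex ^ 'n \<Rightarrow> complex"
  assumes h: "\<And>n. holomorphic_several (h n) polydisk"
    and conv: "\<And>R. 0 \<le> R \<Longrightarrow> R < 1 \<Longrightarrow> uniformly_convergent_on (closed_polydisk R) h"
    and R: "0 \<le> R" "R < 1"
  shows "uniformly_convergent_on (closed_polydisk R) (\<lambda>n. partial_deriv k (h n))"
proof (rule Cauchy_uniformly_convergent, rule uniformly_Cauchy_onI)
  fix e :: real assume e: "0 < e"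
  define R' where "R' = (1 + R) / 2"
  have R': "0 \<le> R'" "R < R'" "R' < 1" using R by (auto simp: R'_def)
  have "0 < e / 2 * (R' - R)" using e R' by simp
  with uniformly_convergent_Cauchy [OF conv [OF R'(1,3)]]
  obtain M where M: "\<And>z m n. z \<in> closed_polydisk R' \<Longrightarrow> M \<le> m \<Longrightarrow> M \<le> n \<Longrightarrow>
      dist (h m z) (h n z) < e / 2 * (R' - R)"
    unfolding uniformly_Cauchy_on_def by metis
  have "dist (partial_deriv k (h m) z) (partial_deriv k (h n) z) < e"
    if "z \<in> closed_polydisk R" "M \<le> m" "M \<le> n" for z m n
  proof -
    note lin = holomorphic_several_linear [OF h h, where a = 1 and b = "-1", simplified]
    have zp: "z \<in> polydisk" using that closed_polydisk_subset [OF R(2)] by blast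
    have "cmod (partial_deriv k (\<lambda>z. h m z - h n z) z) \<le> e / 2 * (R' - R) / (R' - R)"
      using M that by (intro partial_deriv_Cauchy_estimate [OF lin(1) R'(2,3)]) (auto simp: dist_norm less_imp_le)
    also have "e / 2 * (R' - R) / (R' - R) = e / 2" using R' by (intro nonzero_mult_div_cancel_right) simp
    also have "\<dots> < e" using e by simp
    finally show ?thesis by (simp add: lin(2) [OF zp] dist_norm)
  qed
  then show "\<exists>M. \<forall>z\<in>closed_polydisk R. \<forall>m\<ge>M. \<forall>n\<ge>M.
      dist (partial_deriv k (h m) z) (partial_deriv k (h n) z) < e" by blast
qed

text \<open>The Weierstrass theorem in several variables, by differentiating the limit through
  uniform convergence of the derivatives.\<close>

lemma holomorphic_several_limit:
  fixes h :: "nat \<Rightarrow> complex ^ 'n \<Rightarrow> complex"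
  assumes h: "\<And>n. holomorphic_several (h n) polydisk"
    and conv: "\<And>R. 0 \<le> R \<Longrightarrow> R < 1 \<Longrightarrow> uniformly_convergent_on (closed_polydisk R) h"
    and lim: "\<And>z. z \<in> polydisk \<Longrightarrow> (\<lambda>n. h n z) \<longlonglongrightarrow> g z"
  shows "holomorphic_several g polydisk"
    and "0 \<le> R \<Longrightarrow> R < 1 \<Longrightarrow>
      uniform_limit (closed_polydisk R) (\<lambda>n. partial_deriv k (h n)) (partial_deriv k g) sequentially"
proof -
  \<comment> \<open>Only candidates at first: the pointwise limits of the partial derivatives. They
    are recognised as partial derivatives of \<open>g\<close> once \<open>g\<close> is known to be
    differentiable.\<close>
  define d where "d k z = lim (\<lambda>n. partial_deriv k (h n) z)" for k z
  have d: "uniform_limit (closed_polydisk R) (\<lambda>n. partial_deriv k (h n)) (d k) sequentially"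
    if "0 \<le> R" "R < 1" for R k
  proof -
    have "uniformly_convergent_on (closed_polydisk R) (\<lambda>n. partial_deriv k (h n))"
      using h conv that by (rule uniformly_convergent_partial_deriv)
    then show ?thesis by (simp add: uniformly_convergent_uniform_limit_iff d_def [abs_def])
  qed
  have *: "(g has_derivative (\<lambda>v. \<Sum>k\<in>UNIV. v $ k * d k z)) (at z)" if z: "z \<in> polydisk" for z
  proof -
    obtain R where R: "0 \<le> R" "R < 1" "z \<in> closed_polydisk R" by (rule polydisk_exhaustion [OF z])
    \<comment> \<open>Half the room left between R and 1, so the ball around z stays within a closed
      polydisk of radius R + r < 1, where the convergence is uniform.\<close>
    define r where "r = (1 - R) / 2"
    have r: "0 < r" "0 \<le> R + r" "R + r < 1" using R by (simp_all add: r_def field_simps)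
    have sub: "ball z r \<subseteq> closed_polydisk (R + r)"
    proof
      fix w assume "w \<in> ball z r"
      then have wz: "norm (w - z) < r" by (simp add: dist_norm norm_minus_commute)
      have "cmod (w $ k) \<le> R + r" for k
      proof -
        have "cmod (w $ k - z $ k) \<le> norm (w - z)"
          using Finite_Cartesian_Product.norm_nth_le [of "w - z" k] by simp
        moreover have "cmod (z $ k) \<le> R" using R(3) by (simp add: closed_polydisk_def)
        ultimately show ?thesis using wz norm_triangle_sub [of "w $ k" "z $ k"] by linarith
      qed
      then show "w \<in> closed_polydisk (R + r)" by (simp add: closed_polydisk_def)
    qed
    then have sub': "ball z r \<subseteq> polydisk" using closed_polydisk_subset [OF r(3)] by blast
    \<comment> \<open>The theorem on sequences of derivatives supplies its own limit function on the
      ball; uniqueness of pointwise limits identifies it with \<open>g\<close> afterwards.\<close>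
    have "\<exists>g'. \<forall>x\<in>ball z r. (\<lambda>n. h n x) \<longlonglongrightarrow> g' x \<and>
        (g' has_derivative (\<lambda>v. \<Sum>k\<in>UNIV. v $ k * d k x)) (at x within ball z r)"
    proof (rule has_derivative_sequence [OF convex_ball])
      show "(h n has_derivative (\<lambda>v. \<Sum>k\<in>UNIV. v $ k * partial_deriv k (h n) x)) (at x within ball z r)"
        if "x \<in> ball z r" for n x
        by (rule has_derivative_at_withinI [OF has_derivative_partial_deriv [OF h subsetD [OF sub' that]]])
      show "\<forall>\<^sub>F n in sequentially. \<forall>x\<in>ball z r. \<forall>v. norm ((\<Sum>k\<in>UNIV. v $ k * partial_deriv k (h n) x)
          - (\<Sum>k\<in>UNIV. v $ k * d k x)) \<le> e * norm v" if "0 < e" for e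
      proof -
        have "0 < e / real CARD('n)" using that by simp
        then have "\<forall>\<^sub>F n in sequentially. \<forall>k. \<forall>x\<in>closed_polydisk (R + r).
            dist (partial_deriv k (h n) x) (d k x) < e / real CARD('n)"
          using d [OF r(2,3)] by (intro eventually_all_finite) (simp add: uniform_limit_iff)
        then show ?thesis
        proof eventually_elim
          case (elim n)
          show ?case
          proof (intro ballI allI)
            fix x and v :: "complex ^ 'n" assume "x \<in> ball z r"
            then have "x \<in> closed_polydisk (R + r)" using sub by blast
            then have "cmod (partial_deriv k (h n) x - d k x) \<le> e / real CARD('n)" for k
              using elim by (simp add: dist_norm less_imp_le)
            from cmod_linear_form_le [OF this, of v]
            show "norm ((\<Sum>k\<in>UNIV. v $ k * partial_deriv k (h n) x)
                - (\<Sum>k\<in>UNIV. v $ k * d k x)) \<le> e * norm v"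
              by (simp add: right_diff_distrib sum_subtractf)
          qed
        qed
      qed
      show "z \<in> ball z r" using r by simp
      show "(\<lambda>n. h n z) \<longlonglongrightarrow> g z" by (rule lim [OF z])
    qed
    then obtain g' where g': "\<forall>x\<in>ball z r. (\<lambda>n. h n x) \<longlonglongrightarrow> g' x \<and>
        (g' has_derivative (\<lambda>v. \<Sum>k\<in>UNIV. v $ k * d k x)) (at x within ball z r)" ..
    have zr: "z \<in> ball z r" using r(1) by simp
    have "(g' has_derivative (\<lambda>v. \<Sum>k\<in>UNIV. v $ k * d k z)) (at z)"
      using conjunct2 [OF bspec [OF g' zr]] unfolding at_within_open [OF zr open_ball] .
    then show ?thesis
    proof (rule has_derivative_transform_within_open [OF _ open_ball zr])
      show "g' x = g x" if "x \<in> ball z r" for x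
        by (rule LIMSEQ_unique [OF conjunct1 [OF bspec [OF g' that]] lim [OF subsetD [OF sub' that]]])
    qed
  qed
  show "holomorphic_several g polydisk" by (rule holomorphic_severalI [OF *])
  show "uniform_limit (closed_polydisk R) (\<lambda>n. partial_deriv k (h n)) (partial_deriv k g) sequentially"
    if R: "0 \<le> R" "R < 1"
  proof (rule uniform_limit_cong' [THEN iffD1, OF _ _ d [OF R]])
    show "d k z = partial_deriv k g z" if "z \<in> closed_polydisk R" for z
      by (rule partial_deriv_eqI [OF *, symmetric]) (rule subsetD [OF closed_polydisk_subset [OF R(2)] that])
  qed simp
qed

text \<open>Montel's theorem for norm-bounded sequences. The pointwise bounds on the weight survive
  the limit, so \<open>g\<close> is a Bloch function. The bound 2 N arises from estimating |g(0)|
  and the supremum of the weight by N each.\<close>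

lemma bloch_normal_family:
  fixes f :: "nat \<Rightarrow> complex ^ 'n \<Rightarrow> complex"
  assumes p: "0 \<le> p" and f: "\<And>n. f n \<in> bloch p" "\<And>n. bloch_norm p (f n) \<le> N"
  obtains g and k :: "nat \<Rightarrow> nat" where "strict_mono k" "g \<in> bloch p" "bloch_norm p g \<le> 2 * N"
    "\<And>z. (\<lambda>n. f (k n) z) \<longlonglongrightarrow> g z"
    "\<And>R j. 0 \<le> R \<Longrightarrow> R < 1 \<Longrightarrow>
      uniform_limit (closed_polydisk R) (\<lambda>n. partial_deriv j (f (k n))) (partial_deriv j g) sequentially"
proof -
  obtain k where k: "strict_mono k" "\<And>R. 0 \<le> R \<Longrightarrow> R < 1 \<Longrightarrow>
      uniformly_convergent_on (closed_polydisk R) (\<lambda>n. f (k n))"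
  proof (rule locally_uniform_subsequence [where f = f, OF p f])
    fix k assume "strict_mono (k :: nat \<Rightarrow> nat)" "\<And>R. 0 \<le> R \<Longrightarrow> R < 1 \<Longrightarrow>
      uniformly_convergent_on (closed_polydisk R) (\<lambda>n. f (k n))"
    then show thesis by (rule that)
  qed
  \<comment> \<open>Outside the polydisk all terms are 0, so this limit is 0 there, as membership in
    \<open>bloch p\<close> demands.\<close>
  define g where "g z = lim (\<lambda>n. f (k n) z)" for z
  have lim: "(\<lambda>n. f (k n) z) \<longlonglongrightarrow> g z" if z: "z \<in> polydisk" for z
  proof -
    obtain R where R: "0 \<le> R" "R < 1" "z \<in> closed_polydisk R" by (rule polydisk_exhaustion [OF z])
    with k(2) have "uniform_limit (closed_polydisk R) (\<lambda>n. f (k n)) g sequentially"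
      by (simp add: uniformly_convergent_uniform_limit_iff g_def [abs_def])
    then show ?thesis using R(3) by (rule tendsto_uniform_limitI)
  qed
  have hol: "holomorphic_several (f (k n)) polydisk" for n using f(1) by (simp add: bloch_def)
  have g1: "holomorphic_several g polydisk"
    using hol k(2) lim by (rule holomorphic_several_limit(1))
  have g2: "uniform_limit (closed_polydisk R) (\<lambda>n. partial_deriv j (f (k n))) (partial_deriv j g) sequentially"
    if "0 \<le> R" "R < 1" for R j
    using hol k(2) lim that by (rule holomorphic_several_limit(2))
  have f0: "f n z = 0" if "z \<notin> polydisk" for n z using f(1) that by (simp add: bloch_def)
  then have g0: "g z = 0" if "z \<notin> polydisk" for z using that by (simp add: g_def)
  have "bloch_weight p g z \<le> N" if z: "z \<in> polydisk" for z
  proof (rule LIMSEQ_le_const2)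
    obtain R where R: "0 \<le> R" "R < 1" "z \<in> closed_polydisk R" by (rule polydisk_exhaustion [OF z])
    have "(\<lambda>n. partial_deriv j (f (k n)) z) \<longlonglongrightarrow> partial_deriv j g z" for j
      by (rule tendsto_uniform_limitI [OF g2 [OF R(1,2)] R(3)])
    then show "(\<lambda>n. bloch_weight p (f (k n)) z) \<longlonglongrightarrow> bloch_weight p g z"
      unfolding bloch_weight_def by (intro tendsto_intros)
    show "\<exists>M. \<forall>n\<ge>M. bloch_weight p (f (k n)) z \<le> N"
      using order_trans [OF bloch_weight_le_norm [OF f(1) z] f(2)] by blast
  qed
  note gb = bloch_zero_extI [OF g1 this]
  have "zero_ext g = g" using g0 by (auto simp: zero_ext_def)
  moreover have "cmod (g 0) \<le> N"
    using order_trans [OF cmod_at_0_le_bloch_norm [OF f(1)] f(2)]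
    by (intro LIMSEQ_le_const2 [OF tendsto_norm [OF lim [OF zero_in_polydisk]]]) blast
  ultimately have "g \<in> bloch p" "bloch_norm p g \<le> 2 * N" using gb by simp_all
  moreover have "(\<lambda>n. f (k n) z) \<longlonglongrightarrow> g z" for z
    by (cases "z \<in> polydisk") (simp_all add: lim f0 g0)
  ultimately show thesis using k(1) g2 by (intro that)
qed

subsection \<open>Test functions\<close>

lemma one_minus_cnj_mult_bounds:
  assumes w: "cmod w < 1" and u: "cmod u < 1"
  shows "0 < cmod (1 - cnj w * u)"
    and "1 - cmod u \<le> cmod (1 - cnj w * u)"
    and "1 - (cmod w)\<^sup>2 \<le> 2 * cmod (1 - cnj w * u)"
    and "1 - (cmod u)\<^sup>2 \<le> 2 * cmod (1 - cnj w * u)"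
proof -
  have le: "1 - cmod w * cmod u \<le> cmod (1 - cnj w * u)"
    using norm_triangle_ineq2 [of 1 "cnj w * u"] by (simp add: norm_mult)
  have "cmod w * cmod u \<le> cmod u" "cmod w * cmod u \<le> cmod w"
    using w u by (auto intro: mult_left_le_one_le mult_right_le_one_le)
  with le have *: "1 - cmod u \<le> cmod (1 - cnj w * u)" "1 - cmod w \<le> cmod (1 - cnj w * u)"
    by linarith+
  then show "0 < cmod (1 - cnj w * u)" "1 - cmod u \<le> cmod (1 - cnj w * u)"
    using u by linarith+
  \<comment> \<open>1 - x^2 \<le> 2 (1 - x) is (x - 1)^2 \<ge> 0 rearranged. It is applied to the
    moduli of w and u, since |1 - cnj w u| dominates both 1 - |w| and 1 - |u|.\<close>
  have "1 - x\<^sup>2 \<le> 2 * c" if "1 - x \<le> c" for x c :: real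
    using zero_le_power2 [of "x - 1"] that by (simp add: power2_eq_square algebra_simps)
  with * show "1 - (cmod w)\<^sup>2 \<le> 2 * cmod (1 - cnj w * u)" "1 - (cmod u)\<^sup>2 \<le> 2 * cmod (1 - cnj w * u)"
    by blast+
qed

text \<open>With m = \<open>nat \<lceil>p\<rceil>\<close> the kernel is raised to an integer power,
  so no branch of a complex power is involved. The exponent m + 1 - p of the prefactor makes the
  derivative at z_l = w equal to m cnj(w) (1 - |w|^2)^(-p); being positive, it also makes the
  functions tend to 0 pointwise as |w| tends to 1.\<close>

definition derivative_peak :: "real \<Rightarrow> 'n \<Rightarrow> complex \<Rightarrow> complex ^ 'n \<Rightarrow> complex" where
  "derivative_peak p l w z =
     of_real ((1 - (cmod w)\<^sup>2) powr (real (nat \<lceil>p\<rceil>) + 1 - p)) * (1 / (1 - cnj w * z $ l)) ^ nat \<lceil>p\<rceil>"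

lemma derivative_peak_props:
  fixes l :: "'n::finite"
  assumes p: "0 < p" and w: "cmod w < 1"
  defines "m \<equiv> nat \<lceil>p\<rceil>"
  shows derivative_peak_C1_limit: "C1_polynomial_limit (derivative_peak p l w)"
    and partial_deriv_derivative_peak: "z \<in> polydisk \<Longrightarrow> partial_deriv k (derivative_peak p l w) z =
      (if k = l then of_real ((1 - (cmod w)\<^sup>2) powr (real m + 1 - p)) *
        (of_nat m * cnj w / (1 - cnj w * z $ l) ^ (m + 1)) else 0)"
    and bloch_norm_derivative_peak: "bloch_norm p (zero_ext (derivative_peak p l w)) \<le> 1 + real m * 2 ^ (m + 1)"
    and cmod_derivative_peak_le: "z \<in> polydisk \<Longrightarrow> cmod (derivative_peak p l w z) \<le>
      (1 - (cmod w)\<^sup>2) powr (real m + 1 - p) * (1 / (1 - cmod (z $ l))) ^ m"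
proof -
  define A where "A = 1 - (cmod w)\<^sup>2"
  define a where "a = A powr (real m + 1 - p)"
  have A: "0 < A" "A \<le> 1" using w by (simp_all add: A_def abs_square_less_1)
  have m: "0 < m" "p \<le> real m" using p by (simp_all add: m_def)
  have a: "0 < a" "a \<le> 1" using A m by (auto simp: a_def intro: powr_le1)
  have eq: "derivative_peak p l w = (\<lambda>z. of_real a * (1 / (1 - cnj w * z $ l)) ^ m)"
    by (simp add: fun_eq_iff derivative_peak_def a_def A_def m_def)
  note bounds = one_minus_cnj_mult_bounds [OF w]
  have zl: "cmod (z $ l) < 1" if "z \<in> polydisk" for z using that by (simp add: polydisk_def)
  show lim: "C1_polynomial_limit (derivative_peak p l w)"
    unfolding eq using w
    by (intro C1_polynomial_limit_mult C1_polynomial_limit_power C1_polynomial_limit_geometric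
        C1_polynomial_limit_multipolynomial multipolynomials_const) simp
  have D: "((\<lambda>u. of_real a * (1 / (1 - cnj w * u)) ^ m) has_field_derivative
      (\<lambda>u. of_real a * (of_nat m * cnj w / (1 - cnj w * u) ^ (m + 1))) (z $ l)) (at (z $ l))"
    if "z \<in> polydisk" for z
  proof -
    have ne: "1 - cnj w * z $ l \<noteq> 0" using bounds(1) [OF zl [OF that]] by force
    obtain j where j: "m = Suc j" using m(1) gr0_conv_Suc by blast
    have "((\<lambda>u. 1 / (1 - cnj w * u)) has_field_derivative cnj w / (1 - cnj w * z $ l)\<^sup>2) (at (z $ l))"
      using ne by (auto intro!: derivative_eq_intros simp: power2_eq_square)
    from DERIV_cmult [OF DERIV_power [OF this, of m], of "of_real a"] show ?thesis
      by (rule DERIV_cong) (simp add: j power_divide power2_eq_square)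
  qed
  have peak: "holomorphic_several (\<lambda>z :: complex ^ 'n. of_real a * (1 / (1 - cnj w * z $ l)) ^ m) polydisk"
    using D by (rule holomorphic_several_coordinate(1))
  have der: "partial_deriv k (derivative_peak p l w) z =
      (if k = l then of_real a * (of_nat m * cnj w / (1 - cnj w * z $ l) ^ (m + 1)) else 0)"
    if "z \<in> polydisk" for k z
    unfolding eq using D that by (rule holomorphic_several_coordinate(2))
  then show "z \<in> polydisk \<Longrightarrow> partial_deriv k (derivative_peak p l w) z =
      (if k = l then of_real ((1 - (cmod w)\<^sup>2) powr (real m + 1 - p)) *
        (of_nat m * cnj w / (1 - cnj w * z $ l) ^ (m + 1)) else 0)"
    by (simp add: a_def A_def)
  show "cmod (derivative_peak p l w z) \<le> (1 - (cmod w)\<^sup>2) powr (real m + 1 - p) * (1 / (1 - cmod (z $ l))) ^ m"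
    if z: "z \<in> polydisk" for z
  proof -
    have "cmod (1 / (1 - cnj w * z $ l)) \<le> 1 / (1 - cmod (z $ l))"
      using bounds(2) [OF zl [OF z]] zl [OF z] by (simp add: norm_divide frac_le)
    then have "cmod ((1 / (1 - cnj w * z $ l)) ^ m) \<le> (1 / (1 - cmod (z $ l))) ^ m"
      unfolding norm_power by (intro power_mono) auto
    then show ?thesis
      unfolding eq a_def [symmetric] A_def [symmetric] using a(1) by (simp add: norm_mult mult_left_mono)
  qed
  have "bloch_weight p (derivative_peak p l w) z \<le> real m * 2 ^ (m + 1)" if z: "z \<in> polydisk" for z
  proof -
    define c where "c = cmod (1 - cnj w * z $ l)"
    define Z where "Z = 1 - (cmod (z $ l))\<^sup>2"
    have c: "0 < c" "A \<le> 2 * c" "Z \<le> 2 * c"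
      using bounds [OF zl [OF z]] by (simp_all add: c_def A_def Z_def)
    have Z: "0 < Z" using one_minus_square_pos [OF z] by (simp add: Z_def)
    \<comment> \<open>\<open>A\<close> and \<open>Z\<close> are both at most 2 c; the exponents m +
      1 - p and p are nonnegative and add up to m + 1, the power of c in the denominator of the
      derivative.\<close>
    have "a * Z powr p \<le> (2 * c) powr (real m + 1 - p) * (2 * c) powr p"
      unfolding a_def using A c Z m p by (intro mult_mono powr_mono2) auto
    also have "\<dots> = (2 * c) powr real (m + 1)"
      by (simp add: add.commute flip: powr_add)
    also have "\<dots> = (2 * c) ^ (m + 1)" using c by (intro powr_realpow) simp
    finally have aZ: "a * Z powr p / c ^ (m + 1) \<le> 2 ^ (m + 1)"
      using c(1) by (simp add: pos_divide_le_eq power_mult_distrib mult_ac)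
    have "bloch_weight p (derivative_peak p l w) z
        = (\<Sum>k\<in>UNIV. if k = l then a * (real m * cmod w / c ^ (m + 1)) * Z powr p else 0)"
      unfolding bloch_weight_def using a(1)
      by (intro sum.cong refl) (simp add: der [OF z] norm_mult norm_divide norm_power c_def Z_def)
    also have "\<dots> = (real m * cmod w) * (a * Z powr p / c ^ (m + 1))" by simp
    also have "\<dots> \<le> (real m * 1) * 2 ^ (m + 1)"
      using w a(1) c(1) by (intro mult_mono aZ) auto
    finally show ?thesis by simp
  qed
  moreover have "holomorphic_several (derivative_peak p l w) polydisk"
    unfolding eq by (rule peak)
  moreover have "cmod (derivative_peak p l w 0) \<le> 1"
    using a by (simp add: eq)
  ultimately show "bloch_norm p (zero_ext (derivative_peak p l w)) \<le> 1 + real m * 2 ^ (m + 1)"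
    using bloch_zero_extI(2) by fastforce
qed

text \<open>At a point with z_l = b and z_m = w the l-th partial derivative is 1, and the factor
  \<open>z $ l - b\<close> makes the m-th one vanish. The factor 1 - |w|^2 normalises the former and
  sends the functions to 0 pointwise as |w| tends to 1.\<close>

definition mixed_peak :: "'n \<Rightarrow> 'n \<Rightarrow> complex \<Rightarrow> complex \<Rightarrow> complex ^ 'n \<Rightarrow> complex" where
  "mixed_peak l m b w z = (z $ l - b) * (of_real (1 - (cmod w)\<^sup>2) * (1 / (1 - cnj w * z $ m)))"

lemma mixed_peak_props:
  fixes l m :: "'n::finite"
  assumes p: "1 \<le> p" and w: "cmod w < 1" and b: "cmod b < 1" and lm: "l \<noteq> m"
  shows mixed_peak_C1_limit: "C1_polynomial_limit (mixed_peak l m b w)"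
    and partial_deriv_mixed_peak: "z \<in> polydisk \<Longrightarrow> partial_deriv k (mixed_peak l m b w) z =
      (if k = l then of_real (1 - (cmod w)\<^sup>2) * (1 / (1 - cnj w * z $ m))
       else if k = m then (z $ l - b) * (of_real (1 - (cmod w)\<^sup>2) * (cnj w / (1 - cnj w * z $ m)\<^sup>2)) else 0)"
    and bloch_norm_mixed_peak: "bloch_norm p (zero_ext (mixed_peak l m b w)) \<le> 11"
    and cmod_mixed_peak_le: "z \<in> polydisk \<Longrightarrow> cmod (mixed_peak l m b w z) \<le>
      2 * ((1 - (cmod w)\<^sup>2) * (1 / (1 - cmod (z $ m))))"
proof -
  define A where "A = 1 - (cmod w)\<^sup>2"
  have A: "0 < A" "A \<le> 1" using w by (simp_all add: A_def abs_square_less_1)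
  have eq: "mixed_peak l m b w = (\<lambda>z. (z $ l - b) * (of_real A * (1 / (1 - cnj w * z $ m))))"
    by (simp add: fun_eq_iff mixed_peak_def A_def)
  note bounds = one_minus_cnj_mult_bounds [OF w]
  have zk: "cmod (z $ k) < 1" if "z \<in> polydisk" for z and k :: 'n using that by (simp add: polydisk_def)
  have zb: "cmod (z $ l - b) \<le> 2" if "z \<in> polydisk" for z
    using zk [OF that, of l] b norm_triangle_ineq4 [of "z $ l" b] by linarith
  have "(\<lambda>z :: complex ^ 'n. z $ l - b) \<in> multipolynomials"
    using multipolynomials_linear [OF multipolynomials_coordinate multipolynomials_const, of 1 l "-1" b] by simp
  then show "C1_polynomial_limit (mixed_peak l m b w)"
    unfolding eq using w
    by (intro C1_polynomial_limit_mult C1_polynomial_limit_geometric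
        C1_polynomial_limit_multipolynomial multipolynomials_const) simp_all
  have "((\<lambda>u. u - b) has_field_derivative (\<lambda>_. 1) (z $ l)) (at (z $ l))" for z :: "complex ^ 'n"
    by (auto intro!: derivative_eq_intros)
  note lin = holomorphic_several_coordinate [where S = polydisk and l = l and F = "\<lambda>u. u - b"
      and F' = "\<lambda>_. 1", OF this]
  have D: "((\<lambda>u. of_real A * (1 / (1 - cnj w * u))) has_field_derivative
      (\<lambda>u. of_real A * (cnj w / (1 - cnj w * u)\<^sup>2)) (z $ m)) (at (z $ m))"
    if "z \<in> polydisk" for z
  proof -
    have "1 - cnj w * z $ m \<noteq> 0" using bounds(1) [OF zk [OF that]] by force
    then show ?thesis by (auto intro!: derivative_eq_intros simp: power2_eq_square)
  qed
  have peak1: "holomorphic_several (\<lambda>z :: complex ^ 'n. of_real A * (1 / (1 - cnj w * z $ m))) polydisk"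
    using D by (rule holomorphic_several_coordinate(1))
  have peak2: "partial_deriv k (\<lambda>z. of_real A * (1 / (1 - cnj w * z $ m))) z
      = (if k = m then of_real A * (cnj w / (1 - cnj w * z $ m)\<^sup>2) else 0)" if "z \<in> polydisk" for k z
    using D that by (rule holomorphic_several_coordinate(2))
  have der: "partial_deriv k (mixed_peak l m b w) z =
      (if k = l then of_real A * (1 / (1 - cnj w * z $ m))
       else if k = m then (z $ l - b) * (of_real A * (cnj w / (1 - cnj w * z $ m)\<^sup>2)) else 0)"
    if "z \<in> polydisk" for k z
    unfolding eq holomorphic_several_mult(2) [OF lin(1) peak1 that] lin(2) [OF that] peak2 [OF that]
    using lm by simp
  then show "z \<in> polydisk \<Longrightarrow> partial_deriv k (mixed_peak l m b w) z =
      (if k = l then of_real (1 - (cmod w)\<^sup>2) * (1 / (1 - cnj w * z $ m))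
       else if k = m then (z $ l - b) * (of_real (1 - (cmod w)\<^sup>2) * (cnj w / (1 - cnj w * z $ m)\<^sup>2)) else 0)"
    by (simp add: A_def)
  show "cmod (mixed_peak l m b w z) \<le> 2 * ((1 - (cmod w)\<^sup>2) * (1 / (1 - cmod (z $ m))))"
    if z: "z \<in> polydisk" for z
  proof -
    have "cmod (1 / (1 - cnj w * z $ m)) \<le> 1 / (1 - cmod (z $ m))"
      using bounds(2) [OF zk [OF z]] zk [OF z] by (simp add: norm_divide frac_le)
    then show ?thesis
      unfolding eq A_def [symmetric] norm_mult using A(1) zb [OF z] by (intro mult_mono) auto
  qed
  \<comment> \<open>10 = 2 + 8: direction l contributes A / c \<le> 2; direction m contributes |z_l
    - b| \<le> 2 times a quotient bounded by 4. The value at 0 adds at most 1 to the norm.\<close>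
  have "bloch_weight p (mixed_peak l m b w) z \<le> 10" if z: "z \<in> polydisk" for z
  proof -
    define c where "c = cmod (1 - cnj w * z $ m)"
    define Z where "Z k = 1 - (cmod (z $ k))\<^sup>2" for k
    have c: "0 < c" "A \<le> 2 * c" "Z m \<le> 2 * c"
      using bounds [OF zk [OF z]] by (simp_all add: c_def A_def Z_def)
    have Z: "0 < Z k" "Z k \<le> 1" for k using one_minus_square_pos [OF z, of k] by (simp_all add: Z_def)
    \<comment> \<open>Here p \<ge> 1 enters: the derivative in z_m is of order A / c^2, and one full
      power of Z m \<le> 2 c, next to A \<le> 2 c, is needed to absorb c^2.\<close>
    have Zp: "Z k powr p \<le> Z k" for k
      using powr_mono' [of 1 p "Z k"] Z [of k] p by simp
    have Z1: "Z k powr p \<le> 1" for k using Zp [of k] Z [of k] by linarith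
    have "A * Z m powr p \<le> (2 * c) * (2 * c)"
      using A Z Zp [of m] c by (intro mult_mono) auto
    then have AZ: "A * Z m powr p / c\<^sup>2 \<le> 4"
      using c(1) by (simp add: pos_divide_le_eq power2_eq_square)
    have "cmod (z $ l - b) * (A * (cmod w / c\<^sup>2)) * Z m powr p
        = (cmod (z $ l - b) * cmod w) * (A * Z m powr p / c\<^sup>2)" by simp
    also have "\<dots> \<le> (2 * 1) * 4" using zb [OF z] w A by (intro mult_mono AZ) auto
    finally have 8: "cmod (z $ l - b) * (A * (cmod w / c\<^sup>2)) * Z m powr p \<le> 8" by simp
    have "A * (1 / c) * Z l powr p \<le> 2 * 1"
      using c A Z1 by (intro mult_mono) (auto simp: pos_divide_le_eq)
    then have 2: "A * (1 / c) * Z l powr p \<le> 2" by simp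
    have "bloch_weight p (mixed_peak l m b w) z
        = (\<Sum>k\<in>UNIV. (if k = l then A * (1 / c) * Z l powr p else 0) +
            (if k = m then cmod (z $ l - b) * (A * (cmod w / c\<^sup>2)) * Z m powr p else 0))"
      unfolding bloch_weight_def using A(1) lm
      by (intro sum.cong refl) (auto simp: der [OF z] norm_mult norm_divide norm_power c_def Z_def)
    also have "\<dots> = A * (1 / c) * Z l powr p + cmod (z $ l - b) * (A * (cmod w / c\<^sup>2)) * Z m powr p"
      by (simp add: sum.distrib)
    finally show ?thesis using 2 8 by linarith
  qed
  moreover have "holomorphic_several (mixed_peak l m b w) polydisk"
    unfolding eq by (rule holomorphic_several_mult(1) [OF lin(1) peak1])
  moreover have "cmod (mixed_peak l m b w 0) \<le> 1"
    using A b by (simp add: eq norm_mult mult_le_one less_imp_le)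
  ultimately show "bloch_norm p (zero_ext (mixed_peak l m b w)) \<le> 11"
    using bloch_zero_extI(2) by fastforce
qed

subsection \<open>Approach to the boundary of the polydisk\<close>

text \<open>\<open>infdist\<close> to the empty set is 0 by convention, so unfolding it as an
  infimum needs this.\<close>

lemma frontier_polydisk_nonempty: "frontier (polydisk :: (complex ^ 'n) set) \<noteq> {}"
proof (rule frontier_not_empty)
  have "(\<chi> j. 1) \<notin> (polydisk :: (complex ^ 'n) set)" by (simp add: polydisk_def)
  then show "(polydisk :: (complex ^ 'n) set) \<noteq> UNIV" by blast
qed (use zero_in_polydisk in blast)

text \<open>A frontier point lies outside the open polydisk, so one of its coordinates has modulus
  at least 1; already that coordinate is 1 - R away.\<close>

lemma infdist_frontier_polydisk_ge:
  fixes w :: "complex ^ 'n"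
  assumes "w \<in> closed_polydisk R"
  shows "1 - R \<le> infdist w (frontier polydisk)"
  unfolding infdist_notempty [OF frontier_polydisk_nonempty]
proof (rule cINF_greatest [OF frontier_polydisk_nonempty])
  fix y :: "complex ^ 'n" assume "y \<in> frontier polydisk"
  then have "y \<notin> polydisk" by (simp add: frontier_def interior_open [OF open_polydisk])
  then obtain k where "1 \<le> cmod (y $ k)" by (auto simp: polydisk_def not_less)
  moreover have "cmod (w $ k) \<le> R" using assms by (simp add: closed_polydisk_def)
  moreover have "cmod (y $ k) \<le> cmod (w $ k) + cmod (y $ k - w $ k)" by (rule norm_triangle_sub)
  moreover have "cmod (y $ k - w $ k) \<le> dist w y"
    using Finite_Cartesian_Product.norm_nth_le [of "y - w" k] by (simp add: dist_norm norm_minus_commute)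
  ultimately show "1 - R \<le> dist w y" by linarith
qed

text \<open>Pushing the l-th coordinate radially out to the unit circle leaves the polydisk after a
  path of length 1 - |w_l|.\<close>

lemma infdist_frontier_polydisk_le:
  fixes w :: "complex ^ 'n"
  assumes w: "w \<in> polydisk"
  shows "infdist w (frontier polydisk) \<le> 1 - cmod (w $ l)"
proof -
  \<comment> \<open>The radial direction; the value 1 is an arbitrary choice of direction when the
    coordinate is 0.\<close>
  define u where "u = (if w $ l = 0 then 1 else sgn (w $ l))"
  define y where "y = w + axis l (u - w $ l)"
  have norm_u: "cmod u = 1" by (simp add: u_def norm_sgn)
  have "u - w $ l = of_real (1 - cmod (w $ l)) * u"
    by (auto simp: u_def sgn_eq algebra_simps)
  then have "cmod (u - w $ l) = \<bar>1 - cmod (w $ l)\<bar>"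
    by (metis norm_mult norm_of_real norm_u mult.right_neutral)
  also have "\<dots> = 1 - cmod (w $ l)" using w by (simp add: polydisk_def less_imp_le)
  finally have 1: "cmod (u - w $ l) = 1 - cmod (w $ l)" .
  have "norm (axis l (u - w $ l)) = cmod (u - w $ l)"
    by (simp add: norm_vec_def L2_set_def axis_def if_distrib [of cmod] if_distrib [of "\<lambda>x. x\<^sup>2"] cong: if_cong)
  with 1 have dist: "dist w y = 1 - cmod (w $ l)" by (simp add: y_def dist_norm)
  have "y $ l = u" by (simp add: y_def axis_def)
  then have "y \<notin> polydisk" using norm_u by (auto simp: polydisk_def intro!: exI [of _ l])
  \<comment> \<open>The segment joins a point inside to a point outside, so by connectedness it
    meets the frontier, at distance at most \<open>dist w y\<close> from w.\<close>
  then have "closed_segment w y \<inter> frontier polydisk \<noteq> {}"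
    using w by (intro connected_Int_frontier connected_segment) auto
  then obtain x where x: "x \<in> closed_segment w y" "x \<in> frontier polydisk" by blast
  have "infdist w (frontier polydisk) \<le> dist w x" using x(2) by (rule infdist_le)
  also have "\<dots> \<le> dist w y" using dist_in_closed_segment [OF x(1)] by (simp add: dist_commute)
  finally show ?thesis using dist by simp
qed

text \<open>The distance of a point w of the polydisk to the frontier is 1 - max |w_l|, by the two
  preceding bounds. So nearness to the boundary means leaving a compact polydisk, the form that
  suits locally uniform convergence.\<close>

lemma vanishes_as_image_to_boundary_iff:
  assumes \<phi>: "holomorphic_self_map \<phi>"
  shows "vanishes_as_image_to_boundary \<phi> S \<longleftrightarrow>
    (\<forall>e>0. \<exists>R. 0 \<le> R \<and> R < 1 \<and> (\<forall>z\<in>polydisk. \<phi> z \<notin> closed_polydisk R \<longrightarrow> \<bar>S z\<bar> < e))"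
  unfolding vanishes_as_image_to_boundary_def
proof (intro iffI allI impI)
  fix e :: real
  assume "\<forall>e>0. \<exists>d>0. \<forall>z\<in>polydisk. infdist (\<phi> z) (frontier polydisk) < d \<longrightarrow> \<bar>S z\<bar> < e" "0 < e"
  then obtain d where d: "0 < d" "\<And>z. z \<in> polydisk \<Longrightarrow> infdist (\<phi> z) (frontier polydisk) < d \<Longrightarrow> \<bar>S z\<bar> < e"
    by blast
  show "\<exists>R. 0 \<le> R \<and> R < 1 \<and> (\<forall>z\<in>polydisk. \<phi> z \<notin> closed_polydisk R \<longrightarrow> \<bar>S z\<bar> < e)"
  proof (intro exI [of _ "max 0 (1 - d)"] conjI ballI impI)
    fix z assume z: "z \<in> polydisk" and "\<phi> z \<notin> closed_polydisk (max 0 (1 - d))"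
    then obtain l where "1 - d < cmod (\<phi> z $ l)" by (auto simp: closed_polydisk_def not_le)
    then show "\<bar>S z\<bar> < e"
      using infdist_frontier_polydisk_le [OF self_map_in_polydisk [OF \<phi> z], of l] by (intro d z) linarith
  qed (use d in auto)
next
  fix e :: real
  assume "\<forall>e>0. \<exists>R. 0 \<le> R \<and> R < 1 \<and> (\<forall>z\<in>polydisk. \<phi> z \<notin> closed_polydisk R \<longrightarrow> \<bar>S z\<bar> < e)" "0 < e"
  then obtain R where R: "R < 1" "\<And>z. z \<in> polydisk \<Longrightarrow> \<phi> z \<notin> closed_polydisk R \<Longrightarrow> \<bar>S z\<bar> < e"
    by blast
  show "\<exists>d>0. \<forall>z\<in>polydisk. infdist (\<phi> z) (frontier polydisk) < d \<longrightarrow> \<bar>S z\<bar> < e"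
  proof (intro exI [of _ "1 - R"] conjI ballI impI)
    fix z assume "z \<in> polydisk" "infdist (\<phi> z) (frontier polydisk) < 1 - R"
    then show "\<bar>S z\<bar> < e"
      using infdist_frontier_polydisk_ge [of "\<phi> z" R] by (intro R) auto
  qed (use R in auto)
qed

subsection \<open>Composition operators\<close>

definition composition_weight ::
  "real \<Rightarrow> real \<Rightarrow> (complex ^ 'n \<Rightarrow> complex ^ 'n) \<Rightarrow> 'n \<Rightarrow> 'n \<Rightarrow> complex ^ 'n \<Rightarrow> real" where
  "composition_weight p q \<phi> k l z = cmod (partial_deriv k (\<lambda>w. \<phi> w $ l) z) *
     ((1 - (cmod (z $ k))\<^sup>2) powr q / (1 - (cmod (\<phi> z $ l))\<^sup>2) powr p)"

lemma composition_weight_nonneg: "0 \<le> composition_weight p q \<phi> k l z"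
  by (simp add: composition_weight_def)

text \<open>\<open>b\<close> bounds the weighted derivatives at the single point \<phi> z, not a
  norm. This allows two uses: with the Bloch norm of \<open>f\<close> at any point, and with a small
  number where the derivatives of a convergent sequence are already small.\<close>

lemma bloch_weight_compose_le:
  fixes \<phi> :: "complex ^ 'n \<Rightarrow> complex ^ 'n"
  assumes \<phi>: "holomorphic_self_map \<phi>" and f: "holomorphic_several f polydisk" and z: "z \<in> polydisk"
    and b: "\<And>l. cmod (partial_deriv l f (\<phi> z)) * (1 - (cmod (\<phi> z $ l))\<^sup>2) powr p \<le> b"
  shows "bloch_weight q (f \<circ> \<phi>) z \<le> b * (\<Sum>k\<in>UNIV. \<Sum>l\<in>UNIV. composition_weight p q \<phi> k l z)"
  unfolding bloch_weight_def sum_distrib_left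
proof (rule sum_mono)
  fix k :: 'n
  define Z where "Z = (1 - (cmod (z $ k))\<^sup>2) powr q"
  have "cmod (partial_deriv k (f \<circ> \<phi>) z) * Z
      \<le> (\<Sum>l\<in>UNIV. cmod (partial_deriv k (\<lambda>w. \<phi> w $ l) z) * cmod (partial_deriv l f (\<phi> z))) * Z"
    unfolding holomorphic_several_compose(2) [OF \<phi> f z] norm_mult [symmetric]
    by (intro mult_right_mono norm_sum) (simp add: Z_def)
  also have "\<dots> = (\<Sum>l\<in>UNIV. (cmod (partial_deriv l f (\<phi> z)) * (1 - (cmod (\<phi> z $ l))\<^sup>2) powr p) *
      composition_weight p q \<phi> k l z)"
    unfolding sum_distrib_right
  proof (intro sum.cong refl)
    fix l :: 'n
    have "(1 - (cmod (\<phi> z $ l))\<^sup>2) powr p \<noteq> 0"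
      using one_minus_square_pos [OF self_map_in_polydisk [OF \<phi> z], of l] by simp
    then show "cmod (partial_deriv k (\<lambda>w. \<phi> w $ l) z) * cmod (partial_deriv l f (\<phi> z)) * Z
        = (cmod (partial_deriv l f (\<phi> z)) * (1 - (cmod (\<phi> z $ l))\<^sup>2) powr p) * composition_weight p q \<phi> k l z"
      by (simp add: composition_weight_def Z_def)
  qed
  also have "\<dots> \<le> (\<Sum>l\<in>UNIV. b * composition_weight p q \<phi> k l z)"
    by (intro sum_mono mult_right_mono b composition_weight_nonneg)
  finally show "cmod (partial_deriv k (f \<circ> \<phi>) z) * (1 - (cmod (z $ k))\<^sup>2) powr q
      \<le> (\<Sum>l\<in>UNIV. b * composition_weight p q \<phi> k l z)" unfolding Z_def .
qed

lemma composition_operator_zero_ext: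
  assumes "holomorphic_self_map \<phi>"
  shows "composition_operator \<phi> (zero_ext f) = zero_ext (f \<circ> \<phi>)"
  using self_map_in_polydisk [OF assms] by (auto simp: composition_operator_def zero_ext_def)

lemma composition_operator_diff:
  "composition_operator \<phi> (\<lambda>z. f z - g z) = (\<lambda>z. composition_operator \<phi> f z - composition_operator \<phi> g z)"
  by (auto simp: composition_operator_def zero_ext_def)

lemma little_bloch_metric: "Metric_space (little_bloch q) (bloch_dist q)"
  by (rule Metric_space.subspace [OF Metric_space_bloch little_bloch_subset])

lemma topspace_little_bloch: "topspace (little_bloch_topology q) = little_bloch q"
  by (simp add: little_bloch_topology_def Metric_space.topspace_mtopology [OF little_bloch_metric])

text \<open>Sequences are taken from \<open>S\<close> alone, not from its closure, so each term is
  the image of an actual function in the unit ball; only the limit may lie elsewhere in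
  \<open>M\<close>.\<close>

lemma (in Metric_space) compactin_closure_of_sequentially:
  assumes "S \<subseteq> M"
    and "\<And>\<sigma> :: nat \<Rightarrow> 'a. range \<sigma> \<subseteq> S \<Longrightarrow>
      \<exists>l r. l \<in> M \<and> strict_mono r \<and> limitin mtopology (\<sigma> \<circ> r) l sequentially"
  shows "compactin mtopology (mtopology closure_of S)"
  using assms Bolzano_Weierstrass_property [of S M]
  unfolding compact_closure_of_eq_Bolzano_Weierstrass by blast

lemma composition_operator_compactI:
  fixes \<phi> :: "complex ^ 'n \<Rightarrow> complex ^ 'n"
  assumes \<phi>: "holomorphic_self_map \<phi>" and p: "0 < p" and q: "0 < q"
    and mono: "\<And>\<gamma>. zero_ext (\<lambda>z. monomial \<gamma> (\<phi> z)) \<in> little_bloch q"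
    and van: "vanishes_as_image_to_boundary \<phi> (\<lambda>z. \<Sum>k\<in>UNIV. \<Sum>l\<in>UNIV. composition_weight p q \<phi> k l z)"
  shows "compact_operator (little_bloch p) (bloch_norm p) (little_bloch_topology q) (composition_operator \<phi>)"
proof -
  define S where "S z = (\<Sum>k\<in>UNIV. \<Sum>l\<in>UNIV. composition_weight p q \<phi> k l z)" for z
  have S0: "0 \<le> S z" for z unfolding S_def by (intro sum_nonneg composition_weight_nonneg)
  have p0: "0 \<le> p" and q0: "0 \<le> q" using p q by simp_all
  have \<phi>p: "\<phi> z \<in> polydisk" if "z \<in> polydisk" for z using self_map_in_polydisk [OF \<phi> that] .
  have "\<forall>e>0. \<exists>R. 0 \<le> R \<and> R < 1 \<and> (\<forall>z\<in>polydisk. \<phi> z \<notin> closed_polydisk R \<longrightarrow> \<bar>S z\<bar> < e)"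
    using van unfolding S_def vanishes_as_image_to_boundary_iff [OF \<phi>] .
  then have small: "\<exists>R. 0 \<le> R \<and> R < 1 \<and> (\<forall>z\<in>polydisk. \<phi> z \<notin> closed_polydisk R \<longrightarrow> S z < e)" if "0 < e" for e
    using S0 that by simp
  \<comment> \<open>The exponent with a single 1 turns the monomial hypothesis into \<phi>_l being a
    Bloch function, which bounds the numerators of the composition weights.\<close>
  have coord: "zero_ext (\<lambda>z. \<phi> z $ l) \<in> bloch q" for l
  proof -
    have "(x $ i) ^ (if i = l then 1 else 0) = (if i = l then x $ l else 1)" for x :: "complex ^ 'n" and i
      by simp
    then have "monomial (\<lambda>i. if i = l then 1 else 0) x = x $ l" for x :: "complex ^ 'n"
      unfolding monomial_def by (simp only: prod.delta finite UNIV_I if_True)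
    then show ?thesis
      using mono [of "\<lambda>i. if i = l then 1 else 0"] little_bloch_subset by auto
  qed
  have hol\<phi>: "holomorphic_several (\<lambda>z. \<phi> z $ l) polydisk" for l
    using \<phi> by (simp add: holomorphic_self_map_def)
  \<comment> \<open>The limit condition bounds \<open>S\<close> by 1 near the boundary. Elsewhere
    the denominators are at least \<open>c\<close> and the numerators at most the Bloch norms of the
    coordinates of \<phi>.\<close>
  obtain M where M: "0 < M" "\<And>z. z \<in> polydisk \<Longrightarrow> S z \<le> M"
  proof -
    obtain R where R: "0 \<le> R" "R < 1" "\<And>z. z \<in> polydisk \<Longrightarrow> \<phi> z \<notin> closed_polydisk R \<Longrightarrow> S z < 1"
      using small [of 1] by auto
    define N where "N = (\<Sum>l\<in>UNIV. bloch_norm q (zero_ext (\<lambda>z. \<phi> z $ l)))"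
    define c where "c = (1 - R\<^sup>2) powr p"
    have R2: "0 < 1 - R\<^sup>2" using R by (simp add: abs_square_less_1)
    then have c: "0 < c" by (simp add: c_def)
    define B where "B = (\<Sum>k\<in>(UNIV :: 'n set). \<Sum>l\<in>(UNIV :: 'n set). N / c)"
    have N0: "bloch_norm q (zero_ext (\<lambda>z. \<phi> z $ l)) \<le> N" "0 \<le> N" for l
      unfolding N_def using bloch_norm_nonneg [OF coord] by (auto intro!: member_le_sum sum_nonneg)
    have "S z \<le> B" if z: "z \<in> polydisk" and in_R: "\<phi> z \<in> closed_polydisk R" for z
      unfolding S_def B_def
    proof (intro sum_mono)
      fix k l :: 'n
      have "cmod (partial_deriv k (\<lambda>w. \<phi> w $ l) z) * (1 - (cmod (z $ k))\<^sup>2) powr q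
          \<le> bloch_weight q (\<lambda>z. \<phi> z $ l) z" by (rule weighted_partial_deriv_le)
      also have "\<dots> = bloch_weight q (zero_ext (\<lambda>z. \<phi> z $ l)) z"
        by (rule bloch_weight_zero_ext [OF hol\<phi> z, symmetric])
      also have "\<dots> \<le> N"
        using order_trans [OF bloch_weight_le_norm [OF coord z] N0(1)] .
      finally have 1: "cmod (partial_deriv k (\<lambda>w. \<phi> w $ l) z) * (1 - (cmod (z $ k))\<^sup>2) powr q \<le> N" .
      have "(cmod (\<phi> z $ l))\<^sup>2 \<le> R\<^sup>2"
        using in_R by (intro power_mono) (auto simp: closed_polydisk_def)
      then have 2: "c \<le> (1 - (cmod (\<phi> z $ l))\<^sup>2) powr p"
        unfolding c_def using R2 p by (intro powr_mono2) auto
      show "composition_weight p q \<phi> k l z \<le> N / c"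
        unfolding composition_weight_def times_divide_eq_right
        using 1 2 c N0(2) by (intro frac_le) auto
    qed
    moreover have "0 \<le> B" unfolding B_def using N0(2) c by (intro sum_nonneg divide_nonneg_pos) auto
    ultimately have "S z \<le> B + 1" if "z \<in> polydisk" for z
      using R(3) [OF that] that by (cases "\<phi> z \<in> closed_polydisk R") fastforce+
    with \<open>0 \<le> B\<close> show thesis by (intro that [of "B + 1"]) auto
  qed
  \<comment> \<open>\<phi> need not fix the origin: the value of f \<circ> \<phi> at 0 is
    f(\<phi>(0)), to be controlled by the growth estimate.\<close>
  obtain R0 where R0: "0 \<le> R0" "R0 < 1" "\<phi> 0 \<in> closed_polydisk R0"
    by (rule polydisk_exhaustion [OF \<phi>p [OF zero_in_polydisk]])
  obtain C where C: "0 < C" "\<And>(f :: complex ^ 'n \<Rightarrow> complex) z. f \<in> bloch p \<Longrightarrow>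
      z \<in> closed_polydisk R0 \<Longrightarrow> cmod (f z) \<le> C * bloch_norm p f"
    using bloch_growth [OF R0(1,2) p0, where 'n = 'n] by blast
  have weight_le: "bloch_weight q (f \<circ> \<phi>) z \<le> bloch_norm p f * S z" if f: "f \<in> bloch p" and z: "z \<in> polydisk" for f z
    unfolding S_def
  proof (rule bloch_weight_compose_le [OF \<phi> _ z])
    show "holomorphic_several f polydisk" using f by (simp add: bloch_def)
    show "cmod (partial_deriv l f (\<phi> z)) * (1 - (cmod (\<phi> z $ l))\<^sup>2) powr p \<le> bloch_norm p f" for l
      by (rule order_trans [OF weighted_partial_deriv_le bloch_weight_le_norm [OF f \<phi>p [OF z]]])
  qed
  have hol: "holomorphic_several (f \<circ> \<phi>) polydisk" if "f \<in> bloch p" for f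
    using that by (intro holomorphic_several_compose(1) [OF \<phi>]) (simp add: bloch_def)
  have bounded: "composition_operator \<phi> f \<in> bloch q"
    "bloch_norm q (composition_operator \<phi> f) \<le> (C + M) * bloch_norm p f" if f: "f \<in> bloch p" for f
  proof -
    have "bloch_weight q (f \<circ> \<phi>) z \<le> M * bloch_norm p f" if "z \<in> polydisk" for z
      using order_trans [OF weight_le [OF f that] mult_left_mono [OF M(2) [OF that] bloch_norm_nonneg [OF f]]]
      by (simp add: mult.commute)
    note * = bloch_zero_extI [OF hol [OF f] this]
    show "composition_operator \<phi> f \<in> bloch q" unfolding composition_operator_def by (rule *(1))
    show "bloch_norm q (composition_operator \<phi> f) \<le> (C + M) * bloch_norm p f"
      unfolding composition_operator_def using *(2) C(2) [OF f R0(3)] by (simp add: distrib_right)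
  qed
  have poly: "composition_operator \<phi> P \<in> little_bloch q" if "P \<in> polynomial_functions" for P
  proof -
    obtain A c where P: "P = zero_ext (\<lambda>z. \<Sum>\<gamma>\<in>A. c \<gamma> * monomial \<gamma> z)"
      using \<open>P \<in> polynomial_functions\<close> unfolding polynomial_functions_def by blast
    have "composition_operator \<phi> P = (\<lambda>z. \<Sum>\<gamma>\<in>A. c \<gamma> * zero_ext (\<lambda>z. monomial \<gamma> (\<phi> z)) z)"
      unfolding P composition_operator_zero_ext [OF \<phi>] by (auto simp: zero_ext_def)
    then show ?thesis using little_bloch_sum [OF q0 mono] by simp
  qed
  have maps: "composition_operator \<phi> f \<in> little_bloch q" if f: "f \<in> little_bloch p" for f
  proof (rule little_bloch_closed [OF q0])
    have fb: "f \<in> bloch p" using f little_bloch_subset by blast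
    then show "composition_operator \<phi> f \<in> bloch q" by (rule bounded)
    fix e :: real assume "0 < e"
    then have "0 < e / (C + M)" using C(1) M(1) by simp
    then obtain P where P: "P \<in> polynomial_functions" "bloch_norm p (\<lambda>z. f z - P z) < e / (C + M)"
      using f unfolding little_bloch_iff [OF p0] by blast
    have "P \<in> bloch p" using P(1) polynomial_functions_in_bloch [OF p0] by blast
    from bounded(2) [OF bloch_diff [OF fb this]]
    have "bloch_norm q (\<lambda>z. composition_operator \<phi> f z - composition_operator \<phi> P z)
        \<le> (C + M) * bloch_norm p (\<lambda>z. f z - P z)" unfolding composition_operator_diff .
    also have "\<dots> < e" using P(2) C(1) M(1) by (simp add: pos_less_divide_eq mult.commute)
    finally show "\<exists>g\<in>little_bloch q. bloch_norm q (\<lambda>z. composition_operator \<phi> f z - g z) < e"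
      using poly [OF P(1)] by blast
  qed
  have subseq: "\<exists>g r. g \<in> little_bloch q \<and> strict_mono (r :: nat \<Rightarrow> nat) \<and>
      (\<forall>e>0. \<forall>\<^sub>F n in sequentially. bloch_norm q (\<lambda>z. composition_operator \<phi> (f (r n)) z - g z) < e)"
    if f: "\<And>n. f n \<in> little_bloch p" "\<And>n. bloch_norm p (f n) \<le> 1" for f :: "nat \<Rightarrow> complex ^ 'n \<Rightarrow> complex"
  proof -
    have fb: "f n \<in> bloch p" for n using f(1) little_bloch_subset by blast
    obtain g r where r: "strict_mono (r :: nat \<Rightarrow> nat)" and g: "g \<in> bloch p" "bloch_norm p g \<le> 2 * 1"
      and lim: "\<And>z. (\<lambda>n. f (r n) z) \<longlonglongrightarrow> g z"
      and der: "\<And>R j. 0 \<le> R \<Longrightarrow> R < 1 \<Longrightarrow>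
        uniform_limit (closed_polydisk R) (\<lambda>n. partial_deriv j (f (r n))) (partial_deriv j g) sequentially"
      by (rule bloch_normal_family [where f = f and N = 1 and p = p, OF p0 fb f(2)]) blast
    define h where "h n = (\<lambda>z. f (r n) z - g z)" for n
    have h: "h n \<in> bloch p" for n unfolding h_def by (rule bloch_diff [OF fb g(1)])
    have h3: "bloch_norm p (h n) \<le> 3" for n
      using bloch_linear(2) [OF fb [of "r n"] g(1), where a = 1 and b = "-1"] g(2) f(2) [of "r n"] by (simp add: h_def)
    have conv: "\<forall>\<^sub>F n in sequentially. bloch_norm q (composition_operator \<phi> (h n)) < e" if e: "0 < e" for e
    proof -
      \<comment> \<open>\<open>h n\<close> has norm at most 3 = 1 + 2, so near the boundary the
        weight is at most 3 e / 12 = e / 4. Inside, derivatives below e / (4 M) meet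
        \<open>S\<close> \<le> M and give e / 4 again. With e / 4 for the value at 0 the total is
        below e.\<close>
      obtain R where R: "0 \<le> R" "R < 1" "\<And>z. z \<in> polydisk \<Longrightarrow> \<phi> z \<notin> closed_polydisk R \<Longrightarrow> S z < e / 12"
        using small [of "e / 12"] e by auto
      have "(\<lambda>n. h n (\<phi> 0)) \<longlonglongrightarrow> 0"
        unfolding h_def using tendsto_diff [OF lim [of "\<phi> 0"] tendsto_const [of "g (\<phi> 0)"]] by simp
      from tendstoD [OF this, of "e / 4"] have "\<forall>\<^sub>F n in sequentially. cmod (h n (\<phi> 0)) < e / 4"
        using e by (simp add: dist_norm)
      moreover have "\<forall>\<^sub>F n in sequentially. \<forall>l. \<forall>w\<in>closed_polydisk R. 
          dist (partial_deriv l (f (r n)) w) (partial_deriv l g w) < e / (4 * M)"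
        using der [OF R(1,2)] e M(1) by (intro eventually_all_finite) (simp add: uniform_limit_iff)
      ultimately show ?thesis
      proof eventually_elim
        case (elim n)
        have lin: "partial_deriv l (h n) w = partial_deriv l (f (r n)) w - partial_deriv l g w"
          if "w \<in> polydisk" for l w
          using holomorphic_several_linear(2) [of "f (r n)" polydisk g w l 1 "-1"] fb [of "r n"] g(1) that
          by (simp add: h_def bloch_def)
        have "bloch_weight q (h n \<circ> \<phi>) z \<le> e / 4" if z: "z \<in> polydisk" for z
        proof (cases "\<phi> z \<in> closed_polydisk R")
          case True
          have "bloch_weight q (h n \<circ> \<phi>) z \<le> e / (4 * M) * S z"
            unfolding S_def
          proof (rule bloch_weight_compose_le [OF \<phi> _ z])
            show "holomorphic_several (h n) polydisk" using h by (simp add: bloch_def)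
            fix l
            have "(1 - (cmod (\<phi> z $ l))\<^sup>2) powr p \<le> 1"
              using one_minus_square_pos [OF \<phi>p [OF z], of l] p by (intro powr_le1) auto
            moreover have "cmod (partial_deriv l (h n) (\<phi> z)) \<le> e / (4 * M)"
              using elim(2) True by (simp add: lin [OF \<phi>p [OF z]] dist_norm less_imp_le)
            ultimately have "cmod (partial_deriv l (h n) (\<phi> z)) * (1 - (cmod (\<phi> z $ l))\<^sup>2) powr p \<le> e / (4 * M) * 1"
              using e M(1) by (intro mult_mono) auto
            then show "cmod (partial_deriv l (h n) (\<phi> z)) * (1 - (cmod (\<phi> z $ l))\<^sup>2) powr p \<le> e / (4 * M)" by simp
          qed
          also have "\<dots> \<le> e / (4 * M) * M" using e M z by (intro mult_left_mono) auto
          also have "\<dots> = e / 4" using M(1) by simp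
          finally show ?thesis .
        next
          case False
          have "bloch_weight q (h n \<circ> \<phi>) z \<le> bloch_norm p (h n) * S z" by (rule weight_le [OF h z])
          also have "\<dots> \<le> 3 * (e / 12)"
            using R(3) [OF z False] h3 S0 by (intro mult_mono) auto
          finally show ?thesis by simp
        qed
        from bloch_zero_extI(2) [OF hol [OF h] this]
        have "bloch_norm q (composition_operator \<phi> (h n)) \<le> cmod (h n (\<phi> 0)) + e / 4"
          by (simp add: composition_operator_def)
        then show ?case using elim(1) e by simp
      qed
    qed
    have conv': "\<forall>\<^sub>F n in sequentially. bloch_norm q (\<lambda>z. composition_operator \<phi> (f (r n)) z - composition_operator \<phi> g z) < e"
      if "0 < e" for e
      using conv [OF that] by (simp add: h_def composition_operator_diff)
    \<comment> \<open>\<open>g\<close> is only a Bloch function, so \<open>maps\<close> does not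
      apply to it; the image is approximated in norm by the images of the \<open>f (r n)\<close>,
      which are in the little Bloch space.\<close>
    have "composition_operator \<phi> g \<in> little_bloch q"
    proof (rule little_bloch_closed [OF q0 bounded(1) [OF g(1)]])
      fix e :: real assume "0 < e"
      from conv' [OF this] obtain n where
        "bloch_norm q (\<lambda>z. composition_operator \<phi> (f (r n)) z - composition_operator \<phi> g z) < e"
        by (auto simp: eventually_sequentially)
      moreover have D: "(\<lambda>z. composition_operator \<phi> (f (r n)) z - composition_operator \<phi> g z) \<in> bloch q"
        by (intro bloch_diff bounded fb g)
      moreover have "bloch_norm q (\<lambda>z. composition_operator \<phi> g z - composition_operator \<phi> (f (r n)) z)
          \<le> bloch_norm q (\<lambda>z. composition_operator \<phi> (f (r n)) z - composition_operator \<phi> g z)"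
        using bloch_linear(2) [OF D D, where a = "-1" and b = 0] by simp
      ultimately have "bloch_norm q (\<lambda>z. composition_operator \<phi> g z - composition_operator \<phi> (f (r n)) z) < e"
        by linarith
      then show "\<exists>g'\<in>little_bloch q. bloch_norm q (\<lambda>z. composition_operator \<phi> g z - g' z) < e"
        using maps [OF f(1)] by blast
    qed
    with r conv' show ?thesis
      by (intro exI [of _ "composition_operator \<phi> g"] exI [of _ r]) simp
  qed
  interpret L: Metric_space "little_bloch q" "bloch_dist q" by (rule little_bloch_metric)
  have "compactin L.mtopology (L.mtopology closure_of
      (composition_operator \<phi> ` {f \<in> little_bloch p. bloch_norm p f \<le> 1}))"
  proof (rule L.compactin_closure_of_sequentially)
    show "composition_operator \<phi> ` {f \<in> little_bloch p. bloch_norm p f \<le> 1} \<subseteq> little_bloch q"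
      using maps by blast
    fix \<sigma> :: "nat \<Rightarrow> complex ^ 'n \<Rightarrow> complex"
    assume \<sigma>: "range \<sigma> \<subseteq> composition_operator \<phi> ` {f \<in> little_bloch p. bloch_norm p f \<le> 1}"
    then have "\<forall>n. \<exists>f. f \<in> little_bloch p \<and> bloch_norm p f \<le> 1 \<and> \<sigma> n = composition_operator \<phi> f" by blast
    then obtain f where f: "\<And>n. f n \<in> little_bloch p" "\<And>n. bloch_norm p (f n) \<le> 1"
      and \<sigma>f: "\<And>n. \<sigma> n = composition_operator \<phi> (f n)" by metis
    from subseq [where f = f, OF f] obtain g and r :: "nat \<Rightarrow> nat"
      where gr: "g \<in> little_bloch q \<and> strict_mono r \<and> (\<forall>e>0. \<forall>\<^sub>F n in sequentially.
        bloch_norm q (\<lambda>z. composition_operator \<phi> (f (r n)) z - g z) < e)" by (elim exE)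
    then have g: "g \<in> little_bloch q" and r: "strict_mono r" by simp_all
    have lim: "\<forall>\<^sub>F n in sequentially. bloch_norm q (\<lambda>z. composition_operator \<phi> (f (r n)) z - g z) < e"
      if "0 < e" for e using gr that by simp
    have gb: "g \<in> bloch q" using g little_bloch_subset by blast
    have "limitin L.mtopology (\<sigma> \<circ> r) g sequentially"
      unfolding L.limitin_metric
    proof (intro conjI g allI impI)
      fix e :: real assume "0 < e"
      from lim [OF this]
      show "\<forall>\<^sub>F n in sequentially. (\<sigma> \<circ> r) n \<in> little_bloch q \<and> bloch_dist q ((\<sigma> \<circ> r) n) g < e"
      proof eventually_elim
        case (elim n)
        have "composition_operator \<phi> (f (r n)) \<in> little_bloch q" by (rule maps [OF f(1)])
        moreover from this have "composition_operator \<phi> (f (r n)) \<in> bloch q" using little_bloch_subset by blast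
        ultimately show ?case using elim gb by (simp add: \<sigma>f bloch_dist_def)
      qed
    qed
    with g r show "\<exists>l r. l \<in> little_bloch q \<and> strict_mono r \<and> limitin L.mtopology (\<sigma> \<circ> r) l sequentially"
      by blast
  qed
  moreover have "linear_between (little_bloch p) (little_bloch q) (composition_operator \<phi>)"
    using maps by (auto simp: linear_between_def composition_operator_def zero_ext_def)
  ultimately show ?thesis
    by (simp add: compact_operator_def topspace_little_bloch) (simp add: little_bloch_topology_def)
qed

subsection \<open>Necessity\<close>

text \<open>Otherwise infinitely many images keep norm at least e. Compactness gives a
  norm-convergent subsequence of the rescaled images; its limit is also the pointwise limit, hence
  0, a contradiction.\<close>

lemma compact_operator_norm_tendsto_0:
  fixes f :: "nat \<Rightarrow> complex ^ 'n \<Rightarrow> complex"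
  assumes \<phi>: "holomorphic_self_map \<phi>" and p: "0 \<le> p" and q: "0 \<le> q"
    and comp: "compact_operator (little_bloch p) (bloch_norm p) (little_bloch_topology q) (composition_operator \<phi>)"
    and f: "\<And>n. f n \<in> little_bloch p" "\<And>n. bloch_norm p (f n) \<le> C"
    and lim: "\<And>z. z \<in> polydisk \<Longrightarrow> (\<lambda>n. f n z) \<longlonglongrightarrow> 0"
  shows "(\<lambda>n. bloch_norm q (composition_operator \<phi> (f n))) \<longlonglongrightarrow> 0"
proof (rule ccontr)
  interpret L: Metric_space "little_bloch q" "bloch_dist q" by (rule little_bloch_metric)
  let ?T = "composition_operator \<phi>"
  \<comment> \<open>A positive bound, whatever the sign of \<open>C\<close>, so that dividing by it
    moves the sequence into the unit ball.\<close>
  define B where "B = \<bar>C\<bar> + 1"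
  have B: "0 < B" "\<And>n. bloch_norm p (f n) \<le> B"
    using order_trans [OF f(2) abs_ge_self] by (auto simp: B_def intro: add_increasing2)
  have maps: "?T h \<in> little_bloch q" if "h \<in> little_bloch p" for h
    using comp that by (auto simp: compact_operator_def linear_between_def topspace_little_bloch)
  have mapsb: "?T h \<in> bloch q" if "h \<in> little_bloch p" for h
    using maps [OF that] little_bloch_subset by blast
  define u where "u n = (\<lambda>z. of_real (1 / B) * f n z)" for n
  have fb: "f n \<in> bloch p" for n using f(1) little_bloch_subset by blast
  have u: "u n \<in> little_bloch p" for n
    using little_bloch_linear [OF p f(1) [of n] f(1) [of n], where a = "of_real (1 / B)" and b = 0] by (simp add: u_def)
  have u1: "bloch_norm p (u n) \<le> 1" for n
  proof -
    have "bloch_norm p (u n) \<le> 1 / B * bloch_norm p (f n)"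
      using bloch_linear(2) [OF fb [of n] fb [of n], where a = "of_real (1 / B)" and b = 0] B(1)
      by (simp add: u_def norm_divide)
    also have "\<dots> \<le> 1" using B by simp
    finally show ?thesis .
  qed
  have Tf: "bloch_norm q (?T (f n)) \<le> B * bloch_norm q (?T (u n))" for n
  proof -
    have "?T (f n) = (\<lambda>z. of_real B * ?T (u n) z + 0 * ?T (u n) z)"
      using B(1) by (auto simp: u_def composition_operator_def zero_ext_def)
    then show ?thesis
      using bloch_linear(2) [OF mapsb [OF u [of n]] mapsb [OF u [of n]], where a = "of_real B" and b = 0] B(1) by simp
  qed
  assume "\<not> (\<lambda>n. bloch_norm q (?T (f n))) \<longlonglongrightarrow> 0"
  \<comment> \<open>On the naturals \<open>sequentially\<close> is the cofinite filter, so failure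
    of convergence gives infinitely many exceptional indices at once.\<close>
  then obtain e where e: "0 < e" and inf: "infinite {n. e \<le> bloch_norm q (?T (f n))}"
    unfolding tendsto_iff cofinite_eq_sequentially [symmetric] eventually_cofinite
    by (auto simp: dist_norm not_less bloch_norm_nonneg [OF mapsb [OF f(1)]])
  obtain s :: "nat \<Rightarrow> nat" where s: "strict_mono s" "\<And>n. e \<le> bloch_norm q (?T (f (s n)))"
    using infinite_enumerate [OF inf] by auto
  let ?I = "?T ` {f \<in> little_bloch p. bloch_norm p f \<le> 1}"
  have "compactin L.mtopology (L.mtopology closure_of ?I)"
    using comp by (simp add: compact_operator_def little_bloch_topology_def)
  moreover have "range (\<lambda>n. ?T (u (s n))) \<subseteq> L.mtopology closure_of ?I"
  proof -
    have "?I \<subseteq> L.mtopology closure_of ?I" using maps by (intro closure_of_subset) auto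
    then show ?thesis using u u1 by blast
  qed
  ultimately obtain g r where "strict_mono (r :: nat \<Rightarrow> nat)"
      "limitin L.mtopology ((\<lambda>n. ?T (u (s n))) \<circ> r) g sequentially"
    unfolding L.compactin_sequentially by meson
  then have r: "strict_mono r" and g: "g \<in> little_bloch q"
    and dist: "\<And>d. 0 < d \<Longrightarrow> \<forall>\<^sub>F n in sequentially. bloch_dist q (?T (u (s (r n)))) g < d"
    unfolding L.limitin_metric by (auto simp: eventually_conj_iff)
  have gb: "g \<in> bloch q" using g little_bloch_subset by blast
  have close: "\<forall>\<^sub>F n in sequentially. bloch_norm q (\<lambda>z. ?T (u (s (r n))) z - g z) < d" if "0 < d" for d
    using dist [OF that] mapsb [OF u] gb by (simp add: bloch_dist_def)
  have "g z = 0" for z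
  proof (cases "z \<in> polydisk")
    case True
    obtain R where R: "0 \<le> R" "R < 1" "z \<in> closed_polydisk R" by (rule polydisk_exhaustion [OF True])
    obtain K where K: "0 < K" "\<And>(f :: complex ^ 'n \<Rightarrow> complex) z. f \<in> bloch q \<Longrightarrow>
        z \<in> closed_polydisk R \<Longrightarrow> cmod (f z) \<le> K * bloch_norm q f"
      using bloch_growth [OF R(1,2) q, where 'n = 'n] by blast
    have "(\<lambda>n. ?T (u (s (r n))) z) \<longlonglongrightarrow> g z"
    proof (rule tendstoI)
      fix d :: real assume "0 < d"
      then have "0 < d / K" using K(1) by simp
      from close [OF this] show "\<forall>\<^sub>F n in sequentially. dist (?T (u (s (r n))) z) (g z) < d"
      proof eventually_elim
        case (elim n)
        have "cmod (?T (u (s (r n))) z - g z) \<le> K * bloch_norm q (\<lambda>z. ?T (u (s (r n))) z - g z)"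
          by (rule K(2) [OF bloch_diff [OF mapsb [OF u] gb] R(3)])
        also have "\<dots> < d" using elim K(1) by (simp add: pos_less_divide_eq mult.commute)
        finally show ?case by (simp add: dist_norm)
      qed
    qed
    moreover have "(\<lambda>n. ?T (u (s (r n))) z) \<longlonglongrightarrow> 0"
    proof -
      have "(\<lambda>n. of_real (1 / B) * f n (\<phi> z)) \<longlonglongrightarrow> of_real (1 / B) * 0"
        by (intro tendsto_mult_left lim self_map_in_polydisk [OF \<phi> True])
      from LIMSEQ_subseq_LIMSEQ [OF this strict_mono_o [OF s(1) r]] show ?thesis
        using True by (simp add: composition_operator_def zero_ext_def u_def o_def)
    qed
    ultimately show ?thesis by (rule LIMSEQ_unique)
  next
    case False
    then show ?thesis using gb by (simp add: bloch_def)
  qed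
  then have "\<forall>\<^sub>F n in sequentially. bloch_norm q (?T (u (s (r n)))) < e / B"
    using close [of "e / B"] e B(1) by simp
  then obtain n where "bloch_norm q (?T (u (s (r n)))) < e / B" by (auto simp: eventually_sequentially)
  then have "B * bloch_norm q (?T (u (s (r n)))) < e" using B(1) by (simp add: pos_less_divide_eq mult.commute)
  then show False using Tf [of "s (r n)"] s(2) [of "r n"] by linarith
qed

lemma tendsto_one_minus_square:
  assumes "(\<lambda>n. cmod (w n)) \<longlonglongrightarrow> 1"
  shows "(\<lambda>n. 1 - (cmod (w n))\<^sup>2) \<longlonglongrightarrow> 0"
  using tendsto_diff [OF tendsto_const tendsto_power [OF assms, of 2], of 1] by simp

lemma tendsto_cmod_coordinate_1:
  fixes x :: "nat \<Rightarrow> complex ^ 'n"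
  assumes "\<And>n. 1 - 1 / real (Suc n) < cmod (x n $ l)" "\<And>n. x n \<in> polydisk"
  shows "(\<lambda>n. cmod (x n $ l)) \<longlonglongrightarrow> 1"
proof (rule tendsto_sandwich)
  show "(\<lambda>n. 1 - 1 / real (Suc n)) \<longlonglongrightarrow> 1"
    using tendsto_diff [OF tendsto_const [of 1] LIMSEQ_Suc [OF lim_1_over_n]] by simp
  show "\<forall>\<^sub>F n in sequentially. cmod (x n $ l) \<le> 1"
    using assms(2) by (auto simp: polydisk_def less_imp_le intro!: always_eventually)
qed (use assms(1) in \<open>auto intro!: always_eventually less_imp_le\<close>)

text \<open>The link from norms of images to the weights: one point and one direction of
  differentiation are singled out, and the test function decides which terms of the chain rule sum
  survive.\<close>

lemma partial_deriv_compose_le_bloch_norm: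
  assumes \<phi>: "holomorphic_self_map \<phi>" and f: "holomorphic_several f polydisk" and a: "a \<in> polydisk"
    and bl: "composition_operator \<phi> (zero_ext f) \<in> bloch q"
  shows "cmod (\<Sum>l\<in>UNIV. partial_deriv k (\<lambda>w. \<phi> w $ l) a * partial_deriv l f (\<phi> a)) *
    (1 - (cmod (a $ k))\<^sup>2) powr q \<le> bloch_norm q (composition_operator \<phi> (zero_ext f))"
proof -
  note hol = holomorphic_several_compose [OF \<phi> f]
  have "cmod (partial_deriv k (f \<circ> \<phi>) a) * (1 - (cmod (a $ k))\<^sup>2) powr q \<le> bloch_weight q (f \<circ> \<phi>) a"
    by (rule weighted_partial_deriv_le)
  also have "\<dots> = bloch_weight q (composition_operator \<phi> (zero_ext f)) a"
    by (simp add: composition_operator_zero_ext [OF \<phi>] bloch_weight_zero_ext [OF hol(1) a])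
  also have "\<dots> \<le> bloch_norm q (composition_operator \<phi> (zero_ext f))"
    by (rule bloch_weight_le_norm [OF bl a])
  finally show ?thesis unfolding hol(2) [OF a] .
qed

context
  fixes \<phi> :: "complex ^ 'n \<Rightarrow> complex ^ 'n" and p q :: real
  assumes \<phi>: "holomorphic_self_map \<phi>" and p: "1 \<le> p" and q: "0 < q"
    and comp: "compact_operator (little_bloch p) (bloch_norm p) (little_bloch_topology q) (composition_operator \<phi>)"
begin

lemma composition_operator_in_bloch:
  "h \<in> little_bloch p \<Longrightarrow> composition_operator \<phi> h \<in> bloch q"
  using comp little_bloch_subset by (auto simp: compact_operator_def linear_between_def topspace_little_bloch)

text \<open>The direction \<open>k n\<close> may vary with n, so that sequences of counterexamples
  in the uniform statement below can be treated without first fixing k.\<close>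

lemma composition_weight_vanishes:
  assumes a: "\<And>n. a n \<in> polydisk" and lim: "(\<lambda>n. cmod (\<phi> (a n) $ l)) \<longlonglongrightarrow> 1"
  shows "(\<lambda>n. composition_weight p q \<phi> (k n) l (a n)) \<longlonglongrightarrow> 0"
proof -
  define w where "w n = \<phi> (a n) $ l" for n
  have \<phi>a: "\<phi> (a n) \<in> polydisk" for n by (rule self_map_in_polydisk [OF \<phi> a])
  then have w: "cmod (w n) < 1" for n by (simp add: w_def polydisk_def)
  have p0: "0 < p" using p by simp
  define m where "m = nat \<lceil>p\<rceil>"
  have "p \<le> real m" unfolding m_def by (rule real_nat_ceiling_ge)
  moreover from this have "1 \<le> m" using p by linarith
  ultimately have m: "1 \<le> m" "p \<le> real m" by simp_all
  have A0: "(\<lambda>n. 1 - (cmod (w n))\<^sup>2) \<longlonglongrightarrow> 0"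
    using tendsto_one_minus_square [OF lim] by (simp add: w_def)
  have A: "0 < 1 - (cmod (w n))\<^sup>2" for n using w by (simp add: abs_square_less_1)
  let ?f = "\<lambda>n. derivative_peak p l (w n)"
  have C1: "C1_polynomial_limit (?f n)" for n by (rule derivative_peak_C1_limit [OF p0 w])
  then have hol: "holomorphic_several (?f n) polydisk" for n
    by (simp add: C1_polynomial_limit_def bounded_C1_def)
  have little: "zero_ext (?f n) \<in> little_bloch p" for n
    using C1_polynomial_limit_in_little_bloch [OF C1] p0 by simp
  have "(\<lambda>n. zero_ext (?f n) z) \<longlonglongrightarrow> 0" if z: "z \<in> polydisk" for z
  proof (rule Lim_null_comparison)
    have "(\<lambda>n. (1 - (cmod (w n))\<^sup>2) powr (real m + 1 - p)) \<longlonglongrightarrow> 0 powr (real m + 1 - p)"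
      using m A by (intro tendsto_powr2 A0 tendsto_const) (auto simp: less_imp_le)
    then show "(\<lambda>n. (1 - (cmod (w n))\<^sup>2) powr (real m + 1 - p) * (1 / (1 - cmod (z $ l))) ^ m) \<longlonglongrightarrow> 0"
      using tendsto_mult_right [of _ 0 _ "(1 / (1 - cmod (z $ l))) ^ m"] by simp
    show "\<forall>\<^sub>F n in sequentially. norm (zero_ext (?f n) z)
        \<le> (1 - (cmod (w n))\<^sup>2) powr (real m + 1 - p) * (1 / (1 - cmod (z $ l))) ^ m"
      using cmod_derivative_peak_le [OF p0 w z] z by (simp add: zero_ext_def m_def)
  qed
  with bloch_norm_derivative_peak [OF p0 w]
  have conv: "(\<lambda>n. bloch_norm q (composition_operator \<phi> (zero_ext (?f n)))) \<longlonglongrightarrow> 0"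
    using p0 q by (intro compact_operator_norm_tendsto_0 [OF \<phi> _ _ comp little]) auto
  have "\<forall>\<^sub>F n in sequentially. cmod (w n) > 1 / 2"
    using order_tendstoD(1) [OF lim, of "1 / 2"] by (simp add: w_def)
  \<comment> \<open>The derivative of the peak carries the factor m |w|; it exceeds 1/2 eventually,
    which costs the factor 2.\<close>
  then have le: "\<forall>\<^sub>F n in sequentially. norm (composition_weight p q \<phi> (k n) l (a n))
      \<le> 2 * bloch_norm q (composition_operator \<phi> (zero_ext (?f n)))"
  proof eventually_elim
    case (elim n)
    define t where "t = composition_weight p q \<phi> (k n) l (a n)"
    define d where "d = cmod (partial_deriv (k n) (\<lambda>w. \<phi> w $ l) (a n))"
    define Z where "Z = (1 - (cmod (a n $ k n))\<^sup>2) powr q"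
    define A where "A = 1 - (cmod (w n))\<^sup>2"
    have A: "0 < A" using \<open>0 < 1 - (cmod (w n))\<^sup>2\<close> by (simp add: A_def)
    have t: "0 \<le> t" "t = d * (Z / A powr p)"
      by (simp_all add: t_def composition_weight_nonneg) (simp add: composition_weight_def d_def Z_def A_def w_def)
    have cnj: "cnj (w n) * w n = of_real ((cmod (w n))\<^sup>2)"
      using complex_norm_square [of "w n"] by (simp add: mult.commute)
    then have one: "1 - cnj (w n) * w n = of_real A" by (simp add: A_def)
    have peak: "partial_deriv j (?f n) (\<phi> (a n)) = (if j = l then of_real (A powr (real m + 1 - p)) *
        (of_nat m * cnj (w n) / of_real A ^ (m + 1)) else 0)" for j
      using partial_deriv_derivative_peak [OF p0 w \<phi>a] one by (simp add: m_def A_def w_def)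
    \<comment> \<open>The balance of exponents built into the test function: exactly the denominator
      of the composition weight remains.\<close>
    have pw: "A powr (real m + 1 - p) / A ^ (m + 1) = 1 / A powr p"
    proof -
      have "A powr (real m + 1 - p) * A powr p = A powr (real (m + 1))" by (simp add: add.commute flip: powr_add)
      also have "\<dots> = A ^ (m + 1)" using A by (rule powr_realpow)
      finally show ?thesis using A by (simp add: field_simps)
    qed
    have "cmod (\<Sum>j\<in>UNIV. partial_deriv (k n) (\<lambda>w. \<phi> w $ j) (a n) * partial_deriv j (?f n) (\<phi> (a n)))
        = d * (A powr (real m + 1 - p) * (real m * cmod (w n) / A ^ (m + 1)))"
      using A by (simp add: peak if_distrib [of "\<lambda>x. _ * x"] norm_mult norm_divide norm_power d_def cong: if_cong)
    also have "\<dots> = real m * cmod (w n) * d * (A powr (real m + 1 - p) / A ^ (m + 1))" by simp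
    also have "\<dots> = real m * cmod (w n) * d * (1 / A powr p)" unfolding pw ..
    finally have "real m * cmod (w n) * t \<le> bloch_norm q (composition_operator \<phi> (zero_ext (?f n)))"
      using partial_deriv_compose_le_bloch_norm [OF \<phi> hol [of n] a [of n] composition_operator_in_bloch [OF little [of n]], where k = "k n"]
      by (simp add: t(2) Z_def)
    moreover have "1 * (1 / 2) * t \<le> real m * cmod (w n) * t"
      using m elim t(1) by (intro mult_right_mono mult_mono) auto
    ultimately show ?case using t(1) by (simp add: t_def)
  qed
  show ?thesis
    by (rule Lim_null_comparison [OF le]) (use tendsto_mult_left [OF conv, of 2] in simp)
qed

lemma partial_deriv_vanishes_off_diagonal:
  assumes lm: "l \<noteq> m" and a: "\<And>n. a n \<in> polydisk" and lim: "(\<lambda>n. cmod (\<phi> (a n) $ m)) \<longlonglongrightarrow> 1"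
  shows "(\<lambda>n. cmod (partial_deriv (k n) (\<lambda>w. \<phi> w $ l) (a n)) * (1 - (cmod (a n $ k n))\<^sup>2) powr q) \<longlonglongrightarrow> 0"
proof -
  define w where "w n = \<phi> (a n) $ m" for n
  define b where "b n = \<phi> (a n) $ l" for n
  have \<phi>a: "\<phi> (a n) \<in> polydisk" for n by (rule self_map_in_polydisk [OF \<phi> a])
  then have w: "cmod (w n) < 1" and b: "cmod (b n) < 1" for n by (simp_all add: w_def b_def polydisk_def)
  have A0: "(\<lambda>n. 1 - (cmod (w n))\<^sup>2) \<longlonglongrightarrow> 0"
    using tendsto_one_minus_square [OF lim] by (simp add: w_def)
  let ?f = "\<lambda>n. mixed_peak l m (b n) (w n)"
  have C1: "C1_polynomial_limit (?f n)" for n by (rule mixed_peak_C1_limit [OF p w b lm])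
  then have hol: "holomorphic_several (?f n) polydisk" for n
    by (simp add: C1_polynomial_limit_def bounded_C1_def)
  have little: "zero_ext (?f n) \<in> little_bloch p" for n
    using C1_polynomial_limit_in_little_bloch [OF C1] p by simp
  have "(\<lambda>n. zero_ext (?f n) z) \<longlonglongrightarrow> 0" if z: "z \<in> polydisk" for z
  proof (rule Lim_null_comparison)
    show "(\<lambda>n. 2 * ((1 - (cmod (w n))\<^sup>2) * (1 / (1 - cmod (z $ m))))) \<longlonglongrightarrow> 0"
      using tendsto_mult_left [OF tendsto_mult_right [OF A0, of "1 / (1 - cmod (z $ m))"], of 2] by simp
    show "\<forall>\<^sub>F n in sequentially. norm (zero_ext (?f n) z)
        \<le> 2 * ((1 - (cmod (w n))\<^sup>2) * (1 / (1 - cmod (z $ m))))"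
      using cmod_mixed_peak_le [OF p w b lm z] z by (simp add: zero_ext_def)
  qed
  with bloch_norm_mixed_peak [OF p w b lm]
  have conv: "(\<lambda>n. bloch_norm q (composition_operator \<phi> (zero_ext (?f n)))) \<longlonglongrightarrow> 0"
    using p q by (intro compact_operator_norm_tendsto_0 [OF \<phi> _ _ comp little]) auto
  show ?thesis
  proof (rule Lim_null_comparison [OF _ conv], intro always_eventually allI)
    fix n
    define A where "A = 1 - (cmod (w n))\<^sup>2"
    have A: "0 < A" using w by (simp add: A_def abs_square_less_1)
    have "cnj (w n) * w n = of_real ((cmod (w n))\<^sup>2)"
      using complex_norm_square [of "w n"] by (simp add: mult.commute)
    then have one: "1 - cnj (w n) * w n = of_real A" by (simp add: A_def)
    have "of_real A * (1 / (1 - cnj (w n) * w n)) = (1 :: complex)"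
      unfolding one using A by simp
    \<comment> \<open>At \<phi> (a n) the factor \<open>z $ l - b\<close> is 0 and the normalised
      kernel is 1, so the chain rule sum reduces to the derivative of \<phi>_l.\<close>
    then have peak: "partial_deriv j (?f n) (\<phi> (a n)) = (if j = l then 1 else 0)" for j
      using partial_deriv_mixed_peak [OF p w [of n] b [of n] lm \<phi>a [of n], where k = j] by (simp add: w_def b_def A_def)
    show "norm (cmod (partial_deriv (k n) (\<lambda>w. \<phi> w $ l) (a n)) * (1 - (cmod (a n $ k n))\<^sup>2) powr q)
        \<le> bloch_norm q (composition_operator \<phi> (zero_ext (?f n)))"
      using partial_deriv_compose_le_bloch_norm [OF \<phi> hol [of n] a [of n] composition_operator_in_bloch [OF little [of n]], where k = "k n"]
      by (simp add: peak if_distrib [of "\<lambda>x. _ * x"] cong: if_cong)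
  qed
qed

section \<open>From sequences to uniform estimates near the boundary\<close>

lemma composition_weight_uniformly_small:
  assumes e: "0 < e"
  shows "\<exists>R<1. \<forall>z\<in>polydisk. \<forall>k l. R < cmod (\<phi> z $ l) \<longrightarrow> composition_weight p q \<phi> k l z < e"
proof -
  have "\<exists>R<1. \<forall>z\<in>polydisk. \<forall>k. R < cmod (\<phi> z $ l) \<longrightarrow> composition_weight p q \<phi> k l z < e" for l
  proof (rule ccontr)
    assume neg: "\<not> ?thesis"
    have "\<exists>z k. z \<in> polydisk \<and> R < cmod (\<phi> z $ l) \<and> e \<le> composition_weight p q \<phi> k l z" if "R < 1" for R
      using neg that by (meson not_less)
    then have "\<forall>n. \<exists>z k. z \<in> polydisk \<and> 1 - 1 / real (Suc n) < cmod (\<phi> z $ l) \<and> e \<le> composition_weight p q \<phi> k l z"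
      by simp
    then obtain a k where a: "\<And>n. a n \<in> polydisk" and big: "\<And>n. e \<le> composition_weight p q \<phi> (k n) l (a n)"
      and lower: "\<And>n. 1 - 1 / real (Suc n) < cmod (\<phi> (a n) $ l)" by metis
    have "(\<lambda>n. cmod (\<phi> (a n) $ l)) \<longlonglongrightarrow> 1"
      by (rule tendsto_cmod_coordinate_1 [OF lower self_map_in_polydisk [OF \<phi> a]])
    from order_tendstoD(2) [OF composition_weight_vanishes [OF a this, of k] e] big show False
      by (auto simp: eventually_sequentially not_less [symmetric])
  qed
  then obtain R where R: "\<And>l. R l < 1"
    "\<And>l z k. z \<in> polydisk \<Longrightarrow> R l < cmod (\<phi> z $ l) \<Longrightarrow> composition_weight p q \<phi> k l z < e" by metis
  have "R l \<le> Max (range R)" for l by simp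
  then show ?thesis
    using R by (intro exI [of _ "Max (range R)"]) (auto intro: le_less_trans)
qed

lemma partial_deriv_uniformly_small:
  assumes e: "0 < e"
  shows "\<exists>R<1. \<forall>z\<in>polydisk. \<forall>k l m. l \<noteq> m \<longrightarrow> R < cmod (\<phi> z $ m) \<longrightarrow>
    cmod (partial_deriv k (\<lambda>w. \<phi> w $ l) z) * (1 - (cmod (z $ k))\<^sup>2) powr q < e"
proof -
  define d where "d k l z = cmod (partial_deriv k (\<lambda>w. \<phi> w $ l) z) * (1 - (cmod (z $ k))\<^sup>2) powr q" for k l z
  have "\<exists>R<1. \<forall>z\<in>polydisk. \<forall>k. l \<noteq> m \<longrightarrow> R < cmod (\<phi> z $ m) \<longrightarrow> d k l z < e" for l m
  proof (rule ccontr)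
    assume neg: "\<not> ?thesis"
    have *: "\<exists>z k. l \<noteq> m \<and> z \<in> polydisk \<and> R < cmod (\<phi> z $ m) \<and> e \<le> d k l z" if "R < 1" for R
      using neg that by (meson not_less)
    then have lm: "l \<noteq> m" using zero_less_one by blast
    from * have "\<forall>n. \<exists>z k. z \<in> polydisk \<and> 1 - 1 / real (Suc n) < cmod (\<phi> z $ m) \<and> e \<le> d k l z"
      by simp
    then obtain a k where a: "\<And>n. a n \<in> polydisk" and big: "\<And>n. e \<le> d (k n) l (a n)"
      and lower: "\<And>n. 1 - 1 / real (Suc n) < cmod (\<phi> (a n) $ m)" by metis
    have "(\<lambda>n. cmod (\<phi> (a n) $ m)) \<longlonglongrightarrow> 1"
      by (rule tendsto_cmod_coordinate_1 [OF lower self_map_in_polydisk [OF \<phi> a]])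
    from order_tendstoD(2) [OF partial_deriv_vanishes_off_diagonal [OF lm a this, of k] e] big show False
      by (auto simp: eventually_sequentially not_less [symmetric] d_def)
  qed
  then obtain R where R: "\<And>l m. R l m < 1"
    "\<And>l m z k. z \<in> polydisk \<Longrightarrow> l \<noteq> m \<Longrightarrow> R l m < cmod (\<phi> z $ m) \<Longrightarrow> d k l z < e" by metis
  define M where "M = Max (range (\<lambda>(l, m). R l m))"
  have "R l m \<le> M" for l m unfolding M_def by (rule Max_ge) (auto intro: rev_image_eqI [of "(l, m)"])
  moreover have "M < 1" unfolding M_def using R(1) by (subst Max_less_iff) auto
  ultimately show ?thesis
    unfolding d_def [symmetric] using R(2) by (intro exI [of _ M]) (blast intro: le_less_trans)
qed

lemma composition_operator_vanishing_condition:
  "vanishes_as_image_to_boundary \<phi> (\<lambda>z. \<Sum>k\<in>UNIV. \<Sum>l\<in>UNIV. composition_weight p q \<phi> k l z)"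
  unfolding vanishes_as_image_to_boundary_iff [OF \<phi>]
proof (intro allI impI)
  fix e :: real assume "0 < e"
  \<comment> \<open>The number of pairs (k, l): each summand gets the share e / N.\<close>
  define N where "N = real CARD('n) * real CARD('n)"
  have N: "0 < N" by (simp add: N_def)
  obtain R1 where R1: "R1 < 1" "\<And>z k l. z \<in> polydisk \<Longrightarrow> R1 < cmod (\<phi> z $ l) \<Longrightarrow>
      composition_weight p q \<phi> k l z < e / N"
    using composition_weight_uniformly_small [of "e / N"] \<open>0 < e\<close> N by auto
  define r where "r = max 0 R1"
  have r: "0 \<le> r" "r < 1" "R1 \<le> r" using R1 by (auto simp: r_def)
  define c where "c = (1 - r\<^sup>2) powr p"
  have r2: "0 < 1 - r\<^sup>2" using r by (simp add: abs_square_less_1)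
  then have c: "0 < c" by (simp add: c_def)
  \<comment> \<open>The order of choice matters: \<open>R1\<close> fixes r and thus the lower bound
    \<open>c\<close> for the denominators with |\<phi>_l| \<le> r; only then can the numerators be
    required to be below e / N times \<open>c\<close>.\<close>
  obtain R2 where R2: "R2 < 1" "\<And>z k l m. z \<in> polydisk \<Longrightarrow> l \<noteq> m \<Longrightarrow> R2 < cmod (\<phi> z $ m) \<Longrightarrow>
      cmod (partial_deriv k (\<lambda>w. \<phi> w $ l) z) * (1 - (cmod (z $ k))\<^sup>2) powr q < e / N * c"
    using partial_deriv_uniformly_small [of "e / N * c"] \<open>0 < e\<close> N c by auto
  show "\<exists>R. 0 \<le> R \<and> R < 1 \<and> (\<forall>z\<in>polydisk. \<phi> z \<notin> closed_polydisk R \<longrightarrow>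
      \<bar>\<Sum>k\<in>UNIV. \<Sum>l\<in>UNIV. composition_weight p q \<phi> k l z\<bar> < e)"
  proof (intro exI [of _ "max r R2"] conjI ballI impI)
    fix z :: "complex ^ 'n" assume z: "z \<in> polydisk" and "\<phi> z \<notin> closed_polydisk (max r R2)"
    then obtain m where m: "r < cmod (\<phi> z $ m)" "R2 < cmod (\<phi> z $ m)"
      by (auto simp: closed_polydisk_def not_le)
    have small: "composition_weight p q \<phi> k l z < e / N" for k l
    \<comment> \<open>Some coordinate m is close to the unit circle. Either coordinate l is as well,
      and its weight is small by itself, or l differs from m and the smallness of the numerator
      decides.\<close>
    proof (cases "r < cmod (\<phi> z $ l)")
      case True
      then show ?thesis using R1(2) [OF z] r(3) by auto
    next
      case False
      then have "l \<noteq> m" using m(1) by auto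
      have "(cmod (\<phi> z $ l))\<^sup>2 \<le> r\<^sup>2" using False by (intro power_mono) auto
      then have 1: "c \<le> (1 - (cmod (\<phi> z $ l))\<^sup>2) powr p"
        unfolding c_def using r2 p by (intro powr_mono2) auto
      have "composition_weight p q \<phi> k l z
          \<le> cmod (partial_deriv k (\<lambda>w. \<phi> w $ l) z) * (1 - (cmod (z $ k))\<^sup>2) powr q / c"
        unfolding composition_weight_def times_divide_eq_right
        using 1 c by (intro divide_left_mono mult_pos_pos) auto
      also have "\<dots> < e / N" using R2(2) [OF z \<open>l \<noteq> m\<close> m(2)] c by (simp add: pos_divide_less_eq)
      finally show ?thesis .
    qed
    have "(\<Sum>k\<in>UNIV. \<Sum>l\<in>UNIV. composition_weight p q \<phi> k l z)
        < (\<Sum>k\<in>(UNIV :: 'n set). \<Sum>l\<in>(UNIV :: 'n set). e / N)"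
      by (intro sum_strict_mono small) auto
    also have "\<dots> = e" by (simp add: N_def)
    finally show "\<bar>\<Sum>k\<in>UNIV. \<Sum>l\<in>UNIV. composition_weight p q \<phi> k l z\<bar> < e"
      by (simp add: sum_nonneg composition_weight_nonneg)
  qed (use r R2 in auto)
qed

lemma composition_operator_monomial_in_little_bloch:
  "zero_ext (\<lambda>z. monomial \<gamma> (\<phi> z)) \<in> little_bloch q"
proof -
  have "monomial \<gamma> \<in> multipolynomials"
    using multipolynomials_indexed_sum [of "{()}" "\<lambda>_. 1" "\<lambda>_. \<gamma>"] by simp
  then have "zero_ext (monomial \<gamma>) \<in> little_bloch p"
    using polynomial_functions_in_little_bloch [of p] p by (auto simp: polynomial_functions_eq)
  then have "composition_operator \<phi> (zero_ext (monomial \<gamma>)) \<in> little_bloch q"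
    using comp by (auto simp: compact_operator_def linear_between_def topspace_little_bloch)
  then show ?thesis by (simp add: composition_operator_zero_ext [OF \<phi>] o_def)
qed

end

theorem corollary6p4:
  fixes \<phi> :: "complex ^ 'n \<Rightarrow> complex ^ 'n" and p q :: real
  assumes "holomorphic_self_map \<phi>" and "p \<ge> 1" and "q > 0"
  shows "compact_operator (little_bloch p) (bloch_norm p) (little_bloch_topology q)
           (composition_operator \<phi>)
         \<longleftrightarrow>
         (\<forall>\<gamma> :: 'n \<Rightarrow> nat. zero_ext (\<lambda>z. monomial \<gamma> (\<phi> z)) \<in> little_bloch q) \<and>
         vanishes_as_image_to_boundary \<phi>
           (\<lambda>z. \<Sum>k\<in>UNIV. \<Sum>l\<in>UNIV. cmod (partial_deriv k (\<lambda>w. \<phi> w $ l) z) *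
                  ((1 - (cmod (z $ k))\<^sup>2) powr q / (1 - (cmod (\<phi> z $ l))\<^sup>2) powr p))"
proof
  assume "compact_operator (little_bloch p) (bloch_norm p) (little_bloch_topology q) (composition_operator \<phi>)"
  note comp = assms this
  from composition_operator_monomial_in_little_bloch [OF comp] composition_operator_vanishing_condition [OF comp]
  show "(\<forall>\<gamma> :: 'n \<Rightarrow> nat. zero_ext (\<lambda>z. monomial \<gamma> (\<phi> z)) \<in> little_bloch q) \<and>
      vanishes_as_image_to_boundary \<phi>
        (\<lambda>z. \<Sum>k\<in>UNIV. \<Sum>l\<in>UNIV. cmod (partial_deriv k (\<lambda>w. \<phi> w $ l) z) *
               ((1 - (cmod (z $ k))\<^sup>2) powr q / (1 - (cmod (\<phi> z $ l))\<^sup>2) powr p))"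
    unfolding composition_weight_def by blast
next
  assume "(\<forall>\<gamma> :: 'n \<Rightarrow> nat. zero_ext (\<lambda>z. monomial \<gamma> (\<phi> z)) \<in> little_bloch q) \<and>
      vanishes_as_image_to_boundary \<phi>
        (\<lambda>z. \<Sum>k\<in>UNIV. \<Sum>l\<in>UNIV. cmod (partial_deriv k (\<lambda>w. \<phi> w $ l) z) *
               ((1 - (cmod (z $ k))\<^sup>2) powr q / (1 - (cmod (\<phi> z $ l))\<^sup>2) powr p))"
  then show "compact_operator (little_bloch p) (bloch_norm p) (little_bloch_topology q) (composition_operator \<phi>)"
    using assms by (intro composition_operator_compactI) (simp_all add: composition_weight_def)
qed

end
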